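(* Let $m\in\mathbb N$, let $Q,B$ be real $m\times m$ matrices with $Q=Q^\star\ge 0$, and suppose that $Q(t)=\int_0^t e^{sB}Qe^{sB^\star}\,ds$ is positive definite for every $t>0$. For $x,y\in\mathbb R^m$ and $t>0$ set $$\mathcal S(x,y,t)=(4\pi)^{-\frac m2}\,\frac{e^{-\frac{i m\pi}{4}}}{\sqrt{\det Q(t)}}\;e^{\,i\,\frac{\langle Q(t)^{-1}(y-x),\,y-x\rangle}{4}} .$$ Given $\varphi\in\mathscr S(\mathbb R^m)$, the function $f$ defined by $$f(x,t)=\int_{\mathbb R^m}\mathcal S(e^{tB}x,y,t)\,\varphi(y)\,dy\quad (t>0),\qquad f(x,0)=\varphi(x),$$ is the unique solution of the Cauchy problem $$\begin{cases}\partial_t f-i\operatorname{tr}(Q\nabla^2 f)-\langle Bx,\nabla f\rangle=0 & \text{in }\mathbb R^m\times(0,\infty),\\ f(x,0)=\varphi(x),& x\in\mathbb R^m,\end{cases}$$ such that $f(\cdot,t)\in\mathscr S(\mathbb R^m)$ for every $t\ge 0$.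
   Context: $\mathscr S(\mathbb R^m)$ is the Schwartz space of complex-valued rapidly decreasing functions on $\mathbb R^m$; $^\star$ denotes transpose; $\nabla$ and $\nabla^2$ are the gradient and Hessian in $x$; $\langle\cdot,\cdot\rangle$ is the (bilinear) Euclidean product; $i^2=-1$. A solution of the Cauchy problem is understood in the classical sense: a complex-valued function $f$, continuous on $\mathbb R^m\times[0,\infty)$, with $\partial_t f,\nabla f,\nabla^2 f$ existing and continuous on $\mathbb R^m\times(0,\infty)$, satisfying the equation pointwise and equal to $\varphi$ at $t=0$. (The positivity of $Q(t)$ for one $t>0$ is equivalent to its positivity for all $t>0$.) *)

theory Defs
  imports "HOL-Analysis.Analysis"
begin

subsection \<open>Matrices\<close>

primrec mpow :: "real^'n^'n \<Rightarrow> nat \<Rightarrow> real^'n^'n" where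
  "mpow A 0 = mat 1"
| "mpow A (Suc k) = A ** mpow A k"

text \<open>The type of square matrices is not an instance of \<^class>\<open>real_normed_algebra_1\<close> (its
  multiplication \<open>*\<close> is componentwise), so \<^const>\<open>exp\<close> is not the matrix exponential.\<close>

definition mexp :: "real^'n^'n \<Rightarrow> real^'n^'n" where
  "mexp A = (\<Sum>k. (1 / fact k) *\<^sub>R mpow A k)"

definition pos_semidefinite :: "real^'n^'n \<Rightarrow> bool" where
  "pos_semidefinite A \<longleftrightarrow> (\<forall>x. 0 \<le> (A *v x) \<bullet> x)"

definition pos_definite :: "real^'n^'n \<Rightarrow> bool" where
  "pos_definite A \<longleftrightarrow> (\<forall>x. x \<noteq> 0 \<longrightarrow> 0 < (A *v x) \<bullet> x)"

definition Qt :: "real^'n^'n \<Rightarrow> real^'n^'n \<Rightarrow> real \<Rightarrow> real^'n^'n" where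
  "Qt Q B t = integral {0..t} (\<lambda>s. mexp (s *\<^sub>R B) ** Q ** mexp (s *\<^sub>R transpose B))"


subsection \<open>Partial derivatives and Schwartz functions\<close>

definition has_pdiff :: "'n \<Rightarrow> (real^'n \<Rightarrow> complex) \<Rightarrow> real^'n \<Rightarrow> bool" where
  "has_pdiff i g x \<longleftrightarrow> (\<lambda>s::real. g (x + s *\<^sub>R axis i 1)) differentiable (at 0)"

definition pdiff :: "'n \<Rightarrow> (real^'n \<Rightarrow> complex) \<Rightarrow> real^'n \<Rightarrow> complex" where
  "pdiff i g x = vector_derivative (\<lambda>s::real. g (x + s *\<^sub>R axis i 1)) (at 0)"

text \<open>A list of coordinate indices plays the role of a multi-index.\<close>

primrec pdiffs :: "'n list \<Rightarrow> (real^'n \<Rightarrow> complex) \<Rightarrow> real^'n \<Rightarrow> complex" where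
  "pdiffs [] g = g"
| "pdiffs (i # is) g = pdiff i (pdiffs is g)"

definition C_infinity :: "(real^'n \<Rightarrow> complex) \<Rightarrow> bool" where
  "C_infinity g \<longleftrightarrow>
     (\<forall>is. continuous_on UNIV (pdiffs is g) \<and> (\<forall>i x. has_pdiff i (pdiffs is g) x))"

definition schwartz :: "(real^'n \<Rightarrow> complex) \<Rightarrow> bool" where
  "schwartz g \<longleftrightarrow>
     C_infinity g \<and> (\<forall>is k. bounded (range (\<lambda>x. norm x ^ k *\<^sub>R pdiffs is g x)))"

definition grad :: "(real^'n \<Rightarrow> complex) \<Rightarrow> real^'n \<Rightarrow> complex^'n" where
  "grad g x = (\<chi> i. pdiff i g x)"

definition hess :: "(real^'n \<Rightarrow> complex) \<Rightarrow> real^'n \<Rightarrow> complex^'n^'n" where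
  "hess g x = (\<chi> i j. pdiff i (pdiff j g) x)"


subsection \<open>The Cauchy problem\<close>

text \<open>The inner product \<open>\<bullet>\<close> is only real-valued, hence a separate bilinear pairing
  of a real with a complex vector.\<close>

definition bilin :: "real^'n \<Rightarrow> complex^'n \<Rightarrow> complex" where
  "bilin v w = (\<Sum>i\<in>UNIV. of_real (v $ i) * w $ i)"

text \<open>Only the values \<open>f x t\<close> with \<open>t \<ge> 0\<close> matter.\<close>

definition classical_solution ::
  "real^'n^'n \<Rightarrow> real^'n^'n \<Rightarrow> (real^'n \<Rightarrow> complex) \<Rightarrow> (real^'n \<Rightarrow> real \<Rightarrow> complex) \<Rightarrow> bool" where
  "classical_solution Q B \<phi> f \<longleftrightarrow>
     continuous_on (UNIV \<times> {0..}) (\<lambda>(x, t). f x t) \<and>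
     (\<forall>x. \<forall>t>0. (f x) differentiable (at t)) \<and>
     (\<forall>i x. \<forall>t>0. has_pdiff i (\<lambda>y. f y t) x) \<and>
     (\<forall>i j x. \<forall>t>0. has_pdiff i (pdiff j (\<lambda>y. f y t)) x) \<and>
     continuous_on (UNIV \<times> {0<..}) (\<lambda>(x, t). vector_derivative (f x) (at t)) \<and>
     continuous_on (UNIV \<times> {0<..}) (\<lambda>(x, t). grad (\<lambda>y. f y t) x) \<and>
     continuous_on (UNIV \<times> {0<..}) (\<lambda>(x, t). hess (\<lambda>y. f y t) x) \<and>
     (\<forall>x. \<forall>t>0. vector_derivative (f x) (at t)
          - \<i> * trace (map_matrix of_real Q ** hess (\<lambda>y. f y t) x)
          - bilin (B *v x) (grad (\<lambda>y. f y t) x) = 0) \<and>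
     (\<forall>x. f x 0 = \<phi> x)"

definition kernel ::
  "real^'n^'n \<Rightarrow> real^'n^'n \<Rightarrow> real^'n \<Rightarrow> real^'n \<Rightarrow> real \<Rightarrow> complex" where
  "kernel Q B x y t =
     of_real ((4 * pi) powr (- (real CARD('n) / 2)))
     * (exp (- (\<i> * of_real (real CARD('n) * pi / 4))) / of_real (sqrt (det (Qt Q B t))))
     * exp (\<i> * of_real (((matrix_inv (Qt Q B t) *v (y - x)) \<bullet> (y - x)) / 4))"

definition sol ::
  "real^'n^'n \<Rightarrow> real^'n^'n \<Rightarrow> (real^'n \<Rightarrow> complex) \<Rightarrow> real^'n \<Rightarrow> real \<Rightarrow> complex" where
  "sol Q B \<phi> x t =
     (if t > 0 then (LINT y|lborel. kernel Q B (mexp (t *\<^sub>R B) *v x) y t * \<phi> y) else \<phi> x)"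

end

theory Submission
  imports Defs "HOL-Probability.Distributions" "HOL-Probability.Sinc_Integral"
begin

text \<open>Writing \<open>f(x,t) = u(e\<^bsup>tB\<^esup>x, t)\<close> removes the drift: \<open>u\<close> solves
\<open>\<partial>\<^sub>t u = i tr(e\<^bsup>tB\<^esup> Q e\<^bsup>tB*\<^esup> \<nabla>\<^sup>2u)\<close>, and on the Fourier side this is multiplication by
\<open>e\<^bsup>-i\<langle>Q(t)\<xi>,\<xi>\<rangle>\<^esup>\<close>. Hence the solution is
\<open>f(x,t) = \<integral> exp(i\<langle>e\<^bsup>tB\<^esup>x,\<xi>\<rangle> - i\<langle>Q(t)\<xi>,\<xi>\<rangle>) h(\<xi>) d\<xi>\<close>, where \<open>h\<close> is \<open>(2\<pi>)\<^bsup>-m\<^esup>\<close> times the Fourier transform of \<open>\<phi>\<close>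
(\<open>evol\<close>). In contrast to the kernel this expression stays regular as \<open>t \<rightarrow> 0\<close>, and existence is read off from it.
Differentiation under the integral gives the equation (\<open>classical_solution_evol\<close>). Derivatives
in \<open>x\<close> and multiplication by \<open>(e\<^bsup>tB\<^esup>x)\<^sub>j\<close> turn into operations on the Schwartz amplitude \<open>h\<close>
(\<open>osc_has_pd\<close>, \<open>osc_mult\<close>), so the integral is again a Schwartz function of \<open>x\<close>, with bounds
that are uniform for \<open>t\<close> in bounded intervals (\<open>osc_decay\<close>). The kernel appears for \<open>t > 0\<close> by inserting a
Gaussian factor that is removed in the limit, exchanging the integrals and evaluating a complex
Gaussian integral (\<open>integral_gauss\<close>, \<open>fourier_chirp_kernel\<close>); the same regularisation at \<open>t = 0\<close> is
Fourier inversion (\<open>fourier_inversion\<close>). Together these say \<open>sol = evol\<close> (\<open>sol_eq_evol\<close>).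

For uniqueness let \<open>w\<close> be the difference of two solutions and
\<open>H(t) = e\<^bsup>t tr B\<^esup> \<integral>|w(x,t)|\<^sup>2 dx\<close>, which formally is constant. The decay of \<open>w(\<cdot>,t)\<close> in \<open>x\<close> is not assumed to be
uniform in \<open>t\<close>, so \<open>H\<close> cannot simply be differentiated: a priori mass could enter from
infinity. The proof has two steps.

If \<open>H\<close> is bounded on a time interval, then it is constant there. Indeed \<open>w\<close> can be
paired with any of the explicit solutions, localised by a cutoff of radius \<open>R\<close>; the error is an integral of
\<open>w\<close> against a rapidly decreasing function of size \<open>O(1/R)\<close>, so the pairing is conserved
(\<open>pairing_constant\<close>). The explicit evolution is reversible: it attains every Schwartz function at any given
time (\<open>evol_surjective\<close>), in particular \<open>w(\<cdot>,s)\<close>, and this gives \<open>H(s) \<le> H(t)\<close> for all \<open>s, t\<close> in the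
interval (\<open>energy_constant_if_bounded\<close>).

As a supremum of energies in balls \<open>H\<close> is lower semicontinuous, so the Baire category theorem applies to the closed set \<open>K\<close> of times near
which \<open>H\<close> is unbounded. If \<open>K\<close> were nonempty, \<open>H\<close> would be bounded on some portion of \<open>K\<close>; on
each gap of \<open>K\<close> the first step makes \<open>H\<close> constant up to and including an end point lying in \<open>K\<close>. So
\<open>H\<close> would be bounded near a point of \<open>K\<close>, a contradiction
(\<open>bounded_interval_constancy_extends\<close>). Hence \<open>H\<close> is constant, and it vanishes at \<open>t = 0\<close>.\<close>

section \<open>Integration on Euclidean space\<close>

lemma matvec_measurable [measurable]:
  fixes A :: "real^'n^'n"
  shows "(\<lambda>x. A *v x) \<in> borel_measurable borel"
  by (intro borel_measurable_continuous_onI linear_continuous_on linear_linear[THEN iffD2] matrix_vector_mul_linear)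

lemma nn_integral_translate:
  fixes f :: "'a::euclidean_space \<Rightarrow> ennreal"
  assumes [measurable]: "f \<in> borel_measurable borel"
  shows "(\<integral>\<^sup>+x. f (c + x) \<partial>lborel) = (\<integral>\<^sup>+x. f x \<partial>lborel)"
proof -
  have "(\<integral>\<^sup>+x. f x \<partial>lborel) = (\<integral>\<^sup>+x. f x \<partial>distr lborel borel ((+) c))"
    by (simp add: lborel_distr_plus)
  also have "\<dots> = (\<integral>\<^sup>+x. f (c + x) \<partial>lborel)"
    by (subst nn_integral_distr) auto
  finally show ?thesis by simp
qed

text \<open>For \<open>f, g \<ge> 0\<close> the double integral of \<open>f (A x + y) g y\<close> can be simplified by a translation in \<open>x\<close> or by one
in \<open>y\<close>. Comparing the results, with the unit cube for \<open>g\<close>, shows that \<open>f \<mapsto> \<integral> f \<circ> A\<close> is a multiple of the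
Lebesgue integral.\<close>
lemma nn_integral_matrix_scales:
  fixes A :: "real^'n^'n"
  assumes "invertible A"
  shows "\<exists>c. \<forall>f\<in>borel_measurable borel. (\<integral>\<^sup>+x. f (A *v x) \<partial>lborel) = c * (\<integral>\<^sup>+x. f x \<partial>lborel)"
proof -
  obtain A' where A': "A ** A' = mat 1" using assms by (auto simp: invertible_def)
  then have AA': "A *v (A' *v y) = y" for y by (simp add: matrix_vector_mul_assoc)
  define g :: "real^'n \<Rightarrow> ennreal" where "g = indicator (cbox 0 One)"
  have [measurable]: "g \<in> borel_measurable borel" unfolding g_def by (rule borel_measurable_indicator) simp
  have g_int: "(\<integral>\<^sup>+x. g x \<partial>lborel) = 1"
    unfolding g_def by (simp add: emeasure_lborel_cbox_eq)
  define c where "c = (\<integral>\<^sup>+x. g (- (A *v x)) \<partial>lborel)"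
  have "(\<integral>\<^sup>+x. f (A *v x) \<partial>lborel) = c * (\<integral>\<^sup>+x. f x \<partial>lborel)"
    if [measurable]: "f \<in> borel_measurable borel" for f
  proof -
    have m1: "(\<lambda>x. f (A *v x)) \<in> borel_measurable borel" by measurable
    have "(\<integral>\<^sup>+x. f (A *v x) \<partial>lborel) * (\<integral>\<^sup>+y. g y \<partial>lborel)
        = (\<integral>\<^sup>+y. g y * (\<integral>\<^sup>+x. f (A *v x) \<partial>lborel) \<partial>lborel)"
      by (subst nn_integral_multc) (auto simp: mult.commute)
    also have "\<dots> = (\<integral>\<^sup>+y. g y * (\<integral>\<^sup>+x. f (A *v x + y) \<partial>lborel) \<partial>lborel)"
    proof (rule nn_integral_cong)
      fix y
      have "(\<integral>\<^sup>+x. f (A *v x) \<partial>lborel) = (\<integral>\<^sup>+x. f (A *v x + y) \<partial>lborel)"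
        using nn_integral_translate[OF m1, of "A' *v y"]
        by (simp add: matrix_vector_right_distrib AA' add.commute)
      then show "g y * (\<integral>\<^sup>+x. f (A *v x) \<partial>lborel) = g y * (\<integral>\<^sup>+x. f (A *v x + y) \<partial>lborel)" by simp
    qed
    also have "\<dots> = (\<integral>\<^sup>+y. \<integral>\<^sup>+x. g y * f (A *v x + y) \<partial>lborel \<partial>lborel)"
      by (simp add: nn_integral_cmult)
    also have "\<dots> = (\<integral>\<^sup>+x. \<integral>\<^sup>+y. g y * f (A *v x + y) \<partial>lborel \<partial>lborel)"
      by (rule lborel_pair.Fubini') measurable
    also have "\<dots> = (\<integral>\<^sup>+x. \<integral>\<^sup>+y. g (y - A *v x) * f y \<partial>lborel \<partial>lborel)"
    proof (rule nn_integral_cong)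
      fix x
      have "(\<lambda>y. g (y - A *v x) * f y) \<in> borel_measurable borel" by measurable
      from nn_integral_translate[OF this, of "A *v x"]
      show "(\<integral>\<^sup>+y. g y * f (A *v x + y) \<partial>lborel) = (\<integral>\<^sup>+y. g (y - A *v x) * f y \<partial>lborel)"
        by simp
    qed
    also have "\<dots> = (\<integral>\<^sup>+y. \<integral>\<^sup>+x. g (y - A *v x) * f y \<partial>lborel \<partial>lborel)"
      by (rule lborel_pair.Fubini'[symmetric]) measurable
    also have "\<dots> = (\<integral>\<^sup>+y. (\<integral>\<^sup>+x. g (- (A *v x)) \<partial>lborel) * f y \<partial>lborel)"
    proof (rule nn_integral_cong)
      fix y
      have "(\<integral>\<^sup>+x. g (y - A *v x) * f y \<partial>lborel) = (\<integral>\<^sup>+x. g (y - A *v x) \<partial>lborel) * f y"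
        by (subst nn_integral_multc) auto
      moreover have "(\<lambda>x. g (y - A *v x)) \<in> borel_measurable borel" by measurable
      from nn_integral_translate[OF this, of "A' *v y"]
      have "(\<integral>\<^sup>+x. g (y - A *v x) \<partial>lborel) = (\<integral>\<^sup>+x. g (- (A *v x)) \<partial>lborel)"
        by (simp add: matrix_vector_right_distrib AA')
      ultimately show "(\<integral>\<^sup>+x. g (y - A *v x) * f y \<partial>lborel) = (\<integral>\<^sup>+x. g (- (A *v x)) \<partial>lborel) * f y"
        by simp
    qed
    also have "\<dots> = (\<integral>\<^sup>+x. g (- (A *v x)) \<partial>lborel) * (\<integral>\<^sup>+y. f y \<partial>lborel)"
      by (subst nn_integral_cmult) auto
    finally have *: "(\<integral>\<^sup>+x. f (A *v x) \<partial>lborel) * (\<integral>\<^sup>+y. g y \<partial>lborel)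
        = (\<integral>\<^sup>+x. g (- (A *v x)) \<partial>lborel) * (\<integral>\<^sup>+y. f y \<partial>lborel)" .
    then show ?thesis by (simp add: g_int c_def)
  qed
  then show ?thesis by blast
qed

lemma nn_integral_unit_box: "(\<integral>\<^sup>+x. indicator (cbox 0 One) x \<partial>(lborel::(real^'n) measure)) = 1"
  by (simp add: emeasure_lborel_cbox_eq)

text \<open>The factor by which \<open>A\<close> scales the integral is multiplicative in \<open>A\<close>, so elementary matrices suffice. It is
explicit for diagonal matrices; a transposition is its own inverse, and a shear is conjugate to its inverse by a
reflection, so in both cases the square of the factor is \<open>1\<close>.\<close>
theorem nn_integral_matrix_change:
  fixes A :: "real^'n^'n" and f :: "real^'n \<Rightarrow> ennreal"
  assumes "det A \<noteq> 0" and "f \<in> borel_measurable borel"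
  shows "(\<integral>\<^sup>+x. f (A *v x) \<partial>lborel) = ennreal (1 / \<bar>det A\<bar>) * (\<integral>\<^sup>+x. f x \<partial>lborel)"
proof -
  define R where "R A c \<longleftrightarrow> (\<forall>f\<in>borel_measurable borel. (\<integral>\<^sup>+x. f (A *v x) \<partial>lborel) = c * (\<integral>\<^sup>+x. f x \<partial>lborel))"
    for A :: "real^'n^'n" and c
  have R_ex: "\<exists>c. R A c" if "det A \<noteq> 0" for A
    using nn_integral_matrix_scales[of A] that by (simp add: R_def invertible_det_nz)
  have R_mult: "R (A ** B) (a * b)" if "R A a" "R B b" for A B a b
    unfolding R_def
  proof
    fix f :: "real^'n \<Rightarrow> ennreal" assume f[measurable]: "f \<in> borel_measurable borel"
    have m: "(\<lambda>x. f (A *v x)) \<in> borel_measurable borel" by measurable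
    have "(\<integral>\<^sup>+x. f (A *v (B *v x)) \<partial>lborel) = b * (\<integral>\<^sup>+x. f (A *v x) \<partial>lborel)"
      using that(2) m unfolding R_def by fast
    also have "\<dots> = b * (a * (\<integral>\<^sup>+x. f x \<partial>lborel))" using that(1) f unfolding R_def by simp
    finally show "(\<integral>\<^sup>+x. f ((A ** B) *v x) \<partial>lborel) = a * b * (\<integral>\<^sup>+x. f x \<partial>lborel)"
      by (simp add: matrix_vector_mul_assoc mult_ac)
  qed
  have R_unique: "a = b" if "R A a" "R A b" for A a b
  proof -
    have "(indicator (cbox 0 One) :: real^'n \<Rightarrow> ennreal) \<in> borel_measurable borel" by simp
    then have "a * (\<integral>\<^sup>+x. indicator (cbox 0 One) x \<partial>(lborel::(real^'n) measure)) = b * (\<integral>\<^sup>+x. indicator (cbox 0 One) x \<partial>(lborel::(real^'n) measure))"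
      using that unfolding R_def by metis
    then show ?thesis unfolding nn_integral_unit_box by simp
  qed
  have R_one: "R (mat 1) 1" by (simp add: R_def)
  have R_diag: "R A (ennreal (1 / \<bar>det A\<bar>))" if d: "\<And>i j. i \<noteq> j \<Longrightarrow> A $ i $ j = 0" and nz: "det A \<noteq> 0" for A
  proof -
    have detA: "det A = (\<Prod>i\<in>UNIV. A $ i $ i)" by (rule det_diagonal[OF d])
    have nz': "A $ i $ i \<noteq> 0" for i using nz unfolding detA by simp
    define cc where "cc v = (\<Sum>i\<in>UNIV. if v = axis i 1 then A $ i $ i else 0)" for v :: "real^'n"
    have cc: "cc (axis i 1) = A $ i $ i" for i by (simp add: cc_def axis_eq_axis)
    have B: "(Basis :: (real^'n) set) = range (\<lambda>i. axis i 1)" by (auto simp: Basis_vec_def)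
    have inj: "inj (\<lambda>i::'n. axis i (1::real))" by (simp add: inj_on_def axis_eq_axis)
    have T: "0 + (\<Sum>j\<in>Basis. (cc j * (x \<bullet> j)) *\<^sub>R j) = A *v x" for x
    proof -
      have "(\<Sum>j\<in>Basis. (cc j * (x \<bullet> j)) *\<^sub>R j) = (\<Sum>i\<in>UNIV. (A $ i $ i * x $ i) *\<^sub>R axis i 1)"
        unfolding B by (subst sum.reindex[OF inj]) (simp add: cc inner_axis)
      also have "\<dots> = A *v x"
      proof (rule vec_eq_iff[THEN iffD2, rule_format])
        fix k
        have eq: "A $ k $ j * x $ j = (if j = k then A $ k $ k * x $ k else 0)" for j
          by (cases "j = k") (simp_all add: d)
        have "(A *v x) $ k = (\<Sum>j\<in>UNIV. A $ k $ j * x $ j)"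
          by (simp add: matrix_vector_mult_def)
        also have "\<dots> = (\<Sum>j\<in>UNIV. if j = k then A $ k $ k * x $ k else 0)"
          by (rule sum.cong[OF refl eq])
        finally have "(A *v x) $ k = (\<Sum>j\<in>UNIV. if j = k then A $ k $ k * x $ k else 0)" .
        moreover have "(\<Sum>i\<in>UNIV. (A $ i $ i * x $ i) *\<^sub>R (axis i 1 :: real^'n)) $ k = (\<Sum>i\<in>UNIV. if i = k then A $ k $ k * x $ k else 0)"
          unfolding sum_component by (rule sum.cong) (auto simp: axis_def)
        ultimately show "(\<Sum>i\<in>UNIV. (A $ i $ i * x $ i) *\<^sub>R axis i 1) $ k = (A *v x) $ k"
          by simp
      qed
      finally show ?thesis by simp
    qed
    have P: "(\<Prod>j\<in>Basis. \<bar>cc j\<bar>) = \<bar>det A\<bar>"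
      unfolding B detA by (subst prod.reindex[OF inj]) (simp add: cc abs_prod)
    have L: "lborel = density (distr lborel borel (\<lambda>x. A *v x)) (\<lambda>_. ennreal \<bar>det A\<bar>)"
    proof -
      have "cc j \<noteq> 0" if "j \<in> Basis" for j
        using that nz' unfolding B by (auto simp: cc)
      from lborel_affine_euclidean[of cc 0, OF this] show ?thesis unfolding T P .
    qed
    show ?thesis unfolding R_def
    proof
      fix f :: "real^'n \<Rightarrow> ennreal" assume [measurable]: "f \<in> borel_measurable borel"
      have "(\<integral>\<^sup>+x. f x \<partial>lborel) = (\<integral>\<^sup>+x. f x \<partial>density (distr lborel borel (\<lambda>x. A *v x)) (\<lambda>_. ennreal \<bar>det A\<bar>))"
        using L by simp
      also have "\<dots> = ennreal \<bar>det A\<bar> * (\<integral>\<^sup>+x. f (A *v x) \<partial>lborel)"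
        by (subst nn_integral_density) (auto simp: nn_integral_distr nn_integral_cmult)
      finally have *: "ennreal (1 / \<bar>det A\<bar>) * (\<integral>\<^sup>+x. f x \<partial>lborel)
          = (ennreal (1 / \<bar>det A\<bar>) * ennreal \<bar>det A\<bar>) * (\<integral>\<^sup>+x. f (A *v x) \<partial>lborel)"
        by (simp add: mult.assoc)
      have "ennreal (1 / \<bar>det A\<bar>) * ennreal \<bar>det A\<bar> = 1"
        using nz by (simp flip: ennreal_mult')
      then show "(\<integral>\<^sup>+x. f (A *v x) \<partial>lborel) = ennreal (1 / \<bar>det A\<bar>) * (\<integral>\<^sup>+x. f x \<partial>lborel)"
        using * by simp
    qed
  qed
  have sq1: "c = 1" if "c * c = 1" for c :: ennreal
  proof (cases c)
    case (real r)
    then have "ennreal (r * r) = ennreal 1" using that by (simp add: ennreal_mult'')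
    then have "r * r = 1" using real by (subst (asm) ennreal_inj) auto
    then have "r = 1" using real by (simp add: square_eq_1_iff)
    then show ?thesis using real by simp
  qed (use that in \<open>simp add: ennreal_top_mult\<close>)
  have "det A \<noteq> 0 \<longrightarrow> R A (ennreal (1 / \<bar>det A\<bar>))" for A
  proof (induction A rule: induct_matrix_elementary_alt)
    case (1 A B)
    show ?case
    proof
      assume nz: "det (A ** B) \<noteq> 0"
      then have "R (A ** B) (ennreal (1 / \<bar>det A\<bar>) * ennreal (1 / \<bar>det B\<bar>))"
        using 1 by (intro R_mult) (auto simp: det_mul)
      then show "R (A ** B) (ennreal (1 / \<bar>det (A ** B)\<bar>))"
        by (simp add: det_mul abs_mult flip: ennreal_mult')
    qed
  next
    case (2 A i) then show ?case by (simp add: det_zero_row)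
  next
    case (3 A) then show ?case using R_diag by blast
  next
    case (4 m n)
    let ?S = "(\<chi> i j. mat 1 $ i $ Transposition.transpose m n j) :: real^'n^'n"
    have S: "?S *v x = (\<chi> i. x $ Transposition.transpose m n i)" for x
    proof (rule vec_eq_iff[THEN iffD2, rule_format])
      fix i
      have "mat 1 $ i $ Transposition.transpose m n j * x $ j
          = (if j = Transposition.transpose m n i then x $ j else 0)" for j
        by (auto simp: mat_def Transposition.transpose_def)
      then show "(?S *v x) $ i = (\<chi> i. x $ Transposition.transpose m n i) $ i"
        by (simp add: matrix_vector_mult_def)
    qed
    have SS: "?S ** ?S = mat 1"
      unfolding matrix_eq matrix_vector_mul_assoc[symmetric] S by simp
    then have "det ?S * det ?S = 1" by (metis det_mul det_I)
    then have nz: "det ?S \<noteq> 0" and d1: "\<bar>det ?S\<bar> = 1"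
      by (auto simp: square_eq_1_iff)
    obtain c where c: "R ?S c" using R_ex nz by blast
    have "c * c = 1" using R_mult[OF c c] R_one R_unique unfolding SS by blast
    then have "c = 1" by (rule sq1)
    with c show ?case unfolding d1 by simp
  next
    case (5 m n)
    let ?S = "(\<chi> i j. of_bool (i = m \<and> j = n \<or> i = j)) :: real^'n^'n"
    let ?D = "(\<chi> i j. if i = j then (if i = m then -1 else 1) else 0) :: real^'n^'n"
    have S: "?S *v x = (\<chi> i. x $ i + (if i = m then x $ n else 0))" for x
    proof (subst vec_eq_iff, intro allI)
      fix i
      have "(?S *v x) $ i = (\<Sum>j\<in>UNIV. (if j = i then x $ j else 0) + (if j = n then (if i = m then x $ j else 0) else 0))"
        unfolding matrix_vector_mult_def using 5 by (auto intro!: sum.cong)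
      then show "(?S *v x) $ i = (\<chi> i. x $ i + (if i = m then x $ n else 0)) $ i"
        by (simp add: sum.distrib)
    qed
    have D: "?D *v x = (\<chi> i. if i = m then - x $ i else x $ i)" for x
      by (auto simp: vec_eq_iff matrix_vector_mult_def if_distrib[of "\<lambda>z. z * _"] cong: if_cong)
    \<comment> \<open>the reflection in the m-th coordinate conjugates the shear to its inverse\<close>
    have E: "?S ** (?D ** (?S ** ?D)) = mat 1"
      unfolding matrix_eq matrix_vector_mul_assoc[symmetric] S D using 5 by (auto simp: vec_eq_iff)
    have "det (?S ** (?D ** (?S ** ?D))) = 1" unfolding E by simp
    then have SDSD: "det ?S * (det ?D * (det ?S * det ?D)) = 1" by (simp only: det_mul)
    have detD: "det ?D = (\<Prod>i\<in>UNIV. if i = m then -1 else 1)" by (subst det_diagonal) auto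
    have dD: "\<bar>det ?D\<bar> = 1" unfolding detD abs_prod by (rule prod.neutral) auto
    have s1: "s * s = 1 \<and> s \<noteq> 0 \<and> \<bar>s\<bar> = 1" if "s * (d * (s * d)) = 1" "\<bar>d\<bar> = 1" for s d :: real
    proof -
      have "d * d = 1" using that(2) abs_mult_self_eq[of d] by simp
      moreover have "s * s * (d * d) = 1" using that(1) by (simp only: ac_simps)
      ultimately have "s * s = 1" by simp
      then show ?thesis by (auto simp: square_eq_1_iff)
    qed
    have nz: "det ?S \<noteq> 0" and d1: "\<bar>det ?S\<bar> = 1" using s1[OF SDSD dD] by blast+
    obtain c where c: "R ?S c" using R_ex nz by blast
    have "R ?D (ennreal (1 / \<bar>det ?D\<bar>))"
    proof (rule R_diag)
      show "?D $ i $ j = 0" if "i \<noteq> j" for i j using that by simp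
      show "det ?D \<noteq> 0" using dD by (metis abs_0 zero_neq_one)
    qed
    then have RD: "R ?D 1" unfolding dD by simp
    have "R (?S ** (?D ** (?S ** ?D))) (c * (1 * (c * 1)))"
      by (intro R_mult c RD)
    then have "c * (1 * (c * 1)) = 1" unfolding E using R_one by (rule R_unique)
    then have "c * c = 1" by simp
    then have "c = 1" by (rule sq1)
    with c show ?case unfolding d1 by simp
  qed
  then show ?thesis using assms unfolding R_def by blast
qed

corollary integral_matrix_change:
  fixes A :: "real^'n^'n" and f :: "real^'n \<Rightarrow> complex"
  assumes A: "det A \<noteq> 0" and f[measurable]: "f \<in> borel_measurable borel"
  shows "(\<integral>x. f (A *v x) \<partial>lborel) = (1 / \<bar>det A\<bar>) *\<^sub>R (\<integral>x. f x \<partial>lborel)"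
proof -
  have D: "distr lborel borel (\<lambda>x. A *v x) = density lborel (\<lambda>_. ennreal (1 / \<bar>det A\<bar>))"
  proof (rule measure_eqI)
    fix X assume "X \<in> sets (distr lborel borel (\<lambda>x. A *v x))"
    then have X[measurable]: "X \<in> sets borel" by simp
    have "emeasure (distr lborel borel (\<lambda>x. A *v x)) X = (\<integral>\<^sup>+x. indicator X (A *v x) \<partial>lborel)"
      using nn_integral_distr[of "\<lambda>x. A *v x" lborel borel "indicator X"] by simp
    also have "\<dots> = ennreal (1 / \<bar>det A\<bar>) * (\<integral>\<^sup>+x. indicator X x \<partial>lborel)"
      by (rule nn_integral_matrix_change[OF A]) measurable
    also have "\<dots> = emeasure (density lborel (\<lambda>_. ennreal (1 / \<bar>det A\<bar>))) X"
      by (subst emeasure_density) (auto simp: nn_integral_cmult)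
    finally show "emeasure (distr lborel borel (\<lambda>x. A *v x)) X = emeasure (density lborel (\<lambda>_. ennreal (1 / \<bar>det A\<bar>))) X" .
  qed simp
  have "(\<integral>x. f (A *v x) \<partial>lborel) = (\<integral>x. f x \<partial>distr lborel borel (\<lambda>x. A *v x))"
    by (subst integral_distr) auto
  also have "\<dots> = (1 / \<bar>det A\<bar>) *\<^sub>R (\<integral>x. f x \<partial>lborel)"
    unfolding D by (subst integral_density) auto
  finally show ?thesis .
qed

lemma has_vector_derivative_iff_quotient:
  fixes f :: "real \<Rightarrow> 'b::real_normed_vector"
  shows "(f has_vector_derivative D) (at x) \<longleftrightarrow> ((\<lambda>y. (1 / (y - x)) *\<^sub>R (f y - f x)) \<longlongrightarrow> D) (at x)"
proof -
  have "norm (f y - f x - (y - x) *\<^sub>R D) / norm (y - x) = norm ((1 / (y - x)) *\<^sub>R (f y - f x) - D)" if "y \<noteq> x" for y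
  proof -
    have "(1 / (y - x)) *\<^sub>R (f y - f x) - D = (1 / (y - x)) *\<^sub>R (f y - f x - (y - x) *\<^sub>R D)"
      using that by (simp add: scaleR_right_diff_distrib)
    then show ?thesis by (simp add: divide_inverse)
  qed
  then have "((\<lambda>y. norm (f y - f x - (y - x) *\<^sub>R D) / norm (y - x)) \<longlongrightarrow> 0) (at x)
      \<longleftrightarrow> ((\<lambda>y. norm ((1 / (y - x)) *\<^sub>R (f y - f x) - D)) \<longlongrightarrow> 0) (at x)"
    by (intro tendsto_cong) (auto simp: eventually_at_filter)
  then show ?thesis
    by (simp add: has_vector_derivative_def has_derivative_iff_norm bounded_linear_scaleR_left tendsto_norm_zero_iff LIM_zero_iff)
qed

lemma integral_has_vector_derivative_param:
  fixes G :: "real \<Rightarrow> 'a \<Rightarrow> complex"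
  assumes "d > 0"
    and G: "\<And>s. \<bar>s - s0\<bar> < d \<Longrightarrow> integrable M (G s)"
    and G'[measurable]: "G' s0 \<in> borel_measurable M"
    and der: "\<And>s x. \<bar>s - s0\<bar> < d \<Longrightarrow> ((\<lambda>s. G s x) has_vector_derivative G' s x) (at s)"
    and bnd: "\<And>s x. \<bar>s - s0\<bar> < d \<Longrightarrow> norm (G' s x) \<le> b x"
    and b: "integrable M b"
  shows "((\<lambda>s. \<integral>x. G s x \<partial>M) has_vector_derivative (\<integral>x. G' s0 x \<partial>M)) (at s0)"
proof -
  let ?S = "ball s0 d"
  have S: "s \<in> ?S \<longleftrightarrow> \<bar>s - s0\<bar> < d" for s by (auto simp: dist_real_def)
  have s0: "s0 \<in> ?S" using \<open>d > 0\<close> by simp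
  have lip: "norm (G s x - G s0 x) \<le> b x * \<bar>s - s0\<bar>" if "s \<in> ?S" for s x
  proof -
    have "norm (G s x - G s0 x) \<le> b x * norm (s - s0)"
    proof (rule differentiable_bound[where S="?S" and f'="\<lambda>s h. h *\<^sub>R G' s x"])
      fix r assume r: "r \<in> ?S"
      show "((\<lambda>s. G s x) has_derivative (\<lambda>h. h *\<^sub>R G' r x)) (at r within ?S)"
        using der[of r x] r S has_derivative_at_withinI unfolding has_vector_derivative_def by blast
      show "onorm (\<lambda>h. h *\<^sub>R G' r x) \<le> b x"
        by (rule onorm_le) (use bnd[of r x] r S in \<open>auto simp: mult.commute[of _ "\<bar>_\<bar>"] intro!: mult_left_mono\<close>)
    qed (use that s0 in auto)
    then show ?thesis by simp
  qed
  let ?q = "\<lambda>s x. (1 / (s - s0)) *\<^sub>R (G s x - G s0 x)"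
  have "((\<lambda>s. \<integral>x. ?q s x \<partial>M) \<longlongrightarrow> (\<integral>x. G' s0 x \<partial>M)) (at s0 within ?S)"
    unfolding tendsto_at_iff_sequentially comp_def
  proof (intro allI impI)
    fix X :: "nat \<Rightarrow> real" assume X: "\<forall>i. X i \<in> ?S - {s0}" and Xl: "X \<longlonglongrightarrow> s0"
    show "(\<lambda>i. \<integral>x. ?q (X i) x \<partial>M) \<longlonglongrightarrow> (\<integral>x. G' s0 x \<partial>M)"
    proof (rule integral_dominated_convergence[where w=b])
      show "(\<lambda>x. ?q (X i) x) \<in> borel_measurable M" for i
        using G[of "X i"] G[of s0] X S s0 by (intro borel_measurable_integrable integrable_scaleR_right integrable_diff) auto
      show "AE x in M. (\<lambda>i. ?q (X i) x) \<longlonglongrightarrow> G' s0 x"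
      proof (rule AE_I2)
        fix x
        have "((\<lambda>s. ?q s x) \<longlongrightarrow> G' s0 x) (at s0)"
          using der[of s0 x] \<open>d > 0\<close> by (simp add: has_vector_derivative_iff_quotient)
        then show "(\<lambda>i. ?q (X i) x) \<longlonglongrightarrow> G' s0 x"
          unfolding tendsto_at_iff_sequentially comp_def using X Xl by auto
      qed
      show "AE x in M. norm (?q (X i) x) \<le> b x" for i
        using lip[of "X i"] X by (intro AE_I2) (auto simp: divide_simps mult.commute)
    qed (use b in auto)
  qed
  then have "((\<lambda>s. \<integral>x. ?q s x \<partial>M) \<longlongrightarrow> (\<integral>x. G' s0 x \<partial>M)) (at s0)"
    using at_within_open[OF s0 open_ball] by simp
  moreover have "\<forall>\<^sub>F s in at s0. (\<integral>x. ?q s x \<partial>M) = (1 / (s - s0)) *\<^sub>R ((\<integral>x. G s x \<partial>M) - (\<integral>x. G s0 x \<partial>M))"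
    unfolding eventually_at using \<open>d > 0\<close> G
    by (intro exI[of _ d]) (auto simp: dist_real_def)
  ultimately have "((\<lambda>s. (1 / (s - s0)) *\<^sub>R ((\<integral>x. G s x \<partial>M) - (\<integral>x. G s0 x \<partial>M))) \<longlongrightarrow> (\<integral>x. G' s0 x \<partial>M)) (at s0)"
    by (rule Lim_transform_eventually)
  then show ?thesis by (simp add: has_vector_derivative_iff_quotient)
qed

lemma continuous_on_integral_param:
  fixes G :: "'p::metric_space \<Rightarrow> 'a \<Rightarrow> complex"
  assumes cont: "\<And>x. continuous_on S (\<lambda>p. G p x)"
    and meas: "\<And>p. p \<in> S \<Longrightarrow> G p \<in> borel_measurable M"
    and bnd: "\<And>p x. p \<in> S \<Longrightarrow> norm (G p x) \<le> b x"
    and b: "integrable M b"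
  shows "continuous_on S (\<lambda>p. \<integral>x. G p x \<partial>M)"
  unfolding continuous_on_sequentially comp_def
proof (intro allI ballI impI)
  fix X a assume a: "a \<in> S" and X: "(\<forall>n. X n \<in> S) \<and> X \<longlonglongrightarrow> a"
  show "(\<lambda>n. \<integral>x. G (X n) x \<partial>M) \<longlonglongrightarrow> (\<integral>x. G a x \<partial>M)"
  proof (rule integral_dominated_convergence[where w=b])
    show "AE x in M. (\<lambda>n. G (X n) x) \<longlonglongrightarrow> G a x"
      using cont a X unfolding continuous_on_sequentially comp_def by auto
  qed (use X a meas bnd b in auto)
qed

text \<open>The weight dominates the product of the factors \<open>1 + x\<^sub>b\<^sup>2\<close> over the coordinates, each of which has an integrable
reciprocal on the line.\<close>
lemma integrable_polynomial_weight:
  "integrable lborel (\<lambda>x::real^'n. 1 / (1 + (norm x)\<^sup>2) ^ CARD('n))"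
proof (rule integrableI_bounded)
  show "(\<lambda>x::real^'n. 1 / (1 + (norm x)\<^sup>2) ^ CARD('n)) \<in> borel_measurable lborel" by measurable
  let ?f = "\<lambda>s::real. 1 / (1 + s\<^sup>2)"
  have one: "(\<integral>\<^sup>+s. ennreal (?f s) \<partial>lborel) < \<infinity>"
  proof -
    have "integrable lborel ?f"
      using integrable_inverse_1_plus_square by (simp add: set_integrable_def inverse_eq_divide)
    then show ?thesis by (subst nn_integral_eq_integral) auto
  qed
  have le: "1 / (1 + (norm x)\<^sup>2) ^ CARD('n) \<le> (\<Prod>b\<in>Basis. ?f (x \<bullet> b))" for x :: "real^'n"
  proof -
    have "(\<Prod>b\<in>Basis. 1 + (x \<bullet> b)\<^sup>2) \<le> (\<Prod>b\<in>(Basis::(real^'n) set). 1 + (norm x)\<^sup>2)"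
      by (intro prod_mono) (auto simp: Basis_le_norm intro!: abs_le_square_iff[THEN iffD1])
    also have "\<dots> = (1 + (norm x)\<^sup>2) ^ CARD('n)" by simp
    finally have "1 / (1 + (norm x)\<^sup>2) ^ CARD('n) \<le> 1 / (\<Prod>b\<in>Basis. 1 + (x \<bullet> b)\<^sup>2)"
      by (intro divide_left_mono) (auto intro!: mult_pos_pos prod_pos add_pos_nonneg zero_less_power)
    then show ?thesis by (simp add: prod_dividef)
  qed
  have "(\<integral>\<^sup>+x. ennreal (norm (1 / (1 + (norm x)\<^sup>2) ^ CARD('n))) \<partial>(lborel :: (real^'n) measure))
      \<le> (\<integral>\<^sup>+x. (\<Prod>b\<in>Basis. ennreal (?f (x \<bullet> b))) \<partial>(lborel :: (real^'n) measure))"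
    by (intro nn_integral_mono) (use le in \<open>auto simp: prod_ennreal add_nonneg_nonneg intro!: ennreal_leI\<close>)
  also have "\<dots> = (\<Prod>b\<in>(Basis::(real^'n) set). (\<integral>\<^sup>+s. ennreal (?f s) \<partial>lborel))"
    by (rule nn_integral_lborel_prod) auto
  also have "\<dots> < \<infinity>" using one by (simp add: power_less_top_ennreal)
  finally show "(\<integral>\<^sup>+x. ennreal (norm (1 / (1 + (norm x)\<^sup>2) ^ CARD('n))) \<partial>(lborel :: (real^'n) measure)) < \<infinity>" .
qed

lemma integrable_decay:
  fixes f :: "real^'n \<Rightarrow> 'b::{banach, second_countable_topology}"
  assumes "f \<in> borel_measurable borel"
    and "\<And>x. (1 + (norm x)\<^sup>2) ^ CARD('n) * norm (f x) \<le> C"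
  shows "integrable lborel f"
proof (rule Bochner_Integration.integrable_bound)
  show "integrable lborel (\<lambda>x::real^'n. C * (1 / (1 + (norm x)\<^sup>2) ^ CARD('n)))"
    using integrable_polynomial_weight by (rule integrable_mult_right)
  have "norm (f x) \<le> C * (1 / (1 + (norm x)\<^sup>2) ^ CARD('n))" for x
  proof -
    have "(1 + (norm x)\<^sup>2) ^ CARD('n) > 0" by (intro zero_less_power add_pos_nonneg) auto
    then show ?thesis using assms(2)[of x] by (simp add: field_simps)
  qed
  then show "AE x in lborel. norm (f x) \<le> norm (C * (1 / (1 + (norm x)\<^sup>2) ^ CARD('n)))"
    by (intro AE_I2) (metis norm_ge_zero order_trans real_norm_def abs_ge_self)
qed (use assms(1) in simp)

section \<open>Partial derivatives\<close>

text \<open>One predicate for existence and value of a partial derivative, so that the rules of calculus compose.\<close>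
definition has_pd :: "'n \<Rightarrow> (real^'n \<Rightarrow> complex) \<Rightarrow> complex \<Rightarrow> real^'n \<Rightarrow> bool" where
  "has_pd i g D x \<longleftrightarrow> ((\<lambda>s::real. g (x + s *\<^sub>R axis i 1)) has_vector_derivative D) (at 0)"

lemma has_pd_iff: "has_pd i g D x \<longleftrightarrow> has_pdiff i g x \<and> pdiff i g x = D"
  unfolding has_pd_def has_pdiff_def pdiff_def
  by (metis differentiableI_vector vector_derivative_at vector_derivative_works)

lemma has_pd_const: "has_pd i (\<lambda>x. c) 0 x"
  by (simp add: has_pd_def)

lemma has_pd_add: "has_pd i f D x \<Longrightarrow> has_pd i g E x \<Longrightarrow> has_pd i (\<lambda>x. f x + g x) (D + E) x"
  unfolding has_pd_def by (rule has_vector_derivative_add)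

lemma has_pd_diff: "has_pd i f D x \<Longrightarrow> has_pd i g E x \<Longrightarrow> has_pd i (\<lambda>x. f x - g x) (D - E) x"
  unfolding has_pd_def by (rule has_vector_derivative_diff)

lemma has_pd_mult: "has_pd i f D x \<Longrightarrow> has_pd i g E x \<Longrightarrow> has_pd i (\<lambda>x. f x * g x) (f x * E + D * g x) x"
  unfolding has_pd_def using has_vector_derivative_mult[of "\<lambda>s. f (x + s *\<^sub>R axis i 1)" D 0 UNIV "\<lambda>s. g (x + s *\<^sub>R axis i 1)" E] by simp

lemma has_pd_cmult: "has_pd i f D x \<Longrightarrow> has_pd i (\<lambda>x. c * f x) (c * D) x"
  using has_pd_mult[OF has_pd_const, of i f D x c] by simp

lemma has_pd_sum: "(\<And>k. k \<in> K \<Longrightarrow> has_pd i (f k) (D k) x) \<Longrightarrow> has_pd i (\<lambda>x. \<Sum>k\<in>K. f k x) (\<Sum>k\<in>K. D k) x"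
  unfolding has_pd_def by (rule has_vector_derivative_sum)

lemma has_pd_cnj: "has_pd i f D x \<Longrightarrow> has_pd i (\<lambda>x. cnj (f x)) (cnj D) x"
  unfolding has_pd_def by (rule has_vector_derivative_cnj)

lemma has_pd_coord: "has_pd i (\<lambda>x. of_real (x $ j)) (if i = j then 1 else 0) x"
proof -
  have "(\<lambda>s. complex_of_real ((x + s *\<^sub>R axis i 1) $ j)) = (\<lambda>s. of_real (x $ j + s * (if i = j then 1 else 0)))"
    by (auto simp: axis_def)
  moreover have "((\<lambda>s. complex_of_real (x $ j + s * (if i = j then 1 else 0))) has_vector_derivative of_real (if i = j then 1 else 0)) (at 0)"
    by (rule has_vector_derivative_of_real) (auto intro!: derivative_eq_intros)
  ultimately show ?thesis unfolding has_pd_def by (cases "i = j") simp_all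
qed

lemma has_pd_exp: 
  assumes "has_pd i f D x" shows "has_pd i (\<lambda>x. exp (f x)) (D * exp (f x)) x"
proof -
  have "((\<lambda>s. exp (f (x + s *\<^sub>R axis i 1))) has_vector_derivative D * exp (f (x + 0 *\<^sub>R axis i 1))) (at 0)"
    using field_vector_diff_chain_at[OF assms[unfolded has_pd_def], of exp "exp (f (x + 0 *\<^sub>R axis i 1))"]
    by (simp add: o_def DERIV_exp)
  then show ?thesis by (simp add: has_pd_def)
qed

lemma has_pd_quadratic:
  assumes "transpose P = P"
  shows "has_pd j (\<lambda>x. of_real ((P *v x) \<bullet> x)) (of_real (2 * (P *v x) $ j)) x"
proof -
  let ?e = "axis j (1::real)"
  have 1: "(P *v y) \<bullet> z = y \<bullet> (P *v z)" for y z
    by (metis assms dot_lmul_matrix vector_transpose_matrix)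
  have e: "(P *v ?e) \<bullet> x = (P *v x) $ j" using 1[of ?e x] by (simp add: inner_axis')
  have "(\<lambda>s. complex_of_real ((P *v (x + s *\<^sub>R ?e)) \<bullet> (x + s *\<^sub>R ?e)))
      = (\<lambda>s. of_real ((P *v x) \<bullet> x + s * (2 * (P *v x) $ j) + s\<^sup>2 * ((P *v ?e) \<bullet> ?e)))"
    by (auto simp: fun_eq_iff matrix_vector_right_distrib matrix_vector_mult_scaleR inner_add inner_axis e power2_eq_square algebra_simps simp del: of_real_add of_real_mult)
  moreover have "((\<lambda>s. complex_of_real ((P *v x) \<bullet> x + s * (2 * (P *v x) $ j) + s\<^sup>2 * ((P *v ?e) \<bullet> ?e))) has_vector_derivative of_real (2 * (P *v x) $ j)) (at 0)"
    by (rule has_vector_derivative_of_real) (auto intro!: derivative_eq_intros)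
  ultimately show ?thesis unfolding has_pd_def by simp
qed

lemma has_pd_linear: "has_pd j (\<lambda>x. of_real (v \<bullet> x)) (of_real (v $ j)) x"
proof -
  have "(\<lambda>s. complex_of_real (v \<bullet> (x + s *\<^sub>R axis j 1))) = (\<lambda>s. of_real (v \<bullet> x + s * v $ j))"
    by (auto simp: inner_add inner_axis)
  moreover have "((\<lambda>s. complex_of_real (v \<bullet> x + s * v $ j)) has_vector_derivative of_real (v $ j)) (at 0)"
    by (rule has_vector_derivative_of_real) (auto intro!: derivative_eq_intros)
  ultimately show ?thesis unfolding has_pd_def by simp
qed

lemma has_pd_line:
  assumes "\<And>x. has_pd i g (g' x) x"
  shows "((\<lambda>s. g (x + s *\<^sub>R axis i 1)) has_vector_derivative g' (x + s0 *\<^sub>R axis i 1)) (at s0)"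
proof -
  have "((\<lambda>s. s - s0) has_vector_derivative 1) (at s0)" by (auto intro!: derivative_eq_intros)
  moreover have "((\<lambda>s. g ((x + s0 *\<^sub>R axis i 1) + s *\<^sub>R axis i 1)) has_vector_derivative g' (x + s0 *\<^sub>R axis i 1)) (at (s0 - s0))"
    using assms[of "x + s0 *\<^sub>R axis i 1"] by (simp add: has_pd_def)
  ultimately have "((\<lambda>s. g ((x + s0 *\<^sub>R axis i 1) + s *\<^sub>R axis i 1)) \<circ> (\<lambda>s. s - s0) has_vector_derivative 1 *\<^sub>R g' (x + s0 *\<^sub>R axis i 1)) (at s0)"
    by (rule vector_diff_chain_at)
  then show ?thesis by (simp add: o_def algebra_simps)
qed

lemma integral_translate:
  fixes f :: "'a::euclidean_space \<Rightarrow> complex"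
  assumes "f \<in> borel_measurable borel"
  shows "(\<integral>x. f (x + c) \<partial>lborel) = (\<integral>x. f x \<partial>lborel)"
proof -
  have "(\<integral>x. f x \<partial>lborel) = (\<integral>x. f x \<partial>distr lborel borel ((+) c))"
    by (simp add: lborel_distr_plus)
  also have "\<dots> = (\<integral>x. f (x + c) \<partial>lborel)"
    using assms by (subst integral_distr) (auto simp: add.commute)
  finally show ?thesis by simp
qed

lemma integrable_translate:
  fixes f :: "'a::euclidean_space \<Rightarrow> 'b::{banach, second_countable_topology}"
  assumes "integrable lborel f"
  shows "integrable lborel (\<lambda>x. f (x + c))"
proof -
  have "integrable (distr lborel borel ((+) c)) f" using assms by (simp add: lborel_distr_plus)
  then show ?thesis using borel_measurable_integrable[OF assms]
    by (subst (asm) integrable_distr_eq) (auto simp: add.commute)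
qed

text \<open>By the fundamental theorem of calculus \<open>u(x + e\<^sub>i) - u(x)\<close> is the integral of the derivative over a unit segment.
The integral over \<open>x\<close> of the left side vanishes by translation invariance, and that of the right side is
the integral of the derivative by Fubini.\<close>
lemma integral_partial_derivative_zero:
  fixes u :: "real^'n \<Rightarrow> complex"
  assumes pd: "\<And>x. has_pd i u (u' x) x" and cont: "continuous_on UNIV u'"
    and u: "integrable lborel u" and u': "integrable lborel u'"
  shows "(\<integral>x. u' x \<partial>lborel) = 0"
proof -
  let ?e = "axis i (1::real) :: real^'n"
  let ?I = "\<lambda>s::real. indicator {0..1} s :: real"
  have cm: "(\<lambda>p::(real^'n) \<times> real. u' (fst p + snd p *\<^sub>R ?e)) \<in> borel_measurable borel"
    by (intro borel_measurable_continuous_onI continuous_intros continuous_on_compose2[OF cont]) auto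
  have [measurable]: "u' \<in> borel_measurable borel" "u \<in> borel_measurable borel" using u u' by auto
  have [measurable]: "(\<lambda>(x, s). ?I s *\<^sub>R u' (x + s *\<^sub>R ?e)) \<in> borel_measurable (lborel \<Otimes>\<^sub>M lborel)"
    by measurable
  have int: "integrable (lborel \<Otimes>\<^sub>M lborel) (\<lambda>(s, x). ?I s *\<^sub>R u' (x + s *\<^sub>R ?e))"
  proof (rule lborel_pair.Fubini_integrable)
    have "(\<integral>x. norm (case (s, x) of (s, x) \<Rightarrow> ?I s *\<^sub>R u' (x + s *\<^sub>R ?e)) \<partial>lborel) = ?I s * (\<integral>x. norm (u' x) \<partial>lborel)" for s
    proof -
      have "(\<integral>x. complex_of_real (norm (u' (x + s *\<^sub>R ?e))) \<partial>lborel) = (\<integral>x. complex_of_real (norm (u' x)) \<partial>lborel)"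
        by (rule integral_translate[of "\<lambda>x. complex_of_real (norm (u' x))"]) measurable
      then have "(\<integral>x. norm (u' (x + s *\<^sub>R ?e)) \<partial>lborel) = (\<integral>x. norm (u' x) \<partial>lborel)"
        unfolding integral_complex_of_real by simp
      then show ?thesis by simp
    qed
    then have "(\<lambda>s. \<integral>x. norm (case (s, x) of (s, x) \<Rightarrow> ?I s *\<^sub>R u' (x + s *\<^sub>R ?e)) \<partial>lborel) = (\<lambda>s. ?I s * (\<integral>x. norm (u' x) \<partial>lborel))"
      by (rule ext)
    then show "integrable lborel (\<lambda>s. \<integral>x. norm (case (s, x) of (s, x) \<Rightarrow> ?I s *\<^sub>R u' (x + s *\<^sub>R ?e)) \<partial>lborel)"
      by (simp only:) simp
    show "AE s in lborel. integrable lborel (\<lambda>x. case (s, x) of (s, x) \<Rightarrow> ?I s *\<^sub>R u' (x + s *\<^sub>R ?e))"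
      using integrable_translate[OF u'] by (intro AE_I2) simp
  qed measurable
  have inner: "(\<integral>s. ?I s *\<^sub>R u' (x + s *\<^sub>R ?e) \<partial>lborel) = u (x + ?e) - u x" for x
  proof -
    have "has_bochner_integral lborel (\<lambda>s. ?I s *\<^sub>R u' (x + s *\<^sub>R ?e)) (u (x + 1 *\<^sub>R ?e) - u (x + 0 *\<^sub>R ?e))"
    proof (rule has_bochner_integral_FTC_Icc)
      show "((\<lambda>s. u (x + s *\<^sub>R ?e)) has_vector_derivative u' (x + s *\<^sub>R ?e)) (at s within {0..1})" for s
        using has_pd_line[of i u u', OF pd] by (rule has_vector_derivative_at_within)
      show "continuous_on {0..1} (\<lambda>s. u' (x + s *\<^sub>R ?e))"
        by (intro continuous_intros continuous_on_compose2[OF cont]) auto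
    qed simp
    then show ?thesis by (simp add: has_bochner_integral_integral_eq)
  qed
  have "(\<integral>x. u' x \<partial>lborel) = (\<integral>s. ?I s *\<^sub>R (\<integral>x. u' x \<partial>lborel) \<partial>lborel)" by simp
  also have "\<dots> = (\<integral>s. (\<integral>x. ?I s *\<^sub>R u' (x + s *\<^sub>R ?e) \<partial>lborel) \<partial>lborel)"
    by (simp add: integral_translate)
  also have "\<dots> = (\<integral>x. (\<integral>s. ?I s *\<^sub>R u' (x + s *\<^sub>R ?e) \<partial>lborel) \<partial>lborel)"
    using lborel_pair.Fubini_integral[OF int] by simp
  also have "\<dots> = (\<integral>x. u (x + ?e) - u x \<partial>lborel)" by (simp add: inner)
  also have "\<dots> = 0"
    using integrable_translate[OF u, of ?e] u by (simp add: integral_translate)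
  finally show ?thesis .
qed

section \<open>Schwartz functions\<close>

text \<open>A function is Schwartz once it lies in some class of continuous, rapidly decreasing functions that is closed
under partial derivatives. Each closure property of the Schwartz space below comes from the class of
functions of the corresponding shape.\<close>
lemma schwartz_coinduct:
  assumes "X g"
    and cont: "\<And>g. X g \<Longrightarrow> continuous_on UNIV g"
    and pd: "\<And>g i. X g \<Longrightarrow> \<exists>g'. X g' \<and> (\<forall>x. has_pd i g (g' x) x)"
    and bnd: "\<And>g k. X g \<Longrightarrow> \<exists>C. \<forall>x. norm x ^ k * norm (g x) \<le> C"
  shows "schwartz g"
proof -
  have pdX: "X (pdiff i g)" "has_pdiff i g x" if "X g" for g i x
  proof -
    obtain g' where g': "X g'" "\<And>x. has_pd i g (g' x) x" using pd[OF \<open>X g\<close>] by blast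
    then have "pdiff i g = g'" by (auto simp: has_pd_iff)
    then show "X (pdiff i g)" "has_pdiff i g x" using g' by (auto simp: has_pd_iff)
  qed
  have X: "X (pdiffs is g)" for "is"
    by (induction "is") (use \<open>X g\<close> pdX in auto)
  have "bounded (range (\<lambda>x. norm x ^ k *\<^sub>R pdiffs is g x))" for "is" k
  proof -
    obtain C where "\<And>x. norm x ^ k * norm (pdiffs is g x) \<le> C" using bnd[OF X] by blast
    then show ?thesis by (auto simp: bounded_iff intro!: exI[of _ C])
  qed
  then show ?thesis unfolding schwartz_def C_infinity_def using X cont pdX by blast
qed

lemma schwartz_continuous: assumes "schwartz g" shows "continuous_on S g"
proof -
  have "continuous_on UNIV (pdiffs [] g)" using assms unfolding schwartz_def C_infinity_def by blast
  then show ?thesis by (auto intro: continuous_on_subset)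
qed

lemma schwartz_has_pd: assumes "schwartz g" shows "has_pd i g (pdiff i g x) x"
proof -
  have "has_pdiff i (pdiffs [] g) x" using assms unfolding schwartz_def C_infinity_def by blast
  then show ?thesis by (simp add: has_pd_iff)
qed

lemma schwartz_decay: assumes "schwartz g" shows "\<exists>C. \<forall>x. norm x ^ k * norm (g x) \<le> C"
proof -
  have "bounded (range (\<lambda>x. norm x ^ k *\<^sub>R pdiffs [] g x))" using assms unfolding schwartz_def by blast
  then show ?thesis unfolding bounded_iff by auto
qed

lemma schwartz_pdiff: assumes "schwartz g" shows "schwartz (pdiff i g)"
proof -
  have eq: "pdiffs is (pdiff i g) = pdiffs (is @ [i]) g" for "is" by (induction "is") auto
  show ?thesis using assms unfolding schwartz_def C_infinity_def eq by blast
qed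

lemma schwartz_add: assumes "schwartz g" "schwartz h" shows "schwartz (\<lambda>x. g x + h x)"
proof (rule schwartz_coinduct[where X="\<lambda>u. \<exists>g h. schwartz g \<and> schwartz h \<and> u = (\<lambda>x. g x + h x)"])
  fix u assume "\<exists>g h. schwartz g \<and> schwartz h \<and> u = (\<lambda>x. g x + h x)"
  then obtain g h where gh: "schwartz g" "schwartz h" and u: "u = (\<lambda>x. g x + h x)" by blast
  show "continuous_on UNIV u" unfolding u by (intro continuous_intros schwartz_continuous gh)
  show "\<exists>g'. (\<exists>g h. schwartz g \<and> schwartz h \<and> g' = (\<lambda>x. g x + h x)) \<and> (\<forall>x. has_pd i u (g' x) x)" for i
  proof -
    have "has_pd i u (pdiff i g x + pdiff i h x) x" for x
      unfolding u by (intro has_pd_add schwartz_has_pd gh)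
    then show ?thesis
      using schwartz_pdiff[OF gh(1)] schwartz_pdiff[OF gh(2)]
      by - (rule exI[of _ "\<lambda>x. pdiff i g x + pdiff i h x"], rule conjI,
          rule exI[of _ "pdiff i g"], rule exI[of _ "pdiff i h"], simp_all)
  qed
  show "\<exists>C. \<forall>x. norm x ^ k * norm (u x) \<le> C" for k
  proof -
    obtain C D where C: "\<And>x. norm x ^ k * norm (g x) \<le> C" and D: "\<And>x. norm x ^ k * norm (h x) \<le> D"
      using schwartz_decay[OF gh(1), of k] schwartz_decay[OF gh(2), of k] by blast
    have "norm x ^ k * norm (u x) \<le> C + D" for x
    proof -
      have "norm x ^ k * norm (u x) \<le> norm x ^ k * (norm (g x) + norm (h x))"
        unfolding u by (intro mult_left_mono norm_triangle_ineq) simp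
      then show ?thesis using C[of x] D[of x] by (simp add: distrib_left)
    qed
    then show ?thesis by blast
  qed
qed (use assms in blast)

lemma schwartz_cmult: assumes "schwartz g" shows "schwartz (\<lambda>x. c * g x)"
proof (rule schwartz_coinduct[where X="\<lambda>u. \<exists>g. schwartz g \<and> u = (\<lambda>x. c * g x)"])
  fix u assume "\<exists>g. schwartz g \<and> u = (\<lambda>x. c * g x)"
  then obtain g where g: "schwartz g" and u: "u = (\<lambda>x. c * g x)" by blast
  show "continuous_on UNIV u" unfolding u by (intro continuous_intros schwartz_continuous g)
  show "\<exists>g'. (\<exists>g. schwartz g \<and> g' = (\<lambda>x. c * g x)) \<and> (\<forall>x. has_pd i u (g' x) x)" for i
  proof -
    have "has_pd i u (c * pdiff i g x) x" for x
      unfolding u by (intro has_pd_cmult schwartz_has_pd g)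
    then show ?thesis
      using schwartz_pdiff[OF g]
      by - (rule exI[of _ "\<lambda>x. c * pdiff i g x"], rule conjI, rule exI[of _ "pdiff i g"], simp_all)
  qed
  show "\<exists>C. \<forall>x. norm x ^ k * norm (u x) \<le> C" for k
  proof -
    obtain C where C: "\<And>x. norm x ^ k * norm (g x) \<le> C" using schwartz_decay[OF g] by blast
    have "norm x ^ k * norm (u x) \<le> norm c * C" for x
      using mult_left_mono[OF C[of x] norm_ge_zero[of c]] by (simp add: u norm_mult mult_ac)
    then show ?thesis by blast
  qed
qed (use assms in blast)

lemma schwartz_zero: "schwartz (\<lambda>x. 0)"
  by (rule schwartz_coinduct[where X="\<lambda>u. u = (\<lambda>x. 0)"]) (auto intro: has_pd_const)

lemma schwartz_sum: "finite K \<Longrightarrow> (\<And>k. k \<in> K \<Longrightarrow> schwartz (g k)) \<Longrightarrow> schwartz (\<lambda>x. \<Sum>k\<in>K. g k x)"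
  by (induction K rule: finite_induct) (auto intro: schwartz_zero schwartz_add)

text \<open>Functions \<open>x\<^sub>j g\<close> alone are not closed under differentiation; the functions \<open>x\<^sub>j g + h\<close> are.\<close>
lemma schwartz_coord: assumes "schwartz g" shows "schwartz (\<lambda>x. of_real (x $ j) * g x)"
proof (rule schwartz_coinduct[where X="\<lambda>u. \<exists>g h. schwartz g \<and> schwartz h \<and> u = (\<lambda>x. of_real (x $ j) * g x + h x)"])
  show "\<exists>g' h. schwartz g' \<and> schwartz h \<and> (\<lambda>x. of_real (x $ j) * g x) = (\<lambda>x. of_real (x $ j) * g' x + h x)"
    using assms schwartz_zero by - (rule exI[of _ g], rule exI[of _ "\<lambda>x. 0"], simp)
  fix u assume "\<exists>g h. schwartz g \<and> schwartz h \<and> u = (\<lambda>x. of_real (x $ j) * g x + h x)"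
  then obtain g h where gh: "schwartz g" "schwartz h" and u: "u = (\<lambda>x. of_real (x $ j) * g x + h x)" by blast
  show "continuous_on UNIV u" unfolding u by (intro continuous_intros schwartz_continuous gh)
  show "\<exists>g'. (\<exists>g h. schwartz g \<and> schwartz h \<and> g' = (\<lambda>x. of_real (x $ j) * g x + h x)) \<and> (\<forall>x. has_pd i u (g' x) x)" for i
  proof -
    have "schwartz (pdiff i g)" by (rule schwartz_pdiff[OF gh(1)])
    moreover have "schwartz (\<lambda>x. (if i = j then 1 else 0) * g x + pdiff i h x)"
      by (intro schwartz_add schwartz_cmult schwartz_pdiff gh)
    moreover have "has_pd i u (of_real (x $ j) * pdiff i g x + ((if i = j then 1 else 0) * g x + pdiff i h x)) x" for x
      unfolding u using has_pd_add[OF has_pd_mult[OF has_pd_coord schwartz_has_pd[OF gh(1)]] schwartz_has_pd[OF gh(2)]]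
      by (simp only: add.assoc)
    ultimately show ?thesis
      by - (rule exI[of _ "\<lambda>x. of_real (x $ j) * pdiff i g x + ((if i = j then 1 else 0) * g x + pdiff i h x)"], rule conjI,
          rule exI[of _ "pdiff i g"], rule exI[of _ "\<lambda>x. (if i = j then 1 else 0) * g x + pdiff i h x"], simp_all)
  qed
  show "\<exists>C. \<forall>x. norm x ^ k * norm (u x) \<le> C" for k
  proof -
    obtain C D where C: "\<And>x. norm x ^ Suc k * norm (g x) \<le> C" and D: "\<And>x. norm x ^ k * norm (h x) \<le> D"
      using schwartz_decay[OF gh(1), of "Suc k"] schwartz_decay[OF gh(2), of k] by blast
    have "norm x ^ k * norm (u x) \<le> C + D" for x
    proof -
      have "norm (u x) \<le> norm x * norm (g x) + norm (h x)"
        unfolding u by (rule order_trans[OF norm_triangle_ineq])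
          (auto simp: norm_mult component_le_norm_cart intro!: mult_right_mono)
      then have "norm x ^ k * norm (u x) \<le> norm x ^ k * (norm x * norm (g x) + norm (h x))"
        by (intro mult_left_mono) auto
      then show ?thesis using C[of x] D[of x] by (simp add: distrib_left mult_ac)
    qed
    then show ?thesis by blast
  qed
qed

lemma schwartz_linear: assumes "schwartz g" shows "schwartz (\<lambda>x. of_real (((M::real^'n^'n) *v x) $ j) * g x)"
proof -
  have "(\<lambda>x. of_real ((M *v x) $ j) * g x) = (\<lambda>x. \<Sum>k\<in>UNIV. of_real (M $ j $ k) * (of_real (x $ k) * g x))"
    by (simp add: matrix_vector_mult_def sum_distrib_right mult.assoc)
  then show ?thesis using assms by (simp add: schwartz_sum schwartz_cmult schwartz_coord)
qed

lemma has_pd_chirp: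
  fixes P :: "real^'n^'n"
  assumes "transpose P = P" "has_pd j g D x"
  shows "has_pd j (\<lambda>x. exp (c * of_real ((P *v x) \<bullet> x)) * g x)
    (exp (c * of_real ((P *v x) \<bullet> x)) * (2 * c * (of_real ((P *v x) $ j) * g x) + D)) x"
  using has_pd_mult[OF has_pd_exp[OF has_pd_cmult[OF has_pd_quadratic[OF assms(1)]]] assms(2), of c]
  by (simp add: algebra_simps)

lemma schwartz_chirp:
  fixes P :: "real^'n^'n"
  assumes P: "transpose P = P" and "schwartz g" and c: "Re c = 0"
  shows "schwartz (\<lambda>x. exp (c * of_real ((P *v x) \<bullet> x)) * g x)"
proof (rule schwartz_coinduct[where X="\<lambda>u. \<exists>g. schwartz g \<and> u = (\<lambda>x. exp (c * of_real ((P *v x) \<bullet> x)) * g x)"])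
  fix u assume "\<exists>g. schwartz g \<and> u = (\<lambda>x. exp (c * of_real ((P *v x) \<bullet> x)) * g x)"
  then obtain g where g: "schwartz g" and u: "u = (\<lambda>x. exp (c * of_real ((P *v x) \<bullet> x)) * g x)" by blast
  show "continuous_on UNIV u" unfolding u by (intro continuous_intros schwartz_continuous g matrix_vector_mult_linear_continuous_on)
  show "\<exists>g'. (\<exists>g. schwartz g \<and> g' = (\<lambda>x. exp (c * of_real ((P *v x) \<bullet> x)) * g x)) \<and> (\<forall>x. has_pd i u (g' x) x)" for i
  proof -
    have "schwartz (\<lambda>x. 2 * c * (of_real ((P *v x) $ i) * g x) + pdiff i g x)"
      by (intro schwartz_add schwartz_cmult schwartz_linear schwartz_pdiff g)
    moreover have "has_pd i u (exp (c * of_real ((P *v x) \<bullet> x)) * (2 * c * (of_real ((P *v x) $ i) * g x) + pdiff i g x)) x" for x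
      unfolding u by (rule has_pd_chirp[OF P schwartz_has_pd[OF g]])
    ultimately show ?thesis
      by - (rule exI[of _ "\<lambda>x. exp (c * of_real ((P *v x) \<bullet> x)) * (2 * c * (of_real ((P *v x) $ i) * g x) + pdiff i g x)"], rule conjI,
          rule exI[of _ "\<lambda>x. 2 * c * (of_real ((P *v x) $ i) * g x) + pdiff i g x"], simp_all)
  qed
  show "\<exists>C. \<forall>x. norm x ^ k * norm (u x) \<le> C" for k
    using schwartz_decay[OF g, of k] by (simp add: u norm_mult c)
qed (use assms in blast)

lemma schwartz_integrable:
  fixes g :: "real^'n \<Rightarrow> complex"
  assumes g: "schwartz g"
  shows "integrable lborel g"
proof -
  obtain C where C: "\<And>k x. norm x ^ k * norm (g x) \<le> C k" using schwartz_decay[OF g] by metis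
  show ?thesis
  proof (rule integrable_decay)
    show "g \<in> borel_measurable borel"
      by (intro borel_measurable_continuous_onI schwartz_continuous g)
    fix x :: "real^'n"
    have "(1 + (norm x)\<^sup>2) ^ CARD('n) * norm (g x)
        = (\<Sum>k\<le>CARD('n). of_nat (CARD('n) choose k) * (norm x ^ (2 * (CARD('n) - k)) * norm (g x)))"
      by (simp add: binomial_ring[of 1] sum_distrib_right power_mult mult.assoc)
    also have "\<dots> \<le> (\<Sum>k\<le>CARD('n). of_nat (CARD('n) choose k) * C (2 * (CARD('n) - k)))"
      by (intro sum_mono mult_left_mono C) auto
    finally show "(1 + (norm x)\<^sup>2) ^ CARD('n) * norm (g x) \<le> (\<Sum>k\<le>CARD('n). of_nat (CARD('n) choose k) * C (2 * (CARD('n) - k)))" .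
  qed
qed

section \<open>Oscillatory integrals\<close>

definition phase :: "real^'n^'n \<Rightarrow> real^'n^'n \<Rightarrow> real^'n \<Rightarrow> real^'n \<Rightarrow> complex" where
  "phase A P x \<xi> = exp (\<i> * of_real ((A *v x) \<bullet> \<xi> - (P *v \<xi>) \<bullet> \<xi>))"

text \<open>With \<open>A = e\<^bsup>tB\<^esup>\<close> and \<open>P = Q(t)\<close> this is the evolution at time \<open>t\<close>; with \<open>P = 0\<close> it is a Fourier transform
composed with a linear map.\<close>
definition osc :: "real^'n^'n \<Rightarrow> real^'n^'n \<Rightarrow> (real^'n \<Rightarrow> complex) \<Rightarrow> real^'n \<Rightarrow> complex" where
  "osc A P h x = (\<integral>\<xi>. phase A P x \<xi> * h \<xi> \<partial>lborel)"

lemma norm_phase [simp]: "norm (phase A P x \<xi>) = 1"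
  unfolding phase_def norm_exp_i_times by simp

lemma continuous_on_matvec [continuous_intros]:
  fixes A :: "'p::topological_space \<Rightarrow> real^'n^'n"
  assumes "continuous_on S A" "continuous_on S x"
  shows "continuous_on S (\<lambda>p. A p *v x p)"
  unfolding matrix_vector_mult_def by (intro continuous_intros assms)

lemma continuous_on_phase [continuous_intros]:
  assumes "continuous_on S A" "continuous_on S P" "continuous_on S x" "continuous_on S \<xi>"
  shows "continuous_on S (\<lambda>p. phase (A p) (P p) (x p) (\<xi> p))"
  unfolding phase_def by (intro continuous_intros assms)

lemma phase_measurable [measurable]: "phase A P x \<in> borel_measurable borel"
  by (intro borel_measurable_continuous_onI continuous_intros)

lemma integrable_phase: 
  assumes "integrable lborel h" shows "integrable lborel (\<lambda>\<xi>. phase A P x \<xi> * h \<xi>)"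
proof (rule Bochner_Integration.integrable_bound[OF assms])
  show "(\<lambda>\<xi>. phase A P x \<xi> * h \<xi>) \<in> borel_measurable lborel"
    using assms by measurable
qed (simp add: norm_mult)

lemma osc_bound: "norm (osc A P h x) \<le> (\<integral>\<xi>. norm (h \<xi>) \<partial>lborel)"
  unfolding osc_def by (rule order_trans[OF integral_norm_bound]) (simp add: norm_mult)

lemma osc_add:
  assumes "integrable lborel g" "integrable lborel h"
  shows "osc A P (\<lambda>\<xi>. g \<xi> + h \<xi>) x = osc A P g x + osc A P h x"
  unfolding osc_def distrib_left by (intro Bochner_Integration.integral_add integrable_phase assms)

lemma osc_cmult: "osc A P (\<lambda>\<xi>. c * h \<xi>) x = c * osc A P h x"
  unfolding osc_def by (simp add: mult.left_commute[of _ c])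

lemma osc_sum:
  assumes "\<And>k. k \<in> K \<Longrightarrow> integrable lborel (g k)"
  shows "osc A P (\<lambda>\<xi>. \<Sum>k\<in>K. g k \<xi>) x = (\<Sum>k\<in>K. osc A P (g k) x)"
  unfolding osc_def sum_distrib_left by (intro Bochner_Integration.integral_sum integrable_phase assms)

lemma continuous_on_osc:
  fixes A P :: "'p::metric_space \<Rightarrow> real^'n^'n"
  assumes h: "integrable lborel h" and c: "continuous_on S A" "continuous_on S P" "continuous_on S x"
  shows "continuous_on S (\<lambda>p. osc (A p) (P p) h (x p))"
  unfolding osc_def
proof (rule continuous_on_integral_param[where b="\<lambda>\<xi>. norm (h \<xi>)"])
  show "continuous_on S (\<lambda>p. phase (A p) (P p) (x p) \<xi> * h \<xi>)" for \<xi>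
    by (intro continuous_intros c)
  show "(\<lambda>\<xi>. phase (A p) (P p) (x p) \<xi> * h \<xi>) \<in> borel_measurable lborel" for p
    using h by measurable
qed (use h in \<open>auto simp: norm_mult\<close>)

lemma osc_has_pd:
  fixes A P :: "real^'n^'n"
  assumes h: "schwartz h"
  shows "has_pd j (osc A P h) (osc A P (\<lambda>\<xi>. \<i> * (of_real ((transpose A *v \<xi>) $ j) * h \<xi>)) x) x"
proof -
  let ?e = "axis j (1::real) :: real^'n"
  have sh: "schwartz (\<lambda>\<xi>. \<i> * (of_real ((transpose A *v \<xi>) $ j) * h \<xi>))"
    by (intro schwartz_cmult schwartz_linear h)
  note ih = schwartz_integrable[OF sh] 
  have e: "(A *v ?e) \<bullet> \<xi> = (transpose A *v \<xi>) $ j" for \<xi>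
    by (metis dot_lmul_matrix inner_axis inner_commute inner_real_def mult.right_neutral vector_transpose_matrix transpose_transpose)
  have "((\<lambda>s. \<integral>\<xi>. phase A P (x + s *\<^sub>R ?e) \<xi> * h \<xi> \<partial>lborel) has_vector_derivative
      (\<integral>\<xi>. phase A P (x + 0 *\<^sub>R ?e) \<xi> * (\<i> * (of_real ((transpose A *v \<xi>) $ j) * h \<xi>)) \<partial>lborel)) (at 0)"
  proof (rule integral_has_vector_derivative_param[where d=1 and b="\<lambda>\<xi>. norm (\<i> * (of_real ((transpose A *v \<xi>) $ j) * h \<xi>))"])
    show "((\<lambda>s. phase A P (x + s *\<^sub>R ?e) \<xi> * h \<xi>) has_vector_derivative
        phase A P (x + s *\<^sub>R ?e) \<xi> * (\<i> * (of_real ((transpose A *v \<xi>) $ j) * h \<xi>))) (at s)" for s \<xi>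
    proof -
      have "((\<lambda>s. exp (\<i> * of_real ((A *v x) \<bullet> \<xi> - (P *v \<xi>) \<bullet> \<xi> + s * (transpose A *v \<xi>) $ j)) * h \<xi>) has_vector_derivative
        exp (\<i> * of_real ((A *v x) \<bullet> \<xi> - (P *v \<xi>) \<bullet> \<xi> + s * (transpose A *v \<xi>) $ j)) * (\<i> * (of_real ((transpose A *v \<xi>) $ j) * h \<xi>))) (at s)"
        unfolding mult.assoc[symmetric] mult.commute[of "exp _" \<i>]
        by (rule derivative_eq_intros has_vector_derivative_real_field | simp)+ 
      then show ?thesis
        unfolding phase_def by (simp add: matrix_vector_right_distrib matrix_vector_mult_scaleR inner_add e algebra_simps)
    qed
    show "integrable lborel (\<lambda>\<xi>. phase A P (x + s *\<^sub>R ?e) \<xi> * h \<xi>)" for s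
      by (intro integrable_phase schwartz_integrable h)
    show "(\<lambda>\<xi>. phase A P (x + 0 *\<^sub>R ?e) \<xi> * (\<i> * (of_real ((transpose A *v \<xi>) $ j) * h \<xi>))) \<in> borel_measurable lborel"
      using borel_measurable_integrable[OF ih] by measurable
    show "integrable lborel (\<lambda>\<xi>. norm (\<i> * (of_real ((transpose A *v \<xi>) $ j) * h \<xi>)))"
      by (rule integrable_norm[OF ih])
  qed (simp_all add: norm_mult)
  then show ?thesis unfolding has_pd_def osc_def by simp
qed

text \<open>Integration by parts in \<open>\<xi>\<^sub>k\<close>: the logarithmic derivative of the phase is \<open>i (A x)\<^sub>k - 2i (P \<xi>)\<^sub>k\<close>.\<close>
lemma osc_mult:
  fixes A P :: "real^'n^'n"
  assumes h: "schwartz h" and P: "transpose P = P"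
  shows "of_real ((A *v x) $ k) * osc A P h x
    = osc A P (\<lambda>\<xi>. 2 * (of_real ((P *v \<xi>) $ k) * h \<xi>) + \<i> * pdiff k h \<xi>) x"
proof -
  let ?u = "\<lambda>\<xi>. phase A P x \<xi> * h \<xi>"
  let ?g = "\<lambda>\<xi>. 2 * (of_real ((P *v \<xi>) $ k) * h \<xi>) + \<i> * pdiff k h \<xi>"
  let ?u' = "\<lambda>\<xi>. phase A P x \<xi> * (\<i> * of_real ((A *v x) $ k) * h \<xi> + (-\<i>) * ?g \<xi>)"
  have sg: "schwartz ?g"
    by (intro schwartz_add schwartz_cmult schwartz_linear schwartz_pdiff h)
  have s': "schwartz (\<lambda>\<xi>. \<i> * of_real ((A *v x) $ k) * h \<xi> + (-\<i>) * ?g \<xi>)"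
    by (intro schwartz_add schwartz_cmult schwartz_linear schwartz_pdiff h)
  \<comment> \<open>\<open>-\<i> * ?g\<close> collects the terms in which the derivative falls on the quadratic phase or on \<open>h\<close>\<close>
  have "(\<integral>\<xi>. ?u' \<xi> \<partial>lborel) = 0"
  proof (rule integral_partial_derivative_zero[where u="?u"])
    show "has_pd k ?u (?u' \<xi>) \<xi>" for \<xi>
    proof -
      have "has_pd k (\<lambda>\<xi>. \<i> * (of_real ((A *v x) \<bullet> \<xi>) - of_real ((P *v \<xi>) \<bullet> \<xi>)))
          (\<i> * (of_real ((A *v x) $ k) - of_real (2 * (P *v \<xi>) $ k))) \<xi>"
        by (intro has_pd_cmult has_pd_diff has_pd_linear has_pd_quadratic P)
      from has_pd_mult[OF has_pd_exp[OF this] schwartz_has_pd[OF h]]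
      show ?thesis unfolding phase_def of_real_diff by (rule back_subst[where P="\<lambda>z. has_pd k _ z \<xi>"]) (simp add: algebra_simps)
    qed
    show "continuous_on UNIV ?u'"
      by (intro continuous_on_mult continuous_on_phase continuous_on_const continuous_on_id schwartz_continuous[OF s'])
    show "integrable lborel ?u" by (rule integrable_phase[OF schwartz_integrable[OF h]])
    show "integrable lborel ?u'" by (rule integrable_phase[OF schwartz_integrable[OF s']])
  qed
  then have "osc A P (\<lambda>\<xi>. \<i> * of_real ((A *v x) $ k) * h \<xi> + (-\<i>) * ?g \<xi>) x = 0"
    unfolding osc_def .
  moreover have "osc A P (\<lambda>\<xi>. \<i> * of_real ((A *v x) $ k) * h \<xi> + (-\<i>) * ?g \<xi>) x
    = \<i> * of_real ((A *v x) $ k) * osc A P h x + (-\<i>) * osc A P ?g x"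
    by (subst osc_add[OF schwartz_integrable[OF schwartz_cmult[OF h]] schwartz_integrable[OF schwartz_cmult[OF sg]]])
      (simp only: osc_cmult)
  ultimately have "\<i> * (of_real ((A *v x) $ k) * osc A P h x - osc A P ?g x) = 0"
    by (simp add: algebra_simps)
  then show ?thesis by simp
qed

lemma norm_mult_le_sum_components:
  fixes v :: "real^'n"
  assumes "c \<ge> 0"
  shows "norm v * c \<le> (\<Sum>j\<in>UNIV. \<bar>v $ j\<bar> * c)"
  using mult_right_mono[OF norm_le_l1_cart[of v] assms] by (simp add: sum_distrib_right)

text \<open>Each factor \<open>(A x)\<^sub>j\<close> is absorbed into the amplitude by \<open>osc_mult\<close>. The constants see \<open>P\<close> only through a bound
on its entries, which makes them uniform over the matrices \<open>e\<^bsup>tB\<^esup>, Q(t)\<close> for \<open>t\<close> in a bounded interval.\<close>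
lemma osc_decay:
  fixes h :: "real^'n \<Rightarrow> complex"
  assumes "schwartz h"
  shows "\<exists>C. \<forall>(A::real^'n^'n) (P::real^'n^'n) x. transpose P = P \<longrightarrow> (\<forall>i j. \<bar>P $ i $ j\<bar> \<le> p) \<longrightarrow> norm (A *v x) ^ k * norm (osc A P h x) \<le> C"
  using assms
proof (induction k arbitrary: h)
  case 0
  then show ?case by (intro exI[of _ "\<integral>\<xi>. norm (h \<xi>) \<partial>lborel"]) (simp add: osc_bound)
next
  case (Suc k)
  define ok where "ok P \<longleftrightarrow> transpose P = P \<and> (\<forall>i j. \<bar>P $ i $ j\<bar> \<le> p)" for P :: "real^'n^'n"
  have IH: "\<exists>C. \<forall>A P x. ok P \<longrightarrow> norm (A *v x) ^ k * norm (osc A P g x) \<le> C" if "schwartz g" for g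
    using Suc.IH[OF that] unfolding ok_def by (simp add: imp_conjL)
  have "\<forall>j. \<exists>C. \<forall>A P x. ok P \<longrightarrow> norm (A *v x) ^ k * norm (osc A P (pdiff j h) x) \<le> C"
    using IH schwartz_pdiff[OF Suc.prems] by blast
  then obtain C where C: "\<And>j A P x. ok P \<Longrightarrow> norm (A *v x) ^ k * norm (osc A P (pdiff j h) x) \<le> C j" by metis
  have "\<forall>j. \<exists>C. \<forall>A P x. ok P \<longrightarrow> norm (A *v x) ^ k * norm (osc A P (\<lambda>\<xi>. of_real (\<xi> $ j) * h \<xi>) x) \<le> C"
    using IH schwartz_coord[OF Suc.prems] by blast
  then obtain D where D: "\<And>j A P x. ok P \<Longrightarrow> norm (A *v x) ^ k * norm (osc A P (\<lambda>\<xi>. of_real (\<xi> $ j) * h \<xi>) x) \<le> D j" by metis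
  have "norm (A *v x) ^ Suc k * norm (osc A P h x) \<le> (\<Sum>j\<in>UNIV. 2 * (\<Sum>l\<in>UNIV. p * D l) + C j)" if ok: "ok P" for A P :: "real^'n^'n" and x
  proof -
    let ?n = "norm (A *v x) ^ k"
    have p: "\<bar>P $ i $ j\<bar> \<le> p" for i j using ok by (simp add: ok_def)
    have step: "\<bar>(A *v x) $ j\<bar> * (?n * norm (osc A P h x)) \<le> 2 * (\<Sum>l\<in>UNIV. p * D l) + C j" for j
    proof -
      have sl: "schwartz (\<lambda>\<xi>. \<Sum>l\<in>UNIV. of_real (P $ j $ l) * (of_real (\<xi> $ l) * h \<xi>))"
        by (intro schwartz_sum schwartz_cmult schwartz_coord Suc.prems) simp
      have "of_real ((A *v x) $ j) * osc A P h x = osc A P (\<lambda>\<xi>. 2 * (of_real ((P *v \<xi>) $ j) * h \<xi>) + \<i> * pdiff j h \<xi>) x"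
        by (rule osc_mult[OF Suc.prems]) (use ok ok_def in blast)
      also have "(\<lambda>\<xi>. 2 * (of_real ((P *v \<xi>) $ j) * h \<xi>) + \<i> * pdiff j h \<xi>)
         = (\<lambda>\<xi>. 2 * (\<Sum>l\<in>UNIV. of_real (P $ j $ l) * (of_real (\<xi> $ l) * h \<xi>)) + \<i> * pdiff j h \<xi>)"
        by (simp add: matrix_vector_mult_def sum_distrib_right mult.assoc)
      also have "osc A P \<dots> x = osc A P (\<lambda>\<xi>. 2 * (\<Sum>l\<in>UNIV. of_real (P $ j $ l) * (of_real (\<xi> $ l) * h \<xi>))) x + osc A P (\<lambda>\<xi>. \<i> * pdiff j h \<xi>) x"
        by (intro osc_add schwartz_integrable schwartz_cmult schwartz_pdiff sl Suc.prems)
      also have "\<dots> = 2 * (\<Sum>l\<in>UNIV. of_real (P $ j $ l) * osc A P (\<lambda>\<xi>. of_real (\<xi> $ l) * h \<xi>) x) + \<i> * osc A P (pdiff j h) x"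
        unfolding osc_cmult by (subst osc_sum) (intro schwartz_integrable schwartz_cmult schwartz_coord Suc.prems, simp only: osc_cmult)
      finally have "of_real ((A *v x) $ j) * osc A P h x = 2 * (\<Sum>l\<in>UNIV. of_real (P $ j $ l) * osc A P (\<lambda>\<xi>. of_real (\<xi> $ l) * h \<xi>) x) + \<i> * osc A P (pdiff j h) x" .
      then have "norm (of_real ((A *v x) $ j) * osc A P h x)
        \<le> norm (2 * (\<Sum>l\<in>UNIV. of_real (P $ j $ l) * osc A P (\<lambda>\<xi>. of_real (\<xi> $ l) * h \<xi>) x)) + norm (\<i> * osc A P (pdiff j h) x)"
        by (simp only: norm_triangle_ineq)
      also have "\<dots> \<le> 2 * (\<Sum>l\<in>UNIV. p * norm (osc A P (\<lambda>\<xi>. of_real (\<xi> $ l) * h \<xi>) x)) + norm (osc A P (pdiff j h) x)"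
        by (auto simp: norm_mult intro!: sum_norm_le mult_right_mono p)
      finally have "?n * norm (of_real ((A *v x) $ j) * osc A P h x)
        \<le> ?n * (2 * (\<Sum>l\<in>UNIV. p * norm (osc A P (\<lambda>\<xi>. of_real (\<xi> $ l) * h \<xi>) x)) + norm (osc A P (pdiff j h) x))"
        by (intro mult_left_mono) auto
      also have "\<dots> = 2 * (\<Sum>l\<in>UNIV. p * (?n * norm (osc A P (\<lambda>\<xi>. of_real (\<xi> $ l) * h \<xi>) x))) + ?n * norm (osc A P (pdiff j h) x)"
        by (simp add: distrib_left sum_distrib_left mult_ac)
      also have "\<dots> \<le> 2 * (\<Sum>l\<in>UNIV. p * D l) + C j"
        using p[of undefined undefined] by (intro add_mono mult_left_mono sum_mono C D ok) auto
      finally show ?thesis by (simp add: norm_mult mult_ac)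
    qed
    have "norm (A *v x) * (?n * norm (osc A P h x)) \<le> (\<Sum>j\<in>UNIV. \<bar>(A *v x) $ j\<bar> * (?n * norm (osc A P h x)))"
      by (rule norm_mult_le_sum_components) simp
    also have "\<dots> \<le> (\<Sum>j\<in>UNIV. 2 * (\<Sum>l\<in>UNIV. p * D l) + C j)"
      by (intro sum_mono step)
    finally show ?thesis by (simp add: mult_ac)
  qed
  then show ?case unfolding ok_def by blast
qed

lemma schwartz_osc:
  fixes A P :: "real^'n^'n"
  assumes A: "invertible A" and P: "transpose P = P" and "schwartz h"
  shows "schwartz (osc A P h)"
proof (rule schwartz_coinduct[where X="\<lambda>u. \<exists>h. schwartz h \<and> u = osc A P h"])
  fix u assume "\<exists>h. schwartz h \<and> u = osc A P h"
  then obtain h where h: "schwartz h" and u: "u = osc A P h" by blast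
  show "continuous_on UNIV u" unfolding u
    by (intro continuous_on_osc schwartz_integrable h continuous_intros)
  show "\<exists>g'. (\<exists>h. schwartz h \<and> g' = osc A P h) \<and> (\<forall>x. has_pd i u (g' x) x)" for i
    unfolding u using osc_has_pd[OF h] schwartz_cmult[OF schwartz_linear[OF h]] by blast
  show "\<exists>C. \<forall>x. norm x ^ k * norm (u x) \<le> C" for k
  proof -
    obtain A' where A': "A' ** A = mat 1" using A by (auto simp: invertible_def)
    obtain K where K: "K > 0" "\<And>y. norm (A' *v y) \<le> norm y * K"
      using bounded_linear.pos_bounded[OF matrix_vector_mul_bounded_linear[of A']] by blast
    have nx: "norm x \<le> K * norm (A *v x)" for x
      using K(2)[of "A *v x"] by (simp add: matrix_vector_mul_assoc A' mult.commute)
    define p where "p = (\<Sum>i\<in>UNIV. \<Sum>j\<in>UNIV. \<bar>P $ i $ j\<bar>)"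
    have "\<bar>P $ i $ j\<bar> \<le> p" for i j
    proof -
      have "\<bar>P $ i $ j\<bar> \<le> (\<Sum>j\<in>UNIV. \<bar>P $ i $ j\<bar>)" by (rule member_le_sum) auto
      also have "\<dots> \<le> p" unfolding p_def by (rule member_le_sum) (auto intro: sum_nonneg)
      finally show ?thesis .
    qed
    then obtain C where C: "\<And>x. norm (A *v x) ^ k * norm (osc A P h x) \<le> C"
      using osc_decay[OF h, of p k] P by blast
    have "norm x ^ k * norm (u x) \<le> K ^ k * C" for x
    proof -
      have "norm x ^ k * norm (u x) \<le> (K * norm (A *v x)) ^ k * norm (u x)"
        by (intro mult_right_mono power_mono nx) auto
      also have "\<dots> = K ^ k * (norm (A *v x) ^ k * norm (osc A P h x))" by (simp add: power_mult_distrib u)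
      also have "\<dots> \<le> K ^ k * C" using K by (intro mult_left_mono C) auto
      finally show ?thesis .
    qed
    then show ?thesis by blast
  qed
qed (use assms in blast)

section \<open>Gaussian integrals\<close>

text \<open>From \<open>a r / k \<le> exp (a r / k)\<close> with \<open>r = 1 + |x|\<^sup>2\<close>.\<close>
lemma gaussian_decay:
  assumes a: "a > 0"
  shows "\<exists>C. \<forall>x::'a::real_normed_vector. (1 + (norm x)\<^sup>2) ^ k * exp (- a * (norm x)\<^sup>2) \<le> C"
proof (cases "k = 0")
  case True
  then show ?thesis using a by (intro exI[of _ 1]) auto
next
  case False
  have "(1 + (norm x)\<^sup>2) ^ k * exp (- a * (norm x)\<^sup>2) \<le> (k / a) ^ k * exp a" for x :: 'a
  proof -
    let ?r = "1 + (norm x)\<^sup>2"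
    have "a * ?r / k \<le> exp (a * ?r / k)" using exp_ge_add_one_self[of "a * ?r / k"] by linarith
    then have "?r \<le> (k / a) * exp (a * ?r / k)" using a False by (simp add: field_simps)
    then have "?r ^ k \<le> ((k / a) * exp (a * ?r / k)) ^ k" by (intro power_mono) auto
    also have "\<dots> = (k / a) ^ k * exp (a * ?r)" using False by (simp only: power_mult_distrib flip: exp_of_nat_mult) simp
    finally have "?r ^ k * exp (- a * (norm x)\<^sup>2) \<le> (k / a) ^ k * exp (a * ?r) * exp (- a * (norm x)\<^sup>2)"
      by (intro mult_right_mono) auto
    also have "\<dots> = (k / a) ^ k * exp a" by (simp add: mult.assoc exp_add[symmetric] algebra_simps)
    finally show ?thesis .
  qed
  then show ?thesis by blast
qed

lemma integrable_gaussian_bound: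
  fixes f :: "real^'n \<Rightarrow> 'b::{banach, second_countable_topology}"
  assumes a: "a > 0" and f: "f \<in> borel_measurable borel"
    and bnd: "\<And>x. norm (f x) \<le> c * ((1 + (norm x)\<^sup>2) ^ k * exp (- a * (norm x)\<^sup>2))"
  shows "integrable lborel f"
proof -
  obtain C where C: "\<And>x::real^'n. (1 + (norm x)\<^sup>2) ^ (CARD('n) + k) * exp (- a * (norm x)\<^sup>2) \<le> C"
    using gaussian_decay[OF a] by blast
  have "0 \<le> c"
    using order_trans[OF norm_ge_zero bnd[of 0]] by (simp add: zero_le_mult_iff)
  show ?thesis
  proof (rule integrable_decay[OF f])
    fix x
    have "(1 + (norm x)\<^sup>2) ^ CARD('n) * norm (f x) \<le> (1 + (norm x)\<^sup>2) ^ CARD('n) * (c * ((1 + (norm x)\<^sup>2) ^ k * exp (- a * (norm x)\<^sup>2)))"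
      by (intro mult_left_mono bnd) auto
    also have "\<dots> = c * ((1 + (norm x)\<^sup>2) ^ (CARD('n) + k) * exp (- a * (norm x)\<^sup>2))"
      by (simp add: power_add mult_ac)
    also have "\<dots> \<le> c * C" by (intro mult_left_mono C \<open>0 \<le> c\<close>)
    finally show "(1 + (norm x)\<^sup>2) ^ CARD('n) * norm (f x) \<le> c * C" .
  qed
qed

lemma integral_real_gaussian:
  assumes a: "a > 0"
  shows "(\<integral>x. exp (- (a * (norm x)\<^sup>2)) \<partial>(lborel :: (real^'n) measure)) = sqrt (pi / a) ^ CARD('n)"
proof -
  have one: "(\<integral>\<^sup>+s. ennreal (exp (- (a * s\<^sup>2))) \<partial>lborel) = ennreal (sqrt (pi / a))"
  proof -
    let ?\<sigma> = "sqrt (1 / (2 * a))"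
    have \<sigma>: "?\<sigma>\<^sup>2 = 1 / (2 * a)" using a by simp
    have "exp (- (a * s\<^sup>2)) = sqrt (pi / a) * normal_density 0 ?\<sigma> s" for s
      unfolding normal_density_def \<sigma> using a by (simp add: real_sqrt_divide field_simps)
    then have "(\<integral>\<^sup>+s. ennreal (exp (- (a * s\<^sup>2))) \<partial>lborel) = (\<integral>\<^sup>+s. ennreal (sqrt (pi / a)) * ennreal (normal_density 0 ?\<sigma> s) \<partial>lborel)"
      using a by (simp add: ennreal_mult'')
    also have "\<dots> = ennreal (sqrt (pi / a)) * (\<integral>\<^sup>+s. ennreal (normal_density 0 ?\<sigma> s) \<partial>lborel)"
      by (subst nn_integral_cmult) auto
    also have "(\<integral>\<^sup>+s. ennreal (normal_density 0 ?\<sigma> s) \<partial>lborel) = 1"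
      using a by (subst nn_integral_eq_integral) auto
    finally show ?thesis by simp
  qed
  have "(\<integral>\<^sup>+x. ennreal (exp (- (a * (norm x)\<^sup>2))) \<partial>(lborel :: (real^'n) measure))
      = (\<integral>\<^sup>+x. (\<Prod>b\<in>Basis. ennreal (exp (- (a * (x \<bullet> b)\<^sup>2)))) \<partial>(lborel :: (real^'n) measure))"
  proof (intro nn_integral_cong)
    fix x :: "real^'n"
    have "(norm x)\<^sup>2 = (\<Sum>b\<in>Basis. (x \<bullet> b)\<^sup>2)"
      unfolding power2_norm_eq_inner by (subst euclidean_inner) (simp add: power2_eq_square)
    then have "exp (- (a * (norm x)\<^sup>2)) = (\<Prod>b\<in>Basis. exp (- (a * (x \<bullet> b)\<^sup>2)))"
      by (simp add: sum_distrib_left sum_negf[symmetric] exp_sum)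
    then show "ennreal (exp (- (a * (norm x)\<^sup>2))) = (\<Prod>b\<in>Basis. ennreal (exp (- (a * (x \<bullet> b)\<^sup>2))))"
      by (simp add: prod_ennreal)
  qed
  also have "\<dots> = (\<Prod>b\<in>(Basis::(real^'n) set). (\<integral>\<^sup>+s. ennreal (exp (- (a * s\<^sup>2))) \<partial>lborel))"
    by (rule nn_integral_lborel_prod) auto
  also have "\<dots> = ennreal (sqrt (pi / a) ^ CARD('n))"
    using a by (simp add: one ennreal_power)
  finally have nn: "(\<integral>\<^sup>+x. ennreal (exp (- (a * (norm x)\<^sup>2))) \<partial>(lborel :: (real^'n) measure)) = ennreal (sqrt (pi / a) ^ CARD('n))" .
  have "(\<integral>x. exp (- (a * (norm x)\<^sup>2)) \<partial>(lborel :: (real^'n) measure)) = enn2real (\<integral>\<^sup>+x. ennreal (exp (- (a * (norm x)\<^sup>2))) \<partial>(lborel :: (real^'n) measure))"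
    by (rule integral_eq_nn_integral) auto
  then show ?thesis using a by (simp add: nn)
qed

definition gauss :: "complex \<Rightarrow> real^'n \<Rightarrow> real^'n \<Rightarrow> complex" where
  "gauss \<mu> v \<xi> = exp (\<i> * of_real (v \<bullet> \<xi>) - \<mu> * of_real ((norm \<xi>)\<^sup>2))"

lemma norm_gauss: "norm (gauss \<mu> v \<xi>) = exp (- Re \<mu> * (norm \<xi>)\<^sup>2)"
  unfolding gauss_def norm_exp_eq_Re by simp

lemma gauss_measurable [measurable]: "gauss \<mu> v \<in> borel_measurable borel"
  unfolding gauss_def by (intro borel_measurable_continuous_onI continuous_intros)

lemma power_le_one_plus_sq: "j \<le> 2 * k \<Longrightarrow> (r::real) \<ge> 0 \<Longrightarrow> r ^ j \<le> (1 + r\<^sup>2) ^ k"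
proof (cases "r \<le> 1")
  case True
  assume "r \<ge> 0"
  then have "r ^ j \<le> 1" using True by (intro power_le_one)
  also have "1 \<le> (1 + r\<^sup>2) ^ k" by (intro one_le_power) auto
  finally show ?thesis .
next
  case False
  assume "j \<le> 2 * k"
  then have "r ^ j \<le> r ^ (2 * k)" using False by (intro power_increasing) auto
  also have "\<dots> \<le> (1 + r\<^sup>2) ^ k" unfolding power_mult by (intro power_mono) auto
  finally show ?thesis .
qed

lemma integrable_gauss_mult:
  fixes p :: "real^'n \<Rightarrow> complex"
  assumes \<mu>: "Re \<mu> > 0" and p: "p \<in> borel_measurable borel" "\<And>\<xi>. norm (p \<xi>) \<le> c * (1 + (norm \<xi>)\<^sup>2) ^ k"
  shows "integrable lborel (\<lambda>\<xi>. p \<xi> * gauss \<mu> v \<xi>)"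
proof (rule integrable_gaussian_bound[OF \<mu>])
  show "(\<lambda>\<xi>. p \<xi> * gauss \<mu> v \<xi>) \<in> borel_measurable borel" using p(1) by measurable
  show "norm (p \<xi> * gauss \<mu> v \<xi>) \<le> c * ((1 + (norm \<xi>)\<^sup>2) ^ k * exp (- Re \<mu> * (norm \<xi>)\<^sup>2))" for \<xi>
    using mult_right_mono[OF p(2)[of \<xi>], of "exp (- Re \<mu> * (norm \<xi>)\<^sup>2)"]
    by (simp add: norm_mult norm_gauss mult.assoc)
qed

lemma has_pd_gauss:
  "has_pd j (gauss \<mu> v) ((\<i> * of_real (v $ j) - 2 * \<mu> * of_real (\<xi> $ j)) * gauss \<mu> v \<xi>) \<xi>"
proof -
  have "has_pd j (\<lambda>\<xi>. of_real ((norm \<xi>)\<^sup>2)) (of_real (2 * \<xi> $ j)) \<xi>"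
    using has_pd_quadratic[of "mat 1" j \<xi>] by (simp add: power2_norm_eq_inner)
  from has_pd_exp[OF has_pd_diff[OF has_pd_cmult[OF has_pd_linear[of j v \<xi>], of \<i>] has_pd_cmult[OF this, of \<mu>]]]
  show ?thesis unfolding gauss_def by (simp add: mult_ac)
qed

text \<open>The integrals of \<open>\<partial>\<^sub>j gauss\<close> and of \<open>\<partial>\<^sub>j (\<xi>\<^sub>j gauss)\<close> vanish; these two relations express the first and
second moments through the total mass.\<close>
lemma gauss_moments:
  fixes v :: "real^'n"
  assumes \<mu>: "Re \<mu> > 0"
  defines "F \<equiv> \<integral>\<xi>. gauss \<mu> v \<xi> \<partial>lborel"
  shows "integrable lborel (gauss \<mu> v)"
    and "integrable lborel (\<lambda>\<xi>. of_real (\<xi> $ j) * gauss \<mu> v \<xi>)"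
    and "integrable lborel (\<lambda>\<xi>. of_real (\<xi> $ j) * (of_real (\<xi> $ j) * gauss \<mu> v \<xi>))"
    and "(\<integral>\<xi>. of_real (\<xi> $ j) * gauss \<mu> v \<xi> \<partial>lborel) = \<i> * of_real (v $ j) / (2 * \<mu>) * F"
    and "(\<integral>\<xi>. of_real (\<xi> $ j) * (of_real (\<xi> $ j) * gauss \<mu> v \<xi>) \<partial>lborel) = (1 - of_real ((v $ j)\<^sup>2) / (2 * \<mu>)) / (2 * \<mu>) * F"
proof -
  have \<mu>0: "\<mu> \<noteq> 0" using \<mu> by auto
  have cm: "(\<lambda>\<xi>::real^'n. complex_of_real (\<xi> $ j)) \<in> borel_measurable borel"
    by (intro borel_measurable_continuous_onI continuous_intros)
  show i0: "integrable lborel (gauss \<mu> v)"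
    using integrable_gauss_mult[OF \<mu>, of "\<lambda>_. 1" 1 0 v] by simp
  have n1: "\<bar>\<xi> $ j\<bar> \<le> (1 + (norm \<xi>)\<^sup>2) ^ 1" for \<xi> :: "real^'n"
    using component_le_norm_cart[of \<xi> j] power_le_one_plus_sq[of 1 1 "norm \<xi>"] by simp
  have n2: "\<bar>\<xi> $ j\<bar> * \<bar>\<xi> $ j\<bar> \<le> (1 + (norm \<xi>)\<^sup>2) ^ 1" for \<xi> :: "real^'n"
    using mult_mono[OF component_le_norm_cart[of \<xi> j] component_le_norm_cart[of \<xi> j]] 
    by (simp add: power2_eq_square)
  show i1: "integrable lborel (\<lambda>\<xi>. of_real (\<xi> $ j) * gauss \<mu> v \<xi>)"
    by (rule integrable_gauss_mult[OF \<mu> cm, of 1 1]) (use n1 in simp)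
  have "integrable lborel (\<lambda>\<xi>. (of_real (\<xi> $ j) * of_real (\<xi> $ j)) * gauss \<mu> v \<xi>)"
    by (rule integrable_gauss_mult[OF \<mu>, of _ 1 1]) (use n2 cm in \<open>auto simp: norm_mult\<close>)
  then show i2: "integrable lborel (\<lambda>\<xi>. of_real (\<xi> $ j) * (of_real (\<xi> $ j) * gauss \<mu> v \<xi>))"
    by (simp add: mult.assoc)
  let ?a = "\<integral>\<xi>. of_real (\<xi> $ j) * gauss \<mu> v \<xi> \<partial>lborel"
  let ?b = "\<integral>\<xi>. of_real (\<xi> $ j) * (of_real (\<xi> $ j) * gauss \<mu> v \<xi>) \<partial>lborel"
  have cg: "continuous_on UNIV (gauss \<mu> v)" unfolding gauss_def by (intro continuous_intros)
  have pd0: "has_pd j (gauss \<mu> v) (\<i> * of_real (v $ j) * gauss \<mu> v \<xi> - 2 * \<mu> * (of_real (\<xi> $ j) * gauss \<mu> v \<xi>)) \<xi>" for \<xi>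
    using has_pd_gauss[of j \<mu> v \<xi>] by (simp add: algebra_simps)
  have "(\<integral>\<xi>. \<i> * of_real (v $ j) * gauss \<mu> v \<xi> - 2 * \<mu> * (of_real (\<xi> $ j) * gauss \<mu> v \<xi>) \<partial>lborel) = 0"
    by (rule integral_partial_derivative_zero[OF pd0])
       (use i0 i1 in \<open>auto intro!: continuous_intros cg\<close>)
  then have a: "\<i> * of_real (v $ j) * F = 2 * \<mu> * ?a"
    using i0 i1 by (simp add: F_def)
  then show *: "?a = \<i> * of_real (v $ j) / (2 * \<mu>) * F" using \<mu>0 by (simp add: field_simps)
  have pd1: "has_pd j (\<lambda>\<xi>. of_real (\<xi> $ j) * gauss \<mu> v \<xi>)
      (gauss \<mu> v \<xi> + \<i> * of_real (v $ j) * (of_real (\<xi> $ j) * gauss \<mu> v \<xi>) - 2 * \<mu> * (of_real (\<xi> $ j) * (of_real (\<xi> $ j) * gauss \<mu> v \<xi>))) \<xi>" for \<xi>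
    using has_pd_mult[OF has_pd_coord[of j j \<xi>] pd0[of \<xi>]] by (simp add: algebra_simps)
  have "(\<integral>\<xi>. gauss \<mu> v \<xi> + \<i> * of_real (v $ j) * (of_real (\<xi> $ j) * gauss \<mu> v \<xi>) - 2 * \<mu> * (of_real (\<xi> $ j) * (of_real (\<xi> $ j) * gauss \<mu> v \<xi>)) \<partial>lborel) = 0"
    by (rule integral_partial_derivative_zero[OF pd1])
       (use i0 i1 i2 in \<open>auto intro!: continuous_intros cg\<close>)
  then have "F + \<i> * of_real (v $ j) * ?a = 2 * \<mu> * ?b"
    using i0 i1 i2 by (simp add: F_def)
  then show "?b = (1 - of_real ((v $ j)\<^sup>2) / (2 * \<mu>)) / (2 * \<mu>) * F"
    unfolding * using \<mu>0 by (simp add: field_simps power2_eq_square)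
qed

text \<open>The pair \<open>(\<mu>, z)\<close> is joined to the real Gaussian \<open>(Re \<mu>, 0)\<close> by the path \<open>s \<mapsto> (Re \<mu> + i s Im \<mu>, s z)\<close>. Along it the
moment relations turn the derivative of the integral into a multiple of the integral, a scalar linear
differential equation that the right-hand side solves too. This continues the real value to complex
\<open>\<mu>\<close> without leaving the principal branch of the logarithm.\<close>
theorem integral_gauss:
  fixes z :: "real^'n"
  assumes \<mu>: "Re \<mu> > 0"
  shows "(\<integral>\<xi>. gauss \<mu> z \<xi> \<partial>lborel)
    = of_real (sqrt pi ^ CARD('n)) * exp (- (of_nat CARD('n) / 2) * Ln \<mu>) * exp (- of_real ((norm z)\<^sup>2) / (4 * \<mu>))"
proof -
  define \<epsilon> \<kappa> where "\<epsilon> = Re \<mu>" and "\<kappa> = Im \<mu>"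
  have \<epsilon>: "\<epsilon> > 0" using \<mu> by (simp add: \<epsilon>_def)
  let ?m = "of_nat CARD('n) :: complex"
  let ?n = "of_real ((norm z)\<^sup>2) :: complex"
  define l where "l s = of_real \<epsilon> + of_real s * (\<i> * of_real \<kappa>)" for s
  have Rel: "Re (l s) = \<epsilon>" for s by (simp add: l_def)
  have l0: "l s \<noteq> 0" for s using Rel[of s] \<epsilon> by auto
  have Rp: "Re (l s) > 0" for s using \<epsilon> Rel by simp
  define F where "F s = (\<integral>\<xi>. gauss (l s) (s *\<^sub>R z) \<xi> \<partial>lborel)" for s
  \<comment> \<open>the claimed value of the integral at parameter \<open>s\<close> is a constant times \<open>exp (- L s)\<close>\<close>
  define L where "L s = of_real (s\<^sup>2) * ?n / (4 * l s) + (?m / 2) * Ln (l s)" for s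
  define L' where "L' s = of_real s * ?n / (2 * l s) - of_real (s\<^sup>2) * ?n * (\<i> * of_real \<kappa>) / (4 * (l s)\<^sup>2) + ?m * (\<i> * of_real \<kappa>) / (2 * l s)" for s
  have dl: "(l has_vector_derivative \<i> * of_real \<kappa>) (at s)" for s
  proof -
    have "((\<lambda>s. complex_of_real \<epsilon> + of_real s * (\<i> * of_real \<kappa>)) has_vector_derivative 0 + 1 * (\<i> * of_real \<kappa>)) (at s)"
      by (intro has_vector_derivative_add has_vector_derivative_const has_vector_derivative_mult_left)
        (use has_vector_derivative_of_real[OF DERIV_ident] in simp)
    then show ?thesis unfolding l_def by simp
  qed
  have dL: "(L has_vector_derivative L' s) (at s)" for s
  proof -
    have nr: "l s \<notin> \<real>\<^sub>\<le>\<^sub>0" using Rp[of s] by (auto simp: complex_nonpos_Reals_iff)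
    have d1: "((\<lambda>s. Ln (l s)) has_vector_derivative (\<i> * of_real \<kappa>) * inverse (l s)) (at s)"
      using field_vector_diff_chain_at[OF dl has_field_derivative_Ln[OF nr]] by (simp add: o_def)
    have d2: "((\<lambda>s. inverse (l s)) has_vector_derivative (\<i> * of_real \<kappa>) * (- (inverse (l s) ^ Suc (Suc 0)))) (at s)"
      using field_vector_diff_chain_at[OF dl DERIV_inverse[OF l0]] by (simp add: o_def)
    have d3: "((\<lambda>s. complex_of_real (s\<^sup>2)) has_vector_derivative of_real (2 * s)) (at s)"
      by (rule has_vector_derivative_of_real) (auto intro!: derivative_eq_intros)
    have "((\<lambda>s. (of_real (s\<^sup>2) * inverse (l s)) * (?n / 4) + (?m / 2) * Ln (l s)) has_vector_derivative
       (of_real (s\<^sup>2) * ((\<i> * of_real \<kappa>) * (- (inverse (l s) ^ Suc (Suc 0)))) + of_real (2 * s) * inverse (l s)) * (?n / 4) + (?m / 2) * ((\<i> * of_real \<kappa>) * inverse (l s))) (at s)"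
      by (intro has_vector_derivative_add has_vector_derivative_mult_right has_vector_derivative_mult_left has_vector_derivative_mult d1 d2 d3)
    then show ?thesis
      unfolding L_def L'_def
      by (rule has_vector_derivative_eq_rhs[THEN has_vector_derivative_transform_within_open[where S=UNIV]])
         (auto simp: field_simps power2_eq_square l0)
  qed
  have dF: "(F has_vector_derivative - L' s * F s) (at s)" for s
  proof -
    let ?G' = "\<lambda>s \<xi>. (\<i> * of_real (z \<bullet> \<xi>) - \<i> * of_real \<kappa> * of_real ((norm \<xi>)\<^sup>2)) * gauss (l s) (s *\<^sub>R z) \<xi>"
    have split: "?G' s \<xi> = (\<Sum>j\<in>UNIV. \<i> * of_real (z $ j) * (of_real (\<xi> $ j) * gauss (l s) (s *\<^sub>R z) \<xi>)
          - \<i> * of_real \<kappa> * (of_real (\<xi> $ j) * (of_real (\<xi> $ j) * gauss (l s) (s *\<^sub>R z) \<xi>)))" for \<xi>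
      by (simp add: power2_norm_eq_inner inner_vec_def sum_subtractf sum_distrib_left sum_distrib_right left_diff_distrib right_diff_distrib mult_ac)
    have "((\<lambda>s. \<integral>\<xi>. gauss (l s) (s *\<^sub>R z) \<xi> \<partial>lborel) has_vector_derivative (\<integral>\<xi>. ?G' s \<xi> \<partial>lborel)) (at s)"
    proof (rule integral_has_vector_derivative_param[where d=1 and b="\<lambda>\<xi>. (norm z + \<bar>\<kappa>\<bar>) * ((1 + (norm \<xi>)\<^sup>2) ^ 1 * exp (- \<epsilon> * (norm \<xi>)\<^sup>2))"])
      show "integrable lborel (gauss (l r) (r *\<^sub>R z))" for r by (rule gauss_moments(1)[OF Rp])
      show "?G' s \<in> borel_measurable lborel"
        unfolding gauss_def measurable_lborel2 by (intro borel_measurable_continuous_onI continuous_intros)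
      show "((\<lambda>s. gauss (l s) (s *\<^sub>R z) \<xi>) has_vector_derivative ?G' r \<xi>) (at r)" for r \<xi>
      proof -
        have "((\<lambda>s. \<i> * of_real (z \<bullet> \<xi>) * of_real s - l s * of_real ((norm \<xi>)\<^sup>2)) has_vector_derivative
            \<i> * of_real (z \<bullet> \<xi>) * 1 - \<i> * of_real \<kappa> * of_real ((norm \<xi>)\<^sup>2)) (at r)"
          by (intro has_vector_derivative_diff has_vector_derivative_mult_right has_vector_derivative_mult_left dl)
            (use has_vector_derivative_of_real[OF DERIV_ident] in simp)
        from field_vector_diff_chain_at[OF this DERIV_exp]
        show ?thesis unfolding gauss_def by (simp add: o_def mult_ac)
      qed
      show "norm (?G' r \<xi>) \<le> (norm z + \<bar>\<kappa>\<bar>) * ((1 + (norm \<xi>)\<^sup>2) ^ 1 * exp (- \<epsilon> * (norm \<xi>)\<^sup>2))" for r \<xi>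
      proof -
        have "norm (\<i> * of_real (z \<bullet> \<xi>) - \<i> * of_real \<kappa> * of_real ((norm \<xi>)\<^sup>2)) \<le> \<bar>z \<bullet> \<xi>\<bar> + \<bar>\<kappa>\<bar> * (norm \<xi>)\<^sup>2"
          by (rule order_trans[OF norm_triangle_ineq4]) (simp add: norm_mult norm_power)
        also have "\<dots> \<le> norm z * (1 + (norm \<xi>)\<^sup>2) + \<bar>\<kappa>\<bar> * (1 + (norm \<xi>)\<^sup>2)"
        proof (intro add_mono mult_left_mono)
          have "\<bar>z \<bullet> \<xi>\<bar> \<le> norm z * norm \<xi>" by (rule Cauchy_Schwarz_ineq2)
          also have "\<dots> \<le> norm z * (1 + (norm \<xi>)\<^sup>2)"
            using power_le_one_plus_sq[of 1 1 "norm \<xi>"] by (intro mult_left_mono) auto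
          finally show "\<bar>z \<bullet> \<xi>\<bar> \<le> norm z * (1 + (norm \<xi>)\<^sup>2)" .
        qed auto
        finally have "norm (\<i> * of_real (z \<bullet> \<xi>) - \<i> * of_real \<kappa> * of_real ((norm \<xi>)\<^sup>2)) \<le> (norm z + \<bar>\<kappa>\<bar>) * (1 + (norm \<xi>)\<^sup>2)"
          by (simp add: algebra_simps)
        from mult_right_mono[OF this, of "exp (- \<epsilon> * (norm \<xi>)\<^sup>2)"]
        show ?thesis by (simp add: norm_mult norm_gauss Rel mult.assoc)
      qed
      show "integrable lborel (\<lambda>\<xi>::real^'n. (norm z + \<bar>\<kappa>\<bar>) * ((1 + (norm \<xi>)\<^sup>2) ^ 1 * exp (- \<epsilon> * (norm \<xi>)\<^sup>2)))"
        by (rule integrable_gaussian_bound[OF \<epsilon>, of _ "norm z + \<bar>\<kappa>\<bar>" 1]) (auto simp: abs_mult)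
    qed simp
    moreover have "(\<integral>\<xi>. ?G' s \<xi> \<partial>lborel) = - L' s * F s"
    proof -
      note mom = gauss_moments[OF Rp[of s], where v="s *\<^sub>R z", folded F_def]
      have "(\<integral>\<xi>. ?G' s \<xi> \<partial>lborel) = (\<Sum>j\<in>UNIV. \<i> * of_real (z $ j) * (\<i> * of_real ((s *\<^sub>R z) $ j) / (2 * l s) * F s)
          - \<i> * of_real \<kappa> * ((1 - of_real (((s *\<^sub>R z) $ j)\<^sup>2) / (2 * l s)) / (2 * l s) * F s))"
        unfolding split
        by (subst Bochner_Integration.integral_sum)
          (use mom(2,3) in simp, simp add: mom)
      also have "\<dots> = (\<Sum>j\<in>UNIV. - (of_real s * F s / (2 * l s)) * of_real (z $ j * z $ j) - \<i> * of_real \<kappa> / (2 * l s) * F s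
            + (\<i> * of_real \<kappa> * of_real (s\<^sup>2) * F s / (4 * (l s)\<^sup>2)) * of_real (z $ j * z $ j))"
        by (intro sum.cong refl) (use l0[of s] in \<open>simp add: field_simps power2_eq_square\<close>)
      also have "\<dots> = - (of_real s * F s / (2 * l s)) * ?n - ?m * (\<i> * of_real \<kappa> / (2 * l s) * F s)
            + (\<i> * of_real \<kappa> * of_real (s\<^sup>2) * F s / (4 * (l s)\<^sup>2)) * ?n"
        by (simp only: sum.distrib sum_subtractf sum_distrib_left[symmetric] of_real_sum[symmetric] power2_norm_eq_inner inner_vec_def inner_real_def sum_constant mult.left_commute[of "of_nat _"])
      also have "\<dots> = - L' s * F s"
        unfolding L'_def by (simp add: algebra_simps add_divide_distrib diff_divide_distrib)
      finally show ?thesis .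
    qed
    ultimately show ?thesis unfolding F_def[abs_def] by simp
  qed
  have dW: "((\<lambda>s. F s * exp (L s)) has_vector_derivative 0) (at s)" for s
  proof -
    have "((\<lambda>s. exp (L s)) has_vector_derivative L' s * exp (L s)) (at s)"
      using field_vector_diff_chain_at[OF dL DERIV_exp] by (simp add: o_def)
    from has_vector_derivative_mult[OF dF this] show ?thesis by (simp add: algebra_simps)
  qed
  have "\<exists>c. \<forall>s\<in>UNIV. F s * exp (L s) = c"
    by (rule has_derivative_zero_constant) (use dW in \<open>auto simp: has_vector_derivative_def\<close>)
  then have "F 1 * exp (L 1) = F 0 * exp (L 0)" by (metis UNIV_I)
  moreover have "F 0 = of_real (sqrt (pi / \<epsilon>) ^ CARD('n))"
  proof -
    have "F 0 = (\<integral>\<xi>. complex_of_real (exp (- (\<epsilon> * (norm \<xi>)\<^sup>2))) \<partial>(lborel :: (real^'n) measure))"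
      unfolding F_def gauss_def l_def by (simp add: exp_of_real[symmetric])
    then show ?thesis by (simp only: integral_complex_of_real integral_real_gaussian[OF \<epsilon>])
  qed
  moreover have "exp (L 0) = of_real (sqrt \<epsilon> ^ CARD('n))"
  proof -
    have "sqrt \<epsilon> = exp (ln \<epsilon> / 2)" using \<epsilon> by (simp add: powr_half_sqrt[symmetric] powr_def)
    then have "sqrt \<epsilon> ^ CARD('n) = exp (of_nat CARD('n) * (ln \<epsilon> / 2))" by (simp only: exp_of_nat_mult)
    moreover have "L 0 = of_real (of_nat CARD('n) * (ln \<epsilon> / 2))"
      using \<epsilon> by (simp add: L_def l_def Ln_of_real)
    ultimately show ?thesis by (simp only: exp_of_real)
  qed
  ultimately have "F 1 * exp (L 1) = of_real (sqrt pi ^ CARD('n))"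
    using \<epsilon> by (simp add: real_sqrt_divide power_divide)
  moreover have l1: "l 1 = \<mu>" using complex_eq[of \<mu>] by (simp add: l_def \<epsilon>_def \<kappa>_def)
  ultimately have "F 1 = of_real (sqrt pi ^ CARD('n)) * exp (- L 1)"
    by (metis exp_minus_inverse mult.assoc mult.right_neutral)
  moreover have "exp (- L 1) = exp (- (?m / 2) * Ln \<mu>) * exp (- ?n / (4 * \<mu>))"
    unfolding L_def l1 exp_add[symmetric] by (rule arg_cong[where f=exp]) simp
  ultimately show ?thesis unfolding F_def l1 by (simp add: mult.assoc)
qed

section \<open>Fourier inversion and the oscillatory kernel\<close>

definition fourier :: "(real^'n \<Rightarrow> complex) \<Rightarrow> real^'n \<Rightarrow> complex" where
  "fourier w \<xi> = (\<integral>y. exp (- (\<i> * of_real (y \<bullet> \<xi>))) * w y \<partial>lborel)"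

definition gauss_const :: "'n itself \<Rightarrow> complex \<Rightarrow> complex" where
  "gauss_const _ \<mu> = of_real (sqrt pi ^ CARD('n)) * exp (- (of_nat CARD('n) / 2) * Ln \<mu>)"

text \<open>The Gaussian factor makes the double integral of a function against its Fourier transform absolutely
convergent. The limit \<open>\<mu> \<rightarrow> 0\<close> leads to Fourier inversion, and \<open>\<mu> \<rightarrow> i\<close> to the kernel.\<close>
lemma regularised_fubini:
  fixes w :: "real^'n \<Rightarrow> complex" and A :: "real^'n^'n"
  assumes \<mu>: "Re \<mu> > 0" and w: "integrable lborel w"
  shows "(\<integral>\<eta>. gauss \<mu> u \<eta> * (\<integral>y. exp (- (\<i> * of_real ((A *v y) \<bullet> \<eta>))) * w y \<partial>lborel) \<partial>lborel)
    = gauss_const TYPE('n) \<mu> * (\<integral>y. exp (- of_real ((norm (u - A *v y))\<^sup>2) / (4 * \<mu>)) * w y \<partial>lborel)"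
proof -
  have [measurable]: "w \<in> borel_measurable borel" using borel_measurable_integrable[OF w] by simp
  let ?f = "\<lambda>\<eta> y. gauss \<mu> u \<eta> * (exp (- (\<i> * of_real ((A *v y) \<bullet> \<eta>))) * w y)"
  have c: "continuous_on UNIV (\<lambda>p::(real^'n) \<times> (real^'n). exp (- (\<i> * complex_of_real ((A *v snd p) \<bullet> fst p))))"
    by (intro continuous_intros)
  have [measurable]: "(\<lambda>p. exp (- (\<i> * complex_of_real ((A *v snd p) \<bullet> fst p)))) \<in> borel_measurable (borel \<Otimes>\<^sub>M borel)"
    using borel_measurable_continuous_onI[OF c] by (simp add: borel_prod)
  have m: "(\<lambda>(\<eta>, y). ?f \<eta> y) \<in> borel_measurable (lborel \<Otimes>\<^sub>M lborel)"
    by (simp add: case_prod_unfold)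
  have nf: "norm (?f \<eta> y) = norm (gauss \<mu> u \<eta>) * norm (w y)" for \<eta> y
    by (simp add: norm_mult)
  have iw: "integrable lborel (\<lambda>y. ?f \<eta> y)" for \<eta>
  proof (rule Bochner_Integration.integrable_bound[OF integrable_mult_right[OF integrable_norm[OF w], of "norm (gauss \<mu> u \<eta>)"]])
    show "(\<lambda>y. ?f \<eta> y) \<in> borel_measurable lborel"
      by (simp add: borel_measurable_times borel_measurable_continuous_onI continuous_intros)
  qed (simp add: nf)
  have int: "integrable (lborel \<Otimes>\<^sub>M lborel) (\<lambda>(\<eta>, y). ?f \<eta> y)"
  proof (rule lborel_pair.Fubini_integrable[OF m])
    have "(\<lambda>\<eta>. \<integral>y. norm (case (\<eta>, y) of (\<eta>, y) \<Rightarrow> ?f \<eta> y) \<partial>lborel) = (\<lambda>\<eta>. norm (gauss \<mu> u \<eta>) * (\<integral>y. norm (w y) \<partial>lborel))"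
      by (simp only: prod.case nf integral_mult_right_zero)
    then show "integrable lborel (\<lambda>\<eta>. \<integral>y. norm (case (\<eta>, y) of (\<eta>, y) \<Rightarrow> ?f \<eta> y) \<partial>lborel)"
      using gauss_moments(1)[OF \<mu>, of u] by (simp only:) simp
  qed (use iw in simp)
  have "(\<integral>\<eta>. gauss \<mu> u \<eta> * (\<integral>y. exp (- (\<i> * of_real ((A *v y) \<bullet> \<eta>))) * w y \<partial>lborel) \<partial>lborel)
      = (\<integral>\<eta>. \<integral>y. ?f \<eta> y \<partial>lborel \<partial>lborel)"
    by simp
  also have "\<dots> = (\<integral>y. \<integral>\<eta>. ?f \<eta> y \<partial>lborel \<partial>lborel)"
    using lborel_pair.Fubini_integral[OF int] by simp
  also have "\<dots> = (\<integral>y. (gauss_const TYPE('n) \<mu> * exp (- of_real ((norm (u - A *v y))\<^sup>2) / (4 * \<mu>))) * w y \<partial>lborel)"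
  proof (rule Bochner_Integration.integral_cong[OF refl])
    fix y
    have eq: "?f \<eta> y = w y * gauss \<mu> (u - A *v y) \<eta>" for \<eta>
      unfolding gauss_def by (simp add: inner_diff_left exp_add[symmetric] exp_diff algebra_simps)
    have "(\<integral>\<eta>. ?f \<eta> y \<partial>lborel) = w y * (\<integral>\<eta>. gauss \<mu> (u - A *v y) \<eta> \<partial>lborel)"
      unfolding eq by simp
    also have "\<dots> = (gauss_const TYPE('n) \<mu> * exp (- of_real ((norm (u - A *v y))\<^sup>2) / (4 * \<mu>))) * w y"
      unfolding integral_gauss[OF \<mu>] gauss_const_def by (simp only: ac_simps)
    finally show "(\<integral>\<eta>. ?f \<eta> y \<partial>lborel) = (gauss_const TYPE('n) \<mu> * exp (- of_real ((norm (u - A *v y))\<^sup>2) / (4 * \<mu>))) * w y" .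
  qed
  finally show ?thesis by (simp add: mult.assoc)
qed

lemma gauss_limit:
  fixes H :: "real^'n \<Rightarrow> complex"
  assumes H: "integrable lborel H" and M: "M \<longlonglongrightarrow> \<mu>" and pos: "\<And>k. Re (M k) \<ge> 0"
  shows "(\<lambda>k. \<integral>\<eta>. gauss (M k) u \<eta> * H \<eta> \<partial>lborel) \<longlonglongrightarrow> (\<integral>\<eta>. gauss \<mu> u \<eta> * H \<eta> \<partial>lborel)"
proof (rule integral_dominated_convergence[where w="\<lambda>\<eta>. norm (H \<eta>)"])
  have [measurable]: "H \<in> borel_measurable borel" using borel_measurable_integrable[OF H] by simp
  show "(\<lambda>\<eta>. gauss \<mu> u \<eta> * H \<eta>) \<in> borel_measurable lborel" by measurable
  show "(\<lambda>\<eta>. gauss (M k) u \<eta> * H \<eta>) \<in> borel_measurable lborel" for k by measurable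
  show "integrable lborel (\<lambda>\<eta>. norm (H \<eta>))" using H by simp
  show "AE \<eta> in lborel. (\<lambda>k. gauss (M k) u \<eta> * H \<eta>) \<longlonglongrightarrow> gauss \<mu> u \<eta> * H \<eta>"
    unfolding gauss_def by (intro AE_I2 tendsto_intros M)
  show "AE \<eta> in lborel. norm (gauss (M k) u \<eta> * H \<eta>) \<le> norm (H \<eta>)" for k
    using pos[of k] by (intro AE_I2) (auto simp: norm_mult norm_gauss intro!: mult_left_le_one_le)
qed

lemma gauss_0: "gauss 0 u \<eta> = exp (\<i> * of_real (u \<bullet> \<eta>))"
  by (simp add: gauss_def)

text \<open>For \<open>\<mu> = d\<^sup>2/4\<close> the regularised integral is, up to the factor \<open>(2\<pi>)\<^bsup>m\<^esup>\<close>, an average of \<open>w\<close> over a Gaussian of width \<open>d\<close> around \<open>x\<close>, which tends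
to \<open>w x\<close> as \<open>d \<rightarrow> 0\<close>.\<close>
theorem fourier_inversion:
  fixes w :: "real^'n \<Rightarrow> complex"
  assumes w: "integrable lborel w" and cont: "continuous_on UNIV w" and bnd: "\<And>x. norm (w x) \<le> K"
    and F: "integrable lborel (fourier w)"
  shows "(\<integral>\<xi>. exp (\<i> * of_real (x \<bullet> \<xi>)) * fourier w \<xi> \<partial>lborel) = of_real ((2 * pi) ^ CARD('n)) * w x"
proof -
  let ?m = "CARD('n)"
  have [measurable]: "w \<in> borel_measurable borel" using borel_measurable_continuous_onI[OF cont] .
  define d where "d k = inverse (real (Suc k))" for k
  have d: "d k > 0" for k by (simp add: d_def)
  have dl: "d \<longlonglongrightarrow> 0" unfolding d_def by (rule LIMSEQ_inverse_real_of_nat)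
  \<comment> \<open>for this parameter the kernel \<open>exp (- |x - y|\<^sup>2 / (4 M k))\<close> is \<open>exp (- |v|\<^sup>2)\<close> at \<open>y = x + d k v\<close>\<close>
  define M where "M k = complex_of_real ((d k)\<^sup>2 / 4)" for k
  have Mp: "Re (M k) > 0" for k using d[of k] by (simp add: M_def)
  have "(\<lambda>k. complex_of_real ((d k)\<^sup>2 / 4)) \<longlonglongrightarrow> of_real (0\<^sup>2 / 4)"
    by (intro tendsto_intros dl) simp
  then have Ml: "M \<longlonglongrightarrow> 0" by (simp add: M_def[abs_def])
  have lhs: "(\<lambda>k. \<integral>\<eta>. gauss (M k) x \<eta> * fourier w \<eta> \<partial>lborel) \<longlonglongrightarrow> (\<integral>\<eta>. gauss 0 x \<eta> * fourier w \<eta> \<partial>lborel)"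
    by (rule gauss_limit[OF F Ml]) (use Mp less_imp_le in blast)
  have eq: "(\<integral>\<eta>. gauss (M k) x \<eta> * fourier w \<eta> \<partial>lborel)
      = of_real ((2 * sqrt pi) ^ ?m) * (\<integral>v. of_real (exp (- (norm v)\<^sup>2)) * w (x + d k *\<^sub>R v) \<partial>lborel)" for k
  proof -
    let ?g = "\<lambda>y. exp (- of_real ((norm (x - y))\<^sup>2) / (4 * M k)) * w y"
    have [measurable]: "?g \<in> borel_measurable borel" by measurable
    have "(\<integral>\<eta>. gauss (M k) x \<eta> * fourier w \<eta> \<partial>lborel)
       = gauss_const TYPE('n) (M k) * (\<integral>y. ?g y \<partial>lborel)"
      using regularised_fubini[OF Mp[of k] w, of x "mat 1"] by (simp add: fourier_def)
    also have "(\<integral>y. ?g y \<partial>lborel) = (\<integral>y. ?g (y + x) \<partial>lborel)" by (rule integral_translate[symmetric]) measurable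
    also have "\<dots> = \<bar>det (mat (d k) :: real^'n^'n)\<bar> *\<^sub>R (\<integral>v. ?g (mat (d k) *v v + x) \<partial>lborel)"
    proof -
      have dn: "det (mat (d k) :: real^'n^'n) \<noteq> 0" using d[of k] by (simp add: det_diagonal mat_def)
      have gm: "(\<lambda>y. ?g (y + x)) \<in> borel_measurable borel" by measurable
      show ?thesis using integral_matrix_change[OF dn gm] dn by simp
    qed
    also have "det (mat (d k) :: real^'n^'n) = d k ^ ?m" by (simp add: det_diagonal mat_def)
    also have "(\<lambda>v. ?g (mat (d k) *v v + x)) = (\<lambda>v. of_real (exp (- (norm v)\<^sup>2)) * w (x + d k *\<^sub>R v))"
    proof
      fix v :: "real^'n"
      have mv: "mat (d k) *v v = d k *\<^sub>R v"
        by (simp add: vec_eq_iff matrix_vector_mult_def mat_def if_distrib[of "\<lambda>z. z * _"] cong: if_cong)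
      have "(norm (x - (d k *\<^sub>R v + x)))\<^sup>2 = (d k)\<^sup>2 * (norm v)\<^sup>2" by (simp add: power_mult_distrib)
      then have "- complex_of_real ((norm (x - (d k *\<^sub>R v + x)))\<^sup>2) / (4 * M k) = of_real (- (norm v)\<^sup>2)"
        using d[of k] by (simp add: M_def)
      then show "?g (mat (d k) *v v + x) = of_real (exp (- (norm v)\<^sup>2)) * w (x + d k *\<^sub>R v)"
        unfolding mv by (simp only: exp_of_real add.commute)
    qed
    also have "gauss_const TYPE('n) (M k) * (\<bar>d k ^ ?m\<bar> *\<^sub>R (\<integral>v. of_real (exp (- (norm v)\<^sup>2)) * w (x + d k *\<^sub>R v) \<partial>lborel))
       = of_real ((2 * sqrt pi) ^ ?m) * (\<integral>v. of_real (exp (- (norm v)\<^sup>2)) * w (x + d k *\<^sub>R v) \<partial>lborel)"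
    proof -
      have "Ln (M k) = of_real (ln ((d k)\<^sup>2 / 4))" unfolding M_def by (rule Ln_of_real) (use d[of k] in simp)
      also have "ln ((d k)\<^sup>2 / 4) = 2 * ln (d k / 2)"
        using d[of k] ln_realpow[of "d k / 2" 2] by (simp add: power_divide)
      finally have "exp (- (of_nat ?m / 2) * Ln (M k)) = of_real (exp (of_nat ?m * (- ln (d k / 2))))"
        by (simp add: exp_of_real[symmetric])
      also have "exp (of_nat ?m * (- ln (d k / 2))) = (2 / d k) ^ ?m"
        using d[of k] by (simp only: exp_of_nat_mult) (simp add: exp_minus field_simps)
      finally have "gauss_const TYPE('n) (M k) = of_real (sqrt pi ^ ?m * (2 / d k) ^ ?m)"
        by (simp add: gauss_const_def)
      then show ?thesis using d[of k]
        by (simp add: scaleR_conv_of_real power_divide power_mult_distrib mult_ac)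
    qed
    finally show ?thesis .
  qed
  have ig: "integrable lborel (\<lambda>v::real^'n. exp (- (norm v)\<^sup>2))"
    by (rule integrable_gaussian_bound[of 1 _ 1 0]) auto
  have "(\<lambda>k. \<integral>v. of_real (exp (- (norm v)\<^sup>2)) * w (x + d k *\<^sub>R v) \<partial>lborel) \<longlonglongrightarrow> (\<integral>v. of_real (exp (- (norm v)\<^sup>2)) * w x \<partial>(lborel :: (real^'n) measure))"
  proof (rule integral_dominated_convergence[where w="\<lambda>v::real^'n. K * exp (- (norm v)\<^sup>2)"])
    show "AE v in lborel. (\<lambda>k. of_real (exp (- (norm v)\<^sup>2)) * w (x + d k *\<^sub>R v)) \<longlonglongrightarrow> of_real (exp (- (norm v)\<^sup>2)) * w x"
    proof (rule AE_I2)
      fix v :: "real^'n"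
      have "(\<lambda>k. x + d k *\<^sub>R v) \<longlonglongrightarrow> x + 0 *\<^sub>R v" by (intro tendsto_intros dl)
      then have "(\<lambda>k. x + d k *\<^sub>R v) \<longlonglongrightarrow> x" by simp
      then have "(\<lambda>k. w (x + d k *\<^sub>R v)) \<longlonglongrightarrow> w x"
        using cont unfolding continuous_on_sequentially comp_def by blast
      then show "(\<lambda>k. of_real (exp (- (norm v)\<^sup>2)) * w (x + d k *\<^sub>R v)) \<longlonglongrightarrow> of_real (exp (- (norm v)\<^sup>2)) * w x"
        by (intro tendsto_intros)
    qed
    show "AE v in lborel. norm (of_real (exp (- (norm v)\<^sup>2)) * w (x + d k *\<^sub>R v)) \<le> K * exp (- (norm v)\<^sup>2)" for k
      using bnd by (intro AE_I2) (simp add: norm_mult mult.commute)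
  qed (use ig in auto)
  also have "(\<integral>v. of_real (exp (- (norm v)\<^sup>2)) * w x \<partial>(lborel :: (real^'n) measure)) = of_real (sqrt pi ^ ?m) * w x"
    using integral_real_gaussian[where 'n='n, of 1] by simp
  finally have "(\<lambda>k. of_real ((2 * sqrt pi) ^ ?m) * (\<integral>v. of_real (exp (- (norm v)\<^sup>2)) * w (x + d k *\<^sub>R v) \<partial>lborel))
     \<longlonglongrightarrow> of_real ((2 * sqrt pi) ^ ?m) * (of_real (sqrt pi ^ ?m) * w x)"
    by (intro tendsto_intros)
  with lhs have "(\<integral>\<eta>. gauss 0 x \<eta> * fourier w \<eta> \<partial>lborel) = of_real ((2 * sqrt pi) ^ ?m) * (of_real (sqrt pi ^ ?m) * w x)"
    unfolding eq by (rule LIMSEQ_unique)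
  also have "\<dots> = of_real ((2 * (sqrt pi * sqrt pi)) ^ ?m) * w x"
    by (simp add: power_mult_distrib mult_ac del: real_sqrt_mult_self)
  finally show ?thesis by (simp add: gauss_0)
qed

lemma matrix_symmetric_inner:
  fixes P :: "real^'n^'n"
  assumes "transpose P = P"
  shows "(P *v y) \<bullet> z = y \<bullet> (P *v z)"
  by (metis assms dot_lmul_matrix vector_transpose_matrix)

lemma inner_transpose:
  fixes P :: "real^'n^'n"
  shows "(P *v y) \<bullet> z = y \<bullet> (transpose P *v z)"
  by (metis dot_lmul_matrix vector_transpose_matrix transpose_transpose)

text \<open>A family that is orthonormal for the form \<open>\<langle>P x, y\<rangle>\<close> and of maximal size is a basis: otherwise some nonzero vector
is orthogonal to all \<open>P x\<close> and can be added after normalisation. The basis vectors are the columns of \<open>N\<close>.\<close>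
lemma pos_definite_congruent_identity:
  fixes P :: "real^'n^'n"
  assumes sym: "transpose P = P" and pos: "pos_definite P"
  shows "\<exists>N::real^'n^'n. transpose N ** P ** N = mat 1"
proof -
  define good where "good S \<longleftrightarrow> finite S \<and> (\<forall>x\<in>S. \<forall>y\<in>S. (P *v x) \<bullet> y = (if x = y then 1 else 0))" for S
  have card_le: "card S \<le> CARD('n)" if "good S" for S
  proof -
    have fin: "finite S" using that by (simp add: good_def)
    have "independent S"
    proof (rule independent_if_scalars_zero[OF fin])
      fix f x assume s: "(\<Sum>y\<in>S. f y *\<^sub>R y) = 0" and x: "x \<in> S"
      have "0 = (P *v x) \<bullet> (\<Sum>y\<in>S. f y *\<^sub>R y)" using s by simp
      also have "\<dots> = (\<Sum>y\<in>S. f y * (if x = y then 1 else 0))"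
        unfolding inner_sum_right using that x by (intro sum.cong) (auto simp: good_def)
      also have "\<dots> = f x" using fin x by (simp add: if_distrib cong: if_cong)
      finally show "f x = 0" by simp
    qed
    then show ?thesis using independent_bound[of S] by simp
  qed
  have "good {}" by (simp add: good_def)
  then obtain S where S: "good S" and mx: "\<And>S'. good S' \<Longrightarrow> card S' \<le> card S"
    using ex_has_greatest_nat[of good "{}" card "Suc (CARD('n))"] card_le by (metis le_imp_less_Suc)
  have fin: "finite S" using S by (simp add: good_def)
  have "card S = CARD('n)"
  proof (rule ccontr)
    assume "card S \<noteq> CARD('n)"
    then have "card S < CARD('n)" using card_le[OF S] by simp
    then have "dim ((\<lambda>x. P *v x) ` S) < DIM(real^'n)"
      using dim_le_card'[of "(\<lambda>x. P *v x) ` S"] fin card_image_le[OF fin, of "\<lambda>x. P *v x"] by simp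
    then obtain z where z: "z \<noteq> 0" and oz: "\<And>y. y \<in> span ((\<lambda>x. P *v x) ` S) \<Longrightarrow> orthogonal z y"
      using orthogonal_to_subspace_exists by blast
    have o: "(P *v x) \<bullet> z = 0" if "x \<in> S" for x
      using oz[of "P *v x"] that by (auto simp: orthogonal_def span_base inner_commute)
    define q where "q = (P *v z) \<bullet> z"
    have q: "q > 0" using pos z by (simp add: q_def pos_definite_def)
    define b where "b = (1 / sqrt q) *\<^sub>R z"
    have bb: "(P *v b) \<bullet> b = 1"
      using q by (simp add: b_def matrix_vector_mult_scaleR q_def[symmetric])
    have ob: "(P *v x) \<bullet> b = 0" if "x \<in> S" for x using o[OF that] by (simp add: b_def)
    have ob': "(P *v b) \<bullet> x = 0" if "x \<in> S" for x
      using ob[OF that] matrix_symmetric_inner[OF sym] by (metis inner_commute)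
    have "b \<notin> S" using ob bb by fastforce
    moreover have "good (insert b S)" using S ob ob' bb \<open>b \<notin> S\<close> by (auto simp: good_def)
    ultimately show False using mx[of "insert b S"] fin by simp
  qed
  then obtain f :: "'n \<Rightarrow> real^'n" where f: "bij_betw f UNIV S"
    using finite_same_card_bij[of "UNIV :: 'n set" S] fin by auto
  define N :: "real^'n^'n" where "N = (\<chi> i j. f j $ i)"
  have "(transpose N ** P ** N) $ i $ j = mat 1 $ i $ j" for i j
  proof -
    have "(transpose N ** P ** N) $ i $ j = f i \<bullet> (P *v f j)"
      unfolding matrix_mul_assoc[symmetric]
      by (simp add: matrix_matrix_mult_def transpose_def N_def inner_vec_def matrix_vector_mult_def)
    also have "\<dots> = (if f j = f i then 1 else 0)"
      using S f by (subst inner_commute) (auto simp: good_def bij_betw_def)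
    also have "\<dots> = mat 1 $ i $ j"
      using f by (auto simp: mat_def bij_betw_def inj_on_def)
    finally show ?thesis .
  qed
  then show ?thesis by (auto simp: vec_eq_iff)
qed

lemma matvec_uminus: fixes N :: "real^'n^'n" shows "(- N) *v x = - (N *v x)"
  by (simp add: vec_eq_iff matrix_vector_mult_def sum_negf)

lemma invertible_uminus: fixes N :: "real^'n^'n" assumes "invertible N" shows "invertible (- N)"
proof -
  obtain N' where "N' ** N = mat 1" using assms by (auto simp: invertible_def)
  then have "(- N') ** (- N) = mat 1" by (simp add: matrix_matrix_mult_def)
  then show ?thesis using invertible_left_inverse by blast
qed

lemma fourier_matvec:
  fixes N :: "real^'n^'n"
  shows "fourier w (N *v \<eta>) = osc (- N) 0 w \<eta>"
  unfolding fourier_def osc_def phase_def by (simp add: matvec_uminus inner_commute)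

lemma schwartz_fourier_matvec:
  fixes N :: "real^'n^'n"
  assumes "schwartz w" "invertible N"
  shows "schwartz (\<lambda>\<eta>. fourier w (N *v \<eta>))"
proof -
  have "transpose (0 :: real^'n^'n) = 0" by (simp add: transpose_def vec_eq_iff)
  then show ?thesis
    unfolding fourier_matvec by (rule schwartz_osc[OF invertible_uminus[OF assms(2)] _ assms(1)])
qed

lemma schwartz_fourier:
  fixes w :: "real^'n \<Rightarrow> complex"
  assumes "schwartz w" shows "schwartz (fourier w)"
proof -
  have "invertible (mat 1 :: real^'n^'n)" by (metis invertible_left_inverse matrix_mul_lid)
  from schwartz_fourier_matvec[OF assms this] show ?thesis by simp
qed

lemma matrix_inv_left:
  fixes P :: "real^'n^'n"
  assumes "invertible P" shows "matrix_inv P ** P = mat 1"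
  using assms unfolding invertible_def matrix_inv_def by (rule someI2_ex) blast

text \<open>Substituting \<open>\<xi> = N \<eta>\<close> with \<open>N\<^sup>\<star> P N = 1\<close> reduces the quadratic form to \<open>|\<eta>|\<^sup>2\<close>, so that only the scalar parameter \<open>i\<close>
of the Gaussian has to be regularised.\<close>
theorem fourier_chirp_kernel:
  fixes w :: "real^'n \<Rightarrow> complex" and P :: "real^'n^'n"
  assumes w: "schwartz w" and sym: "transpose P = P" and pos: "pos_definite P"
  shows "(\<integral>\<xi>. exp (\<i> * of_real (z \<bullet> \<xi> - (P *v \<xi>) \<bullet> \<xi>)) * fourier w \<xi> \<partial>lborel)
    = of_real (sqrt pi ^ CARD('n)) * (exp (- (\<i> * of_real (real CARD('n) * pi / 4))) / of_real (sqrt (det P)))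
      * (\<integral>y. exp (\<i> * of_real (((matrix_inv P *v (y - z)) \<bullet> (y - z)) / 4)) * w y \<partial>lborel)"
proof -
  obtain N :: "real^'n^'n" where N: "transpose N ** P ** N = mat 1"
    using pos_definite_congruent_identity[OF sym pos] by blast
  have d: "det N * det N * det P = 1"
    using arg_cong[OF N, of det] by (simp add: det_mul mult_ac)
  then have dN: "det N \<noteq> 0" by auto
  have "\<bar>det N\<bar> * \<bar>det N\<bar> * det P = 1" using d by simp
  then have dP: "det P > 0" by (metis abs_mult_self_eq mult_zero_left not_real_square_gt_zero zero_less_mult_pos zero_less_one mult_zero_right)
  have aN: "\<bar>det N\<bar> = 1 / sqrt (det P)"
  proof -
    have "(\<bar>det N\<bar> * sqrt (det P))\<^sup>2 = 1\<^sup>2" using d dP by (simp add: power_mult_distrib) (simp add: power2_eq_square)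
    then have "\<bar>det N\<bar> * sqrt (det P) = 1" using dP by (subst (asm) power2_eq_iff_nonneg) auto
    then show ?thesis using dP by (simp add: field_simps)
  qed
  have inv: "matrix_inv P = N ** transpose N"
  proof -
    have "(P ** N) ** transpose N = mat 1"
      using N by (metis matrix_left_right_inverse matrix_mul_assoc)
    then have PN: "P ** (N ** transpose N) = mat 1" by (simp add: matrix_mul_assoc)
    then have "invertible P" using invertible_right_inverse by blast
    then have L: "matrix_inv P ** P = mat 1" by (rule matrix_inv_left)
    have "matrix_inv P = matrix_inv P ** (P ** (N ** transpose N))" by (simp only: PN matrix_mul_rid)
    also have "\<dots> = N ** transpose N" by (simp only: matrix_mul_assoc L matrix_mul_lid)
    finally show ?thesis .
  qed
  have iN: "invertible N" using dN by (simp add: invertible_det_nz)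
  let ?A = "transpose N" and ?u = "transpose N *v z"
  let ?H = "\<lambda>\<eta>. fourier w (N *v \<eta>)"
  have H: "integrable lborel ?H" by (intro schwartz_integrable schwartz_fourier_matvec w iN)
  have Heq: "?H \<eta> = (\<integral>y. exp (- (\<i> * of_real ((?A *v y) \<bullet> \<eta>))) * w y \<partial>lborel)" for \<eta>
    unfolding fourier_def inner_transpose[of ?A] transpose_transpose ..
  have iw: "integrable lborel w" by (rule schwartz_integrable[OF w])
  have [measurable]: "w \<in> borel_measurable borel" using borel_measurable_integrable[OF iw] by simp
  define M where "M k = \<i> + of_real (inverse (real (Suc k)))" for k
  have Mp: "Re (M k) > 0" for k by (simp add: M_def)
  have "M \<longlonglongrightarrow> \<i> + of_real 0"
    unfolding M_def by (intro tendsto_intros LIMSEQ_inverse_real_of_nat)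
  then have Ml: "M \<longlonglongrightarrow> \<i>" by simp
  have M0: "M k \<noteq> 0" for k using Mp[of k] by auto
  have lhs: "(\<lambda>k. \<integral>\<eta>. gauss (M k) ?u \<eta> * ?H \<eta> \<partial>lborel) \<longlonglongrightarrow> (\<integral>\<eta>. gauss \<i> ?u \<eta> * ?H \<eta> \<partial>lborel)"
    by (rule gauss_limit[OF H Ml]) (use Mp less_imp_le in blast)
  have eq: "(\<integral>\<eta>. gauss (M k) ?u \<eta> * ?H \<eta> \<partial>lborel) = gauss_const TYPE('n) (M k) * (\<integral>y. exp (- of_real ((norm (?u - ?A *v y))\<^sup>2) / (4 * M k)) * w y \<partial>lborel)" for k
    unfolding Heq by (rule regularised_fubini[OF Mp iw])
  have c: "(\<lambda>k. gauss_const TYPE('n) (M k)) \<longlonglongrightarrow> gauss_const TYPE('n) \<i>"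
    unfolding gauss_const_def by (intro tendsto_intros Ml) (simp_all add: complex_nonpos_Reals_iff)
  have meas: "(\<lambda>y. exp (- of_real ((norm (?u - ?A *v y))\<^sup>2) / (4 * c)) * w y) \<in> borel_measurable lborel" if "c \<noteq> 0" for c
    unfolding measurable_lborel2 using that
    by (intro borel_measurable_continuous_onI continuous_intros schwartz_continuous w) simp
  have "(\<lambda>k. \<integral>y. exp (- of_real ((norm (?u - ?A *v y))\<^sup>2) / (4 * M k)) * w y \<partial>lborel) \<longlonglongrightarrow> (\<integral>y. exp (- of_real ((norm (?u - ?A *v y))\<^sup>2) / (4 * \<i>)) * w y \<partial>lborel)"
  proof (rule integral_dominated_convergence[where w="\<lambda>y. norm (w y)"])
    show "AE y in lborel. (\<lambda>k. exp (- of_real ((norm (?u - ?A *v y))\<^sup>2) / (4 * M k)) * w y) \<longlonglongrightarrow> exp (- of_real ((norm (?u - ?A *v y))\<^sup>2) / (4 * \<i>)) * w y"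
      by (intro AE_I2 tendsto_intros Ml) simp
    show "AE y in lborel. norm (exp (- of_real ((norm (?u - ?A *v y))\<^sup>2) / (4 * M k)) * w y) \<le> norm (w y)" for k
    proof (intro AE_I2)
      fix y
      let ?r = "(norm (?u - ?A *v y))\<^sup>2 / 4"
      have "Re (- of_real ((norm (?u - ?A *v y))\<^sup>2) / (4 * M k)) = - ?r * Re (1 / M k)"
      proof -
        have "- of_real ((norm (?u - ?A *v y))\<^sup>2) / (4 * M k) = of_real (- ?r) * (1 / M k)" by simp
        then have "Re (- of_real ((norm (?u - ?A *v y))\<^sup>2) / (4 * M k)) = Re (of_real (- ?r) * (1 / M k))" by (simp only:)
        then show ?thesis by (simp only: times_complex.sel Re_complex_of_real Im_complex_of_real mult_zero_left diff_zero)
      qed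
      also have "Re (1 / M k) \<ge> 0" using Mp[of k] by (simp add: Re_divide)
      then have "- ?r * Re (1 / M k) \<le> 0" by (simp add: mult_nonneg_nonneg)
      finally have "norm (exp (- of_real ((norm (?u - ?A *v y))\<^sup>2) / (4 * M k))) \<le> 1"
        unfolding norm_exp_eq_Re by simp
      then show "norm (exp (- of_real ((norm (?u - ?A *v y))\<^sup>2) / (4 * M k)) * w y) \<le> norm (w y)"
        unfolding norm_mult by (intro mult_left_le_one_le) auto
    qed
    show "(\<lambda>y. exp (- of_real ((norm (?u - ?A *v y))\<^sup>2) / (4 * \<i>)) * w y) \<in> borel_measurable lborel"
      by (rule meas) simp
    show "(\<lambda>y. exp (- of_real ((norm (?u - ?A *v y))\<^sup>2) / (4 * M k)) * w y) \<in> borel_measurable lborel" for k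
      by (rule meas[OF M0])
    show "integrable lborel (\<lambda>y. norm (w y))" using iw by simp
  qed
  from tendsto_mult[OF c this] lhs
  have main: "(\<integral>\<eta>. gauss \<i> ?u \<eta> * ?H \<eta> \<partial>lborel) = gauss_const TYPE('n) \<i> * (\<integral>y. exp (- of_real ((norm (?u - ?A *v y))\<^sup>2) / (4 * \<i>)) * w y \<partial>lborel)"
    unfolding eq[symmetric] using LIMSEQ_unique by blast
  have PN: "(P *v (N *v \<eta>)) \<bullet> (N *v \<eta>) = \<eta> \<bullet> \<eta>" for \<eta>
  proof -
    have "(P *v (N *v \<eta>)) \<bullet> (N *v \<eta>) = ((transpose N ** P ** N) *v \<eta>) \<bullet> \<eta>"
      using inner_transpose[of "transpose N" "P *v (N *v \<eta>)" \<eta>]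
      by (simp only: matrix_vector_mul_assoc matrix_mul_assoc transpose_transpose)
    then show ?thesis by (simp only: N matrix_vector_mul_lid)
  qed
  let ?f = "\<lambda>\<xi>. exp (\<i> * of_real (z \<bullet> \<xi> - (P *v \<xi>) \<bullet> \<xi>)) * fourier w \<xi>"
  have fm: "?f \<in> borel_measurable borel"
    by (intro borel_measurable_continuous_onI continuous_intros schwartz_continuous schwartz_fourier w)
  have "(\<integral>\<xi>. ?f \<xi> \<partial>lborel) = \<bar>det N\<bar> *\<^sub>R (\<integral>\<eta>. ?f (N *v \<eta>) \<partial>lborel)"
    using integral_matrix_change[OF dN fm] dN by simp
  also have "(\<lambda>\<eta>. ?f (N *v \<eta>)) = (\<lambda>\<eta>. gauss \<i> ?u \<eta> * ?H \<eta>)"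
  proof
    fix \<eta>
    have "z \<bullet> (N *v \<eta>) = ?u \<bullet> \<eta>" using inner_transpose[of "transpose N" z \<eta>] by (simp only: transpose_transpose)
    then show "?f (N *v \<eta>) = gauss \<i> ?u \<eta> * ?H \<eta>"
      unfolding gauss_def PN by (simp add: power2_norm_eq_inner[symmetric] right_diff_distrib)
  qed
  also note main
  also have "gauss_const TYPE('n) \<i> = of_real (sqrt pi ^ CARD('n)) * exp (- (\<i> * of_real (real CARD('n) * pi / 4)))"
    unfolding gauss_const_def Ln_ii by (simp add: mult_ac)
  also have "(\<lambda>y. exp (- of_real ((norm (?u - ?A *v y))\<^sup>2) / (4 * \<i>)) * w y) = (\<lambda>y. exp (\<i> * of_real (((matrix_inv P *v (y - z)) \<bullet> (y - z)) / 4)) * w y)"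
  proof
    fix y
    have "(norm (?u - ?A *v y))\<^sup>2 = (?A *v (y - z)) \<bullet> (?A *v (y - z))"
      unfolding power2_norm_eq_inner matrix_vector_mult_diff_distrib by (simp only: inner_diff inner_commute)
    also have "\<dots> = (matrix_inv P *v (y - z)) \<bullet> (y - z)"
      unfolding inv matrix_vector_mul_assoc[symmetric] by (rule inner_transpose[symmetric])
    finally have n: "(norm (?u - ?A *v y))\<^sup>2 = (matrix_inv P *v (y - z)) \<bullet> (y - z)" .
    have c: "- c / (4 * \<i>) = \<i> * (c / 4)" for c :: complex
      by (simp add: divide_eq_eq)
    show "exp (- of_real ((norm (?u - ?A *v y))\<^sup>2) / (4 * \<i>)) * w y = exp (\<i> * of_real (((matrix_inv P *v (y - z)) \<bullet> (y - z)) / 4)) * w y"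
      unfolding n c by simp
  qed
  finally show ?thesis
    by (simp add: aN scaleR_conv_of_real)
qed

section \<open>The matrix exponential\<close>

lemma matrix_mult_entry: "(X ** Y) $ i $ j = (\<Sum>l\<in>UNIV. X $ i $ l * Y $ l $ j)"
  for X :: "real^'n^'m" and Y :: "real^'p^'n"
  by (simp add: matrix_matrix_mult_def)

lemma bounded_linear_matrix_mult_left: "bounded_linear (\<lambda>M. (A :: real^'n^'n) ** (M :: real^'n^'n))"
proof (intro linear_linear[THEN iffD2] linearI)
  show "A ** (X + Y) = A ** X + A ** Y" for X Y :: "real^'n^'n"
    by (simp add: vec_eq_iff matrix_mult_entry distrib_left sum.distrib)
  show "A ** (c *\<^sub>R X) = c *\<^sub>R (A ** X)" for c and X :: "real^'n^'n"
    by (simp add: vec_eq_iff matrix_mult_entry sum_distrib_left mult.left_commute)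
qed

lemma bounded_linear_matrix_mult_right: "bounded_linear (\<lambda>M. (M :: real^'n^'n) ** (A :: real^'n^'n))"
proof (intro linear_linear[THEN iffD2] linearI)
  show "(X + Y) ** A = X ** A + Y ** A" for X Y :: "real^'n^'n"
    by (simp add: vec_eq_iff matrix_mult_entry distrib_right sum.distrib)
  show "(c *\<^sub>R X) ** A = c *\<^sub>R (X ** A)" for c and X :: "real^'n^'n"
    by (simp add: vec_eq_iff matrix_mult_entry sum_distrib_left mult.assoc)
qed

lemma bounded_linear_transpose: "bounded_linear (transpose :: real^'n^'n \<Rightarrow> _)"
  by (intro linear_linear[THEN iffD2] linearI) (simp_all add: vec_eq_iff transpose_def)

lemma bounded_linear_entry: "bounded_linear (\<lambda>M :: real^'n^'n. M $ i $ j)"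
  by (intro linear_linear[THEN iffD2] linearI) simp_all

lemma mpow_scaleR: "mpow (t *\<^sub>R A) k = t ^ k *\<^sub>R mpow A k"
proof (induction k)
  case (Suc k)
  have "(t *\<^sub>R A) ** (t ^ k *\<^sub>R mpow A k) = (t * t ^ k) *\<^sub>R (A ** mpow A k)"
    by (simp add: vec_eq_iff matrix_mult_entry sum_distrib_left mult_ac)
  then show ?case by (simp add: Suc)
qed simp

lemma mpow_commute: "mpow A k ** A = A ** mpow A k"
  by (induction k) (simp_all add: matrix_mul_assoc[symmetric])

lemma mpow_transpose: "transpose (mpow A k) = mpow (transpose A) k"
proof (induction k)
  case (Suc k)
  have "transpose (mpow A (Suc k)) = transpose (mpow A k ** A)" by (simp add: mpow_commute)
  then show ?case by (simp add: matrix_transpose_mul Suc)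
qed (simp add: transpose_mat)

lemma mpow_entry_bound:
  fixes A :: "real^'n^'n"
  shows "\<bar>mpow A k $ i $ j\<bar> \<le> (\<Sum>i\<in>UNIV. \<Sum>j\<in>UNIV. \<bar>A $ i $ j\<bar>) ^ k"
proof (induction k arbitrary: i j)
  case 0 show ?case by (simp add: mat_def)
next
  case (Suc k)
  let ?c = "\<Sum>i\<in>UNIV. \<Sum>j\<in>UNIV. \<bar>A $ i $ j\<bar>"
  have c0: "?c \<ge> 0" by (intro sum_nonneg) auto
  have "\<bar>mpow A (Suc k) $ i $ j\<bar> \<le> (\<Sum>l\<in>UNIV. \<bar>A $ i $ l\<bar> * \<bar>mpow A k $ l $ j\<bar>)"
    by (simp add: matrix_matrix_mult_def) (rule order_trans[OF sum_abs], simp add: abs_mult)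
  also have "\<dots> \<le> (\<Sum>l\<in>UNIV. \<bar>A $ i $ l\<bar> * ?c ^ k)" by (intro sum_mono mult_left_mono Suc) auto
  also have "\<dots> = (\<Sum>l\<in>UNIV. \<bar>A $ i $ l\<bar>) * ?c ^ k" by (simp add: sum_distrib_right)
  also have "\<dots> \<le> ?c * ?c ^ k"
    using c0 by (intro mult_right_mono member_le_sum[of i UNIV "\<lambda>i. \<Sum>l\<in>UNIV. \<bar>A $ i $ l\<bar>"]) (auto intro: sum_nonneg)
  finally show ?case by simp
qed

lemma summable_mpow_entry:
  fixes A :: "real^'n^'n"
  shows "summable (\<lambda>k. mpow A k $ i $ j / fact k * y ^ k)"
proof (rule summable_comparison_test')
  let ?c = "\<Sum>i\<in>UNIV. \<Sum>j\<in>UNIV. \<bar>A $ i $ j\<bar>"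
  show "summable (\<lambda>k. inverse (fact k) * (?c * \<bar>y\<bar>) ^ k)" by (rule summable_exp)
  show "norm (mpow A k $ i $ j / fact k * y ^ k) \<le> inverse (fact k) * (?c * \<bar>y\<bar>) ^ k" if "k \<ge> 0" for k
    using mult_right_mono[OF mpow_entry_bound[of A k i j], of "\<bar>y\<bar> ^ k / fact k"]
    by (simp add: abs_mult power_abs power_mult_distrib field_simps)
qed

lemma mexp_sums: "(\<lambda>k. (1 / fact k) *\<^sub>R mpow A k) sums mexp (A :: real^'n^'n)"
proof -
  let ?L = "(\<chi> i j. \<Sum>k. mpow A k $ i $ j / fact k) :: real^'n^'n"
  have "(\<lambda>n. (\<Sum>k<n. (1 / fact k) *\<^sub>R mpow A k)) \<longlonglongrightarrow> ?L"
  proof (intro vec_tendstoI)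
    fix i j
    show "(\<lambda>n. (\<Sum>k<n. (1 / fact k) *\<^sub>R mpow A k) $ i $ j) \<longlonglongrightarrow> ?L $ i $ j"
      using summable_LIMSEQ[OF summable_mpow_entry[of A i j 1]] by simp
  qed
  then have "(\<lambda>k. (1 / fact k) *\<^sub>R mpow A k) sums ?L" by (simp add: sums_def)
  then show ?thesis unfolding mexp_def by (simp add: sums_iff)
qed

lemma mexp_commute: "mexp A ** A = A ** mexp (A :: real^'n^'n)"
proof -
  have 1: "(\<lambda>k. ((1 / fact k) *\<^sub>R mpow A k) ** A) sums (mexp A ** A)"
    by (rule bounded_linear.sums[OF bounded_linear_matrix_mult_right mexp_sums])
  have 2: "(\<lambda>k. A ** ((1 / fact k) *\<^sub>R mpow A k)) sums (A ** mexp A)"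
    by (rule bounded_linear.sums[OF bounded_linear_matrix_mult_left mexp_sums])
  have "((1 / fact k) *\<^sub>R mpow A k) ** A = A ** ((1 / fact k) *\<^sub>R mpow A k)" for k
    using mpow_commute[of A k] by (simp only: linear_scale[OF bounded_linear.linear[OF bounded_linear_matrix_mult_left]] linear_scale[OF bounded_linear.linear[OF bounded_linear_matrix_mult_right]])
  with 1 have "(\<lambda>k. A ** ((1 / fact k) *\<^sub>R mpow A k)) sums (mexp A ** A)" by (simp only:)
  then show ?thesis using 2 by (rule sums_unique2)
qed

lemma mexp_transpose: "mexp (transpose A) = transpose (mexp (A :: real^'n^'n))"
proof -
  have "(\<lambda>k. transpose ((1 / fact k) *\<^sub>R mpow A k)) sums transpose (mexp A)"
    by (rule bounded_linear.sums[OF bounded_linear_transpose mexp_sums])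
  then have "(\<lambda>k. (1 / fact k) *\<^sub>R mpow (transpose A) k) sums transpose (mexp A)"
    by (simp add: linear_scale[OF bounded_linear.linear[OF bounded_linear_transpose]] mpow_transpose)
  then show ?thesis using mexp_sums sums_unique2 by blast
qed

lemma mexp_entry: "mexp (t *\<^sub>R A) $ i $ j = (\<Sum>k. mpow A k $ i $ j / fact k * t ^ k)"
  for A :: "real^'n^'n"
proof -
  have "(\<lambda>k. ((1 / fact k) *\<^sub>R mpow (t *\<^sub>R A) k) $ i $ j) sums mexp (t *\<^sub>R A) $ i $ j"
    by (rule bounded_linear.sums[OF bounded_linear_entry mexp_sums])
  then show ?thesis by (simp add: mpow_scaleR sums_iff mult_ac)
qed

lemma mexp_0: "mexp (0 :: real^'n^'n) = mat 1"
proof -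
  have "mexp (0 *\<^sub>R A) $ i $ j = mat 1 $ i $ j" for A :: "real^'n^'n" and i j
    by (simp only: mexp_entry powser_zero) simp
  then show ?thesis by (simp add: vec_eq_iff)
qed

text \<open>Each entry of \<open>mexp (t *\<^sub>R A)\<close> is an everywhere convergent power series in \<open>t\<close>.\<close>
lemma mexp_entry_deriv:
  fixes A :: "real^'n^'n"
  shows "((\<lambda>t. mexp (t *\<^sub>R A) $ i $ j) has_real_derivative (A ** mexp (t *\<^sub>R A)) $ i $ j) (at t)"
proof -
  let ?a = "\<lambda>i k. mpow A k $ i $ j / fact k"
  have "((\<lambda>t. \<Sum>k. ?a i k * t ^ k) has_real_derivative (\<Sum>k. diffs (?a i) k * t ^ k)) (at t)"
    by (rule termdiffs_strong_converges_everywhere[OF summable_mpow_entry])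
  moreover have "(\<Sum>k. diffs (?a i) k * t ^ k) = (A ** mexp (t *\<^sub>R A)) $ i $ j"
  proof -
    have "diffs (?a i) k * t ^ k = (\<Sum>l\<in>UNIV. A $ i $ l * (?a l k * t ^ k))" for k
    proof -
      have "diffs (?a i) k = mpow A (Suc k) $ i $ j / fact k"
        by (simp add: diffs_def field_simps del: mpow.simps of_nat_Suc)
      then show ?thesis by (simp add: matrix_matrix_mult_def sum_distrib_right sum_divide_distrib mult.assoc)
    qed
    then have "(\<Sum>k. diffs (?a i) k * t ^ k) = (\<Sum>l\<in>UNIV. \<Sum>k. A $ i $ l * (?a l k * t ^ k))"
      by (simp only:) (rule suminf_sum, rule summable_mult, rule summable_mpow_entry)
    also have "\<dots> = (\<Sum>l\<in>UNIV. A $ i $ l * mexp (t *\<^sub>R A) $ l $ j)"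
      by (simp only: suminf_mult[OF summable_mpow_entry] mexp_entry)
    finally show ?thesis by (simp add: matrix_matrix_mult_def)
  qed
  ultimately show ?thesis by (simp add: mexp_entry[abs_def])
qed

lemma continuous_on_mexp [continuous_intros]:
  fixes A :: "real^'n^'n"
  assumes "continuous_on S g"
  shows "continuous_on S (\<lambda>p. mexp (g p *\<^sub>R A))"
proof -
  have "continuous_on UNIV (\<lambda>t. mexp (t *\<^sub>R A) $ i $ j)" for i j
    using mexp_entry_deriv[of A i j] by (intro continuous_at_imp_continuous_on) (auto intro: DERIV_isCont)
  then have "continuous_on UNIV (\<lambda>t. (\<chi> i j. mexp (t *\<^sub>R A) $ i $ j))"
    by (intro continuous_on_vec_lambda)
  then have "continuous_on UNIV (\<lambda>t. mexp (t *\<^sub>R A))" by simp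
  from continuous_on_compose2[OF this assms] show ?thesis by simp
qed

lemma mexp_inverse:
  fixes A :: "real^'n^'n"
  shows "mexp (t *\<^sub>R (- A)) ** mexp (t *\<^sub>R A) = mat 1"
proof -
  let ?E = "\<lambda>t. mexp (t *\<^sub>R A)" and ?E' = "\<lambda>t. mexp (t *\<^sub>R (- A))"
  have E': "((\<lambda>t. ?E' t $ i $ l) has_real_derivative - (?E' t ** A) $ i $ l) (at t)" for i l t
  proof (cases "t = 0")
    case True
    then show ?thesis using mexp_entry_deriv[of "- A" i l t]
      by (simp add: mexp_0 matrix_matrix_mult_def sum_negf mat_def if_distrib if_distribR cong: if_cong)
  next
    case False
    have "t *\<^sub>R (?E' t ** (- A)) = t *\<^sub>R ((- A) ** ?E' t)"
      using mexp_commute[of "t *\<^sub>R (- A)"]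
      by (simp add: linear_scale[OF bounded_linear.linear[OF bounded_linear_matrix_mult_left]] linear_scale[OF bounded_linear.linear[OF bounded_linear_matrix_mult_right]] vec_eq_iff matrix_matrix_mult_def sum_negf sum_distrib_left mult_ac)
    then have "?E' t ** (- A) = (- A) ** ?E' t" using False by simp
    then show ?thesis using mexp_entry_deriv[of "- A" i l t]
      by (metis (no_types, lifting) bounded_linear_matrix_mult_left bounded_linear.linear linear_neg vector_uminus_component)
  qed
  have "(?E' t ** ?E t) $ i $ j = (mat 1 :: real^'n^'n) $ i $ j" for i j
  proof -
    have d: "((\<lambda>t. (?E' t ** ?E t) $ i $ j) has_real_derivative 0) (at t)" for t
    proof -
      have "((\<lambda>t. \<Sum>l\<in>UNIV. ?E' t $ i $ l * ?E t $ l $ j) has_real_derivative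
          (\<Sum>l\<in>UNIV. - (?E' t ** A) $ i $ l * ?E t $ l $ j + (A ** ?E t) $ l $ j * ?E' t $ i $ l)) (at t)"
        by (intro DERIV_sum DERIV_mult E' mexp_entry_deriv)
      also have "(\<Sum>l\<in>UNIV. - (?E' t ** A) $ i $ l * ?E t $ l $ j + (A ** ?E t) $ l $ j * ?E' t $ i $ l)
          = (?E' t ** (A ** ?E t)) $ i $ j - ((?E' t ** A) ** ?E t) $ i $ j"
        unfolding matrix_mult_entry[of "?E' t" "A ** ?E t"] matrix_mult_entry[of "?E' t ** A" "?E t"]
        by (simp add: sum_subtractf[symmetric] mult.commute)
      also have "\<dots> = 0" by (simp add: matrix_mul_assoc)
      finally show ?thesis by (simp add: matrix_matrix_mult_def)
    qed
    have "(?E' t ** ?E t) $ i $ j = (?E' 0 ** ?E 0) $ i $ j"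
      by (rule DERIV_isconst_all) (use d in blast)
    then show ?thesis by (simp add: mexp_0)
  qed
  then show ?thesis by (simp add: vec_eq_iff)
qed

lemma invertible_mexp: "invertible (mexp (t *\<^sub>R A))" for A :: "real^'n^'n"
  using mexp_inverse[of t A] invertible_left_inverse by blast

section \<open>The covariance matrix\<close>

lemma Qt_integrand_continuous [continuous_intros]:
  fixes Q B :: "real^'n^'n"
  shows "continuous_on S (\<lambda>s. mexp (s *\<^sub>R B) ** Q ** mexp (s *\<^sub>R transpose B))"
proof -
  have mm: "continuous_on S (\<lambda>s. f s ** g s)" if "continuous_on S f" "continuous_on S g" for f g :: "real \<Rightarrow> real^'n^'n"
    unfolding matrix_matrix_mult_def by (intro continuous_intros that)
  show ?thesis by (intro mm continuous_intros)
qed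

lemma Qt_0: "Qt Q B 0 = 0"
  by (simp add: Qt_def)

lemma Qt_continuous: "continuous_on {0..} (Qt Q B)"
proof -
  have "continuous_on {0..b} (Qt Q B)" for b
    unfolding Qt_def by (intro indefinite_integral_continuous_1 integrable_continuous_real Qt_integrand_continuous)
  show ?thesis
  proof (rule continuous_on_eq_continuous_within[THEN iffD2, rule_format])
    fix t :: real assume t: "t \<in> {0..}"
    have "continuous (at t within {0..t+1}) (Qt Q B)"
      using \<open>continuous_on {0..t+1} (Qt Q B)\<close> t by (auto simp: continuous_on_eq_continuous_within)
    moreover have "at t within {0..t+1} = at t within {0..}"
      by (rule at_within_nhd[of _ "{..<t+1}"]) auto
    ultimately show "continuous (at t within {0..}) (Qt Q B)" by (simp add: continuous_within)
  qed
qed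

lemma Qt_deriv:
  assumes "t > 0"
  shows "(Qt Q B has_vector_derivative mexp (t *\<^sub>R B) ** Q ** mexp (t *\<^sub>R transpose B)) (at t)"
proof -
  have "((\<lambda>u. integral {0..u} (\<lambda>s. mexp (s *\<^sub>R B) ** Q ** mexp (s *\<^sub>R transpose B))) has_vector_derivative mexp (t *\<^sub>R B) ** Q ** mexp (t *\<^sub>R transpose B)) (at t within {0..t+1})"
    using assms by (intro integral_has_vector_derivative Qt_integrand_continuous) auto
  then show ?thesis unfolding Qt_def[abs_def] using assms
    by (simp add: at_within_interior[of t "{0..t+1}"])
qed

lemma Qt_symmetric:
  assumes "transpose Q = Q"
  shows "transpose (Qt Q B t) = Qt Q B t"
proof -
  let ?W = "\<lambda>s. mexp (s *\<^sub>R B) ** Q ** mexp (s *\<^sub>R transpose B)"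
  have tr: "mexp (s *\<^sub>R transpose B) = transpose (mexp (s *\<^sub>R B))" for s
    by (metis mexp_transpose linear_scale[OF bounded_linear.linear[OF bounded_linear_transpose]])
  have W: "transpose (?W s) = ?W s" for s
    unfolding tr by (simp add: matrix_transpose_mul assms matrix_mul_assoc)
  have "integral {0..t} (transpose \<circ> ?W) = transpose (integral {0..t} ?W)"
    by (rule integral_linear[OF integrable_continuous_real[OF Qt_integrand_continuous] bounded_linear_transpose])
  then show ?thesis unfolding Qt_def by (simp add: o_def W)
qed

section \<open>The solution operator\<close>

definition evol :: "real^'n^'n \<Rightarrow> real^'n^'n \<Rightarrow> (real^'n \<Rightarrow> complex) \<Rightarrow> real^'n \<Rightarrow> real \<Rightarrow> complex" where
  "evol Q B h x t = osc (mexp (t *\<^sub>R B)) (Qt Q B t) h x"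

text \<open>Multiplication by \<open>i \<xi>\<^sub>k\<close>: the derivative in the \<open>k\<close>-th direction, seen on the amplitude.\<close>
definition imul :: "'n \<Rightarrow> (real^'n \<Rightarrow> complex) \<Rightarrow> real^'n \<Rightarrow> complex" where
  "imul k h \<xi> = \<i> * (of_real (\<xi> $ k) * h \<xi>)"

lemma schwartz_imul: "schwartz h \<Longrightarrow> schwartz (imul k h)"
  unfolding imul_def[abs_def] by (intro schwartz_cmult schwartz_coord)

lemma schwartz_evol:
  assumes "transpose Q = Q" "schwartz h"
  shows "schwartz (\<lambda>x. evol Q B h x t)"
  unfolding evol_def by (intro schwartz_osc invertible_mexp Qt_symmetric assms)

lemma continuous_on_evol:
  assumes "schwartz h"
  shows "continuous_on (UNIV \<times> {0..}) (\<lambda>p. evol Q B h (fst p) (snd p))"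
  unfolding evol_def
  by (intro continuous_on_osc schwartz_integrable assms continuous_intros continuous_on_compose2[OF Qt_continuous]) auto

lemma evol_has_pd:
  assumes h: "schwartz h"
  shows "has_pd j (\<lambda>x. evol Q B h x t) (\<Sum>k\<in>UNIV. of_real (mexp (t *\<^sub>R B) $ k $ j) * evol Q B (imul k h) x t) x"
proof -
  let ?E = "mexp (t *\<^sub>R B)"
  have "(\<lambda>\<xi>. \<i> * (of_real ((transpose ?E *v \<xi>) $ j) * h \<xi>)) = (\<lambda>\<xi>. \<Sum>k\<in>UNIV. of_real (?E $ k $ j) * imul k h \<xi>)"
    by (simp add: imul_def matrix_vector_mult_def transpose_def sum_distrib_left sum_distrib_right mult_ac del: transpose_matrix_vector)
  then have "osc ?E (Qt Q B t) (\<lambda>\<xi>. \<i> * (of_real ((transpose ?E *v \<xi>) $ j) * h \<xi>)) x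
      = osc ?E (Qt Q B t) (\<lambda>\<xi>. \<Sum>k\<in>UNIV. of_real (?E $ k $ j) * imul k h \<xi>) x" by (simp only:)
  also have "\<dots> = (\<Sum>k\<in>UNIV. of_real (?E $ k $ j) * osc ?E (Qt Q B t) (imul k h) x)"
    by (subst osc_sum) (intro schwartz_integrable schwartz_cmult schwartz_imul h, simp only: osc_cmult)
  finally have "osc ?E (Qt Q B t) (\<lambda>\<xi>. \<i> * (of_real ((transpose ?E *v \<xi>) $ j) * h \<xi>)) x = (\<Sum>k\<in>UNIV. of_real (?E $ k $ j) * osc ?E (Qt Q B t) (imul k h) x)" .
  with osc_has_pd[OF h, of j ?E "Qt Q B t" x] show ?thesis
    unfolding evol_def by simp
qed

lemma evol_pdiff:
  assumes "schwartz h"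
  shows "pdiff j (\<lambda>x. evol Q B h x t) = (\<lambda>x. \<Sum>k\<in>UNIV. of_real (mexp (t *\<^sub>R B) $ k $ j) * evol Q B (imul k h) x t)"
  using evol_has_pd[OF assms] by (auto simp: has_pd_iff)

lemma evol_has_pd2:
  assumes h: "schwartz h"
  shows "has_pd i (pdiff j (\<lambda>x. evol Q B h x t)) (\<Sum>k\<in>UNIV. \<Sum>l\<in>UNIV. of_real (mexp (t *\<^sub>R B) $ k $ j * mexp (t *\<^sub>R B) $ l $ i) * evol Q B (imul l (imul k h)) x t) x"
proof -
  have "has_pd i (pdiff j (\<lambda>x. evol Q B h x t)) (\<Sum>k\<in>UNIV. of_real (mexp (t *\<^sub>R B) $ k $ j) * (\<Sum>l\<in>UNIV. of_real (mexp (t *\<^sub>R B) $ l $ i) * evol Q B (imul l (imul k h)) x t)) x"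
    unfolding evol_pdiff[OF h] by (intro has_pd_sum has_pd_cmult evol_has_pd schwartz_imul h)
  then show ?thesis by (simp add: sum_distrib_left mult.assoc)
qed

lemma matvec_expand: "(A *v x) \<bullet> y = (\<Sum>i\<in>UNIV. \<Sum>j\<in>UNIV. A $ i $ j * x $ j * y $ i)"
  for A :: "real^'n^'n"
  by (simp add: inner_vec_def matrix_vector_mult_def sum_distrib_right)

lemma bounded_linear_quadratic: "bounded_linear (\<lambda>M. (M *v \<xi>) \<bullet> \<xi>)" for \<xi> :: "real^'n"
  by (intro linear_linear[THEN iffD2] linearI)
    (simp_all add: matvec_expand algebra_simps sum.distrib sum_distrib_left)

lemma compact_bound:
  fixes f :: "real \<Rightarrow> real"
  assumes "continuous_on {a..b} f"
  shows "\<exists>C. \<forall>s\<in>{a..b}. \<bar>f s\<bar> \<le> C"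
proof -
  have "bounded (f ` {a..b})" by (intro compact_imp_bounded compact_continuous_image assms) simp
  then show ?thesis by (auto simp: bounded_iff)
qed

text \<open>The first sum is the drift, by \<open>B e\<^bsup>tB\<^esup> = e\<^bsup>tB\<^esup> B\<close>, and the second one comes from
\<open>Q'(t) = e\<^bsup>tB\<^esup> Q e\<^bsup>tB*\<^esup>\<close>. Both are written with \<open>imul\<close> to match the derivatives in \<open>x\<close>.\<close>
lemma phase_time_derivative:
  fixes Q B :: "real^'n^'n"
  assumes t: "t > 0"
  defines "E \<equiv> \<lambda>t. mexp (t *\<^sub>R B)"
  shows "((\<lambda>t. phase (E t) (Qt Q B t) x \<xi> * h \<xi>) has_vector_derivative
     phase (E t) (Qt Q B t) x \<xi> * ((\<Sum>k\<in>UNIV. of_real ((E t *v (B *v x)) $ k) * imul k h \<xi>)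
       + (\<Sum>k\<in>UNIV. \<Sum>l\<in>UNIV. \<i> * of_real ((E t ** Q ** transpose (E t)) $ k $ l) * imul l (imul k h) \<xi>))) (at t)"
proof -
  let ?W = "E t ** Q ** transpose (E t)"
  have EB: "E t ** B = B ** E t"
  proof -
    have "t *\<^sub>R (E t ** B) = t *\<^sub>R (B ** E t)"
      using mexp_commute[of "t *\<^sub>R B"]
      by (simp only: E_def linear_scale[OF bounded_linear.linear[OF bounded_linear_matrix_mult_left]] linear_scale[OF bounded_linear.linear[OF bounded_linear_matrix_mult_right]])
    then show ?thesis using t by simp
  qed
  have tr: "mexp (t *\<^sub>R transpose B) = transpose (E t)"
    by (simp only: E_def mexp_transpose[symmetric] linear_scale[OF bounded_linear.linear[OF bounded_linear_transpose]])
  have "((\<lambda>t. \<Sum>i\<in>UNIV. \<Sum>j\<in>UNIV. E t $ i $ j * (x $ j * \<xi> $ i)) has_real_derivative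
      (\<Sum>i\<in>UNIV. \<Sum>j\<in>UNIV. (B ** E t) $ i $ j * (x $ j * \<xi> $ i))) (at t)"
    unfolding E_def by (intro DERIV_sum DERIV_cmult_right mexp_entry_deriv)
  then have "((\<lambda>t. (E t *v x) \<bullet> \<xi>) has_real_derivative ((B ** E t) *v x) \<bullet> \<xi>) (at t)"
    by (simp add: matvec_expand mult.assoc)
  then have d1: "((\<lambda>t. (E t *v x) \<bullet> \<xi>) has_real_derivative (E t *v (B *v x)) \<bullet> \<xi>) (at t)"
    unfolding EB[symmetric] by (simp add: matrix_vector_mul_assoc)
  have "((\<lambda>t. (Qt Q B t *v \<xi>) \<bullet> \<xi>) has_vector_derivative (?W *v \<xi>) \<bullet> \<xi>) (at t)"
    using bounded_linear.has_vector_derivative[OF bounded_linear_quadratic Qt_deriv[OF t, of Q B]] unfolding tr[unfolded E_def] E_def .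
  then have d2: "((\<lambda>t. (Qt Q B t *v \<xi>) \<bullet> \<xi>) has_real_derivative (?W *v \<xi>) \<bullet> \<xi>) (at t)"
    by (simp add: has_real_derivative_iff_has_vector_derivative)
  let ?\<theta>' = "(E t *v (B *v x)) \<bullet> \<xi> - (?W *v \<xi>) \<bullet> \<xi>"
  have "((\<lambda>t. \<i> * complex_of_real ((E t *v x) \<bullet> \<xi> - (Qt Q B t *v \<xi>) \<bullet> \<xi>)) has_vector_derivative \<i> * of_real ?\<theta>') (at t)"
    by (intro has_vector_derivative_mult_right has_vector_derivative_of_real DERIV_diff d1 d2)
  from field_vector_diff_chain_at[OF this DERIV_exp]
  have "((\<lambda>t. phase (E t) (Qt Q B t) x \<xi>) has_vector_derivative \<i> * of_real ?\<theta>' * phase (E t) (Qt Q B t) x \<xi>) (at t)"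
    unfolding phase_def by (simp add: o_def)
  then have D: "((\<lambda>t. phase (E t) (Qt Q B t) x \<xi> * h \<xi>) has_vector_derivative \<i> * of_real ?\<theta>' * phase (E t) (Qt Q B t) x \<xi> * h \<xi>) (at t)"
    by (rule has_vector_derivative_mult_left)
  have eq: "\<i> * of_real ?\<theta>' * h \<xi> = (\<Sum>k\<in>UNIV. of_real ((E t *v (B *v x)) $ k) * imul k h \<xi>)
       + (\<Sum>k\<in>UNIV. \<Sum>l\<in>UNIV. \<i> * of_real (?W $ k $ l) * imul l (imul k h) \<xi>)"
  proof -
    have a: "(\<Sum>k\<in>UNIV. of_real ((E t *v (B *v x)) $ k) * imul k h \<xi>) = \<i> * of_real ((E t *v (B *v x)) \<bullet> \<xi>) * h \<xi>"
      unfolding inner_vec_def of_real_sum by (simp add: imul_def sum_distrib_left sum_distrib_right mult_ac)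
    have "\<i> * of_real (?W $ k $ l) * imul l (imul k h) \<xi> = - \<i> * of_real (?W $ k $ l * \<xi> $ l * \<xi> $ k) * h \<xi>" for k l
    proof -
      have "\<i> * a * (\<i> * (b * (\<i> * (c * d)))) = (\<i> * \<i>) * \<i> * (a * b * c) * d" for a b c d :: complex
        by (simp only: mult_ac)
      then show ?thesis by (simp add: imul_def)
    qed
    then have b: "(\<Sum>k\<in>UNIV. \<Sum>l\<in>UNIV. \<i> * of_real (?W $ k $ l) * imul l (imul k h) \<xi>) = - \<i> * of_real ((?W *v \<xi>) \<bullet> \<xi>) * h \<xi>"
      by (simp only: matvec_expand of_real_sum sum_distrib_left sum_distrib_right)
    show ?thesis unfolding a b by (simp add: algebra_simps)
  qed
  have "\<i> * of_real ?\<theta>' * phase (E t) (Qt Q B t) x \<xi> * h \<xi> = phase (E t) (Qt Q B t) x \<xi> * (\<i> * of_real ?\<theta>' * h \<xi>)"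
    by (simp only: mult_ac)
  with D show ?thesis unfolding eq by (simp only:)
qed

lemma evol_time_derivative:
  fixes Q B :: "real^'n^'n"
  assumes h: "schwartz h" and t: "t > 0"
  defines "E \<equiv> \<lambda>t. mexp (t *\<^sub>R B)"
  shows "(evol Q B h x has_vector_derivative
       ((\<Sum>k\<in>UNIV. of_real ((E t *v (B *v x)) $ k) * evol Q B (imul k h) x t)
       + (\<Sum>k\<in>UNIV. \<Sum>l\<in>UNIV. \<i> * of_real ((E t ** Q ** transpose (E t)) $ k $ l) * evol Q B (imul l (imul k h)) x t))) (at t)"
proof -
  let ?a = "\<lambda>s k. (E s *v (B *v x)) $ k" and ?W = "\<lambda>s. E s ** Q ** transpose (E s)"
  let ?G = "\<lambda>s \<xi>. (\<Sum>k\<in>UNIV. of_real (?a s k) * imul k h \<xi>)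
       + (\<Sum>k\<in>UNIV. \<Sum>l\<in>UNIV. \<i> * of_real (?W s $ k $ l) * imul l (imul k h) \<xi>)"
  have sG: "schwartz (?G s)" for s
    by (intro schwartz_add schwartz_sum schwartz_cmult schwartz_imul h finite)
  have cE: "continuous_on S E" for S unfolding E_def by (intro continuous_intros)
  have ca: "continuous_on S (\<lambda>s. ?a s k)" for S k
    by (intro continuous_intros cE)
  have cW: "continuous_on S (\<lambda>s. ?W s $ k $ l)" for S k l
    unfolding matrix_mult_entry transpose_def by (simp, intro continuous_intros cE)
  obtain Ca where Ca: "\<And>k s. s \<in> {t/2..3*t/2} \<Longrightarrow> \<bar>?a s k\<bar> \<le> Ca k"
    using compact_bound[OF ca] by metis
  obtain CW where CW: "\<And>k l s. s \<in> {t/2..3*t/2} \<Longrightarrow> \<bar>?W s $ k $ l\<bar> \<le> CW k l"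
    using compact_bound[OF cW] by metis
  let ?b = "\<lambda>\<xi>. (\<Sum>k\<in>UNIV. Ca k * norm (imul k h \<xi>)) + (\<Sum>k\<in>UNIV. \<Sum>l\<in>UNIV. CW k l * norm (imul l (imul k h) \<xi>))"
  have "((\<lambda>s. \<integral>\<xi>. phase (E s) (Qt Q B s) x \<xi> * h \<xi> \<partial>lborel) has_vector_derivative
      (\<integral>\<xi>. phase (E t) (Qt Q B t) x \<xi> * ?G t \<xi> \<partial>lborel)) (at t)"
  proof (rule integral_has_vector_derivative_param[where d="t/2" and b="?b"])
    show "integrable lborel (\<lambda>\<xi>. phase (E s) (Qt Q B s) x \<xi> * h \<xi>)" for s
      by (intro integrable_phase schwartz_integrable h)
    show "(\<lambda>\<xi>. phase (E t) (Qt Q B t) x \<xi> * ?G t \<xi>) \<in> borel_measurable lborel"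
      by (intro borel_measurable_integrable integrable_phase schwartz_integrable sG)
    fix s \<xi> assume "\<bar>s - t\<bar> < t / 2"
    then have s: "s > 0" "s \<in> {t/2..3*t/2}" by (auto simp: abs_if split: if_splits)
    show "((\<lambda>s. phase (E s) (Qt Q B s) x \<xi> * h \<xi>) has_vector_derivative phase (E s) (Qt Q B s) x \<xi> * ?G s \<xi>) (at s)"
      unfolding E_def by (rule phase_time_derivative[OF s(1)])
    have "norm (?G s \<xi>) \<le> (\<Sum>k\<in>UNIV. norm (of_real (?a s k) * imul k h \<xi>)) + (\<Sum>k\<in>UNIV. \<Sum>l\<in>UNIV. norm (\<i> * of_real (?W s $ k $ l) * imul l (imul k h) \<xi>))"
      by (intro order_trans[OF norm_triangle_ineq] add_mono order_trans[OF norm_sum] sum_mono norm_sum order_refl)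
    also have "\<dots> \<le> ?b \<xi>"
      unfolding norm_mult norm_of_real norm_ii mult_1 using s by (intro add_mono sum_mono mult_right_mono Ca CW norm_ge_zero)
    finally show "norm (phase (E s) (Qt Q B s) x \<xi> * ?G s \<xi>) \<le> ?b \<xi>" by (simp add: norm_mult)
  next
    show "integrable lborel ?b"
      by (intro Bochner_Integration.integrable_add Bochner_Integration.integrable_sum integrable_mult_right integrable_norm schwartz_integrable schwartz_imul h)
  qed (use t in auto)
  then have "(evol Q B h x has_vector_derivative osc (E t) (Qt Q B t) (?G t) x) (at t)"
    unfolding evol_def[abs_def] osc_def E_def .
  moreover have "osc (E t) (Qt Q B t) (?G t) x = (\<Sum>k\<in>UNIV. of_real (?a t k) * osc (E t) (Qt Q B t) (imul k h) x)
       + (\<Sum>k\<in>UNIV. \<Sum>l\<in>UNIV. \<i> * of_real (?W t $ k $ l) * osc (E t) (Qt Q B t) (imul l (imul k h)) x)"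
    by (subst osc_add, (intro schwartz_integrable schwartz_sum schwartz_cmult schwartz_imul h finite)+,
        subst osc_sum, (intro schwartz_integrable schwartz_sum schwartz_cmult schwartz_imul h finite)+,
        subst osc_sum, (intro schwartz_integrable schwartz_sum schwartz_cmult schwartz_imul h finite)+,
        subst osc_sum, (intro schwartz_integrable schwartz_sum schwartz_cmult schwartz_imul h finite)+,
        simp only: osc_cmult)
  ultimately show ?thesis unfolding evol_def E_def by simp
qed

lemma sum_swap_pairs: "(\<Sum>i\<in>UNIV. \<Sum>j\<in>UNIV. \<Sum>k\<in>UNIV. \<Sum>l\<in>UNIV. f i j k l) = (\<Sum>k\<in>UNIV. \<Sum>l\<in>UNIV. \<Sum>j\<in>UNIV. \<Sum>i\<in>UNIV. f i j k l)"
  for f :: "'n::finite \<Rightarrow> 'n \<Rightarrow> 'n \<Rightarrow> 'n \<Rightarrow> complex"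
proof -
  have "(\<Sum>i\<in>UNIV. \<Sum>j\<in>UNIV. \<Sum>k\<in>UNIV. \<Sum>l\<in>UNIV. f i j k l) = (\<Sum>k\<in>UNIV. \<Sum>i\<in>UNIV. \<Sum>j\<in>UNIV. \<Sum>l\<in>UNIV. f i j k l)"
    by (subst (2) sum.swap, subst sum.swap, rule refl)
  also have "\<dots> = (\<Sum>k\<in>UNIV. \<Sum>l\<in>UNIV. \<Sum>i\<in>UNIV. \<Sum>j\<in>UNIV. f i j k l)"
    by (rule sum.cong[OF refl], subst (2) sum.swap, subst sum.swap, rule refl)
  also have "\<dots> = (\<Sum>k\<in>UNIV. \<Sum>l\<in>UNIV. \<Sum>j\<in>UNIV. \<Sum>i\<in>UNIV. f i j k l)"
    by (intro sum.cong refl sum.swap)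
  finally show ?thesis .
qed

text \<open>Contracting \<open>Q\<close> with the Hessian in \<open>x\<close> produces the matrix \<open>e\<^bsup>tB\<^esup> Q e\<^bsup>tB*\<^esup>\<close> on the amplitude, which is also the
derivative of \<open>Q(t)\<close>; this is the equation. Continuity of all derivatives is that of \<open>evol\<close> for other amplitudes.\<close>
theorem classical_solution_evol:
  fixes Q B :: "real^'n^'n"
  assumes h: "schwartz h"
  shows "classical_solution Q B (\<lambda>x. evol Q B h x 0) (evol Q B h)"
proof -
  let ?E = "\<lambda>t. mexp (t *\<^sub>R B)"
  have c0: "continuous_on (UNIV \<times> {0<..}) (\<lambda>p. evol Q B g (fst p) (snd p))" if "schwartz g" for g
    using continuous_on_evol[OF that] by (rule continuous_on_subset) auto
  have cE: "continuous_on S (\<lambda>p::(real^'n) \<times> real. ?E (snd p))" for S by (intro continuous_intros)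
  have hess: "hess (\<lambda>y. evol Q B h y t) x $ i $ j = (\<Sum>k\<in>UNIV. \<Sum>l\<in>UNIV. of_real (?E t $ k $ j * ?E t $ l $ i) * evol Q B (imul l (imul k h)) x t)" for x t i j
    using evol_has_pd2[OF h] by (simp add: hess_def has_pd_iff)
  have grad: "grad (\<lambda>y. evol Q B h y t) x $ j = (\<Sum>k\<in>UNIV. of_real (?E t $ k $ j) * evol Q B (imul k h) x t)" for x t j
    by (simp add: grad_def evol_pdiff[OF h])
  note dt = vector_derivative_at[OF evol_time_derivative[OF h]]
  show ?thesis
    unfolding classical_solution_def
  proof (intro conjI allI impI)
    show "continuous_on (UNIV \<times> {0..}) (\<lambda>(x, t). evol Q B h x t)"
      using continuous_on_evol[OF h] by (simp add: case_prod_unfold)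
    show "evol Q B h x differentiable at t" if "t > 0" for x t
      using evol_time_derivative[OF h that] by (rule differentiableI_vector)
    show "has_pdiff i (\<lambda>y. evol Q B h y t) x" for i x t
      using evol_has_pd[OF h] by (simp add: has_pd_iff)
    show "has_pdiff i (pdiff j (\<lambda>y. evol Q B h y t)) x" for i j x t
      using evol_has_pd2[OF h] by (simp add: has_pd_iff)
    show "continuous_on (UNIV \<times> {0<..}) (\<lambda>(x, t). vector_derivative (evol Q B h x) (at t))"
    proof (rule continuous_on_eq)
      show "continuous_on (UNIV \<times> {0<..}) (\<lambda>p. (\<Sum>k\<in>UNIV. of_real ((?E (snd p) *v (B *v fst p)) $ k) * evol Q B (imul k h) (fst p) (snd p))
       + (\<Sum>k\<in>UNIV. \<Sum>l\<in>UNIV. \<i> * of_real ((?E (snd p) ** Q ** transpose (?E (snd p))) $ k $ l) * evol Q B (imul l (imul k h)) (fst p) (snd p)))"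
        unfolding matrix_mult_entry transpose_def
        by (simp, intro continuous_intros c0 schwartz_imul h)
    qed (auto simp: dt)
    show "continuous_on (UNIV \<times> {0<..}) (\<lambda>(x, t). grad (\<lambda>y. evol Q B h y t) x)"
    proof -
      have "continuous_on (UNIV \<times> {0<..}) (\<lambda>p. \<chi> j. grad (\<lambda>y. evol Q B h y (snd p)) (fst p) $ j)"
        unfolding grad by (intro continuous_intros continuous_on_vec_lambda c0 schwartz_imul h)
      then show ?thesis by (simp add: case_prod_unfold)
    qed
    show "continuous_on (UNIV \<times> {0<..}) (\<lambda>(x, t). hess (\<lambda>y. evol Q B h y t) x)"
    proof -
      have "continuous_on (UNIV \<times> {0<..}) (\<lambda>p. \<chi> i j. hess (\<lambda>y. evol Q B h y (snd p)) (fst p) $ i $ j)"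
        unfolding hess by (intro continuous_intros continuous_on_vec_lambda c0 schwartz_imul h)
      then show ?thesis by (simp add: case_prod_unfold)
    qed
    show "vector_derivative (evol Q B h x) (at t)
          - \<i> * trace (map_matrix of_real Q ** hess (\<lambda>y. evol Q B h y t) x)
          - bilin (B *v x) (grad (\<lambda>y. evol Q B h y t) x) = 0" if t: "t > 0" for x t
    proof -
      let ?e = "\<lambda>k l. evol Q B (imul l (imul k h)) x t"
      have b: "bilin (B *v x) (grad (\<lambda>y. evol Q B h y t) x) = (\<Sum>k\<in>UNIV. of_real ((?E t *v (B *v x)) $ k) * evol Q B (imul k h) x t)"
      proof -
        have "bilin (B *v x) (grad (\<lambda>y. evol Q B h y t) x) = (\<Sum>j\<in>UNIV. \<Sum>k\<in>UNIV. of_real (?E t $ k $ j * (B *v x) $ j) * evol Q B (imul k h) x t)"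
          by (simp add: bilin_def grad sum_distrib_left mult_ac)
        also have "\<dots> = (\<Sum>k\<in>UNIV. \<Sum>j\<in>UNIV. of_real (?E t $ k $ j * (B *v x) $ j) * evol Q B (imul k h) x t)" by (rule sum.swap)
        also have "\<dots> = (\<Sum>k\<in>UNIV. of_real (\<Sum>j\<in>UNIV. ?E t $ k $ j * (B *v x) $ j) * evol Q B (imul k h) x t)"
          by (simp only: of_real_sum sum_distrib_right)
        finally show ?thesis by (simp add: matrix_vector_mult_def[of "?E t"])
      qed
      have "trace (map_matrix of_real Q ** hess (\<lambda>y. evol Q B h y t) x)
        = (\<Sum>i\<in>UNIV. \<Sum>j\<in>UNIV. \<Sum>k\<in>UNIV. \<Sum>l\<in>UNIV. of_real (?E t $ k $ i * Q $ i $ j * ?E t $ l $ j) * ?e k l)"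
        by (simp add: trace_def matrix_matrix_mult_def map_matrix_def hess sum_distrib_left mult_ac)
      also have "\<dots> = (\<Sum>k\<in>UNIV. \<Sum>l\<in>UNIV. \<Sum>j\<in>UNIV. \<Sum>i\<in>UNIV. of_real (?E t $ k $ i * Q $ i $ j * ?E t $ l $ j) * ?e k l)"
        by (rule sum_swap_pairs)
      also have "\<dots> = (\<Sum>k\<in>UNIV. \<Sum>l\<in>UNIV. of_real (\<Sum>j\<in>UNIV. \<Sum>i\<in>UNIV. ?E t $ k $ i * Q $ i $ j * ?E t $ l $ j) * ?e k l)"
        by (simp only: of_real_sum sum_distrib_right)
      also have "\<dots> = (\<Sum>k\<in>UNIV. \<Sum>l\<in>UNIV. of_real ((?E t ** Q ** transpose (?E t)) $ k $ l) * ?e k l)"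
        by (simp add: matrix_mult_entry transpose_def sum_distrib_right)
      finally have "\<i> * trace (map_matrix of_real Q ** hess (\<lambda>y. evol Q B h y t) x) = (\<Sum>k\<in>UNIV. \<Sum>l\<in>UNIV. \<i> * of_real ((?E t ** Q ** transpose (?E t)) $ k $ l) * ?e k l)"
        by (simp add: sum_distrib_left mult.assoc)
      with b dt[OF t] show ?thesis by simp
    qed
  qed simp
qed

section \<open>Kernel representation and reversibility\<close>

definition initial_amplitude :: "(real^'n \<Rightarrow> complex) \<Rightarrow> real^'n \<Rightarrow> complex" where
  "initial_amplitude \<phi> \<xi> = of_real (1 / (2 * pi) ^ CARD('n)) * fourier \<phi> \<xi>"

lemma schwartz_initial_amplitude: "schwartz \<phi> \<Longrightarrow> schwartz (initial_amplitude \<phi>)"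
  unfolding initial_amplitude_def[abs_def] by (intro schwartz_cmult schwartz_fourier)

lemma schwartz_bounded: assumes "schwartz g" obtains K where "\<And>x. norm (g x) \<le> K"
proof -
  obtain C where "\<And>x. norm (g x) \<le> C" using schwartz_decay[OF assms, of 0] by auto
  then show ?thesis by (rule that)
qed

text \<open>For \<open>t = 0\<close> this is Fourier inversion, for \<open>t > 0\<close> the evaluation of the chirp integral at \<open>z = e\<^bsup>tB\<^esup>x\<close>.\<close>
theorem sol_eq_evol:
  fixes Q B :: "real^'n^'n"
  assumes Q: "transpose Q = Q" and pos: "\<And>t. t > 0 \<Longrightarrow> pos_definite (Qt Q B t)"
    and \<phi>: "schwartz \<phi>" and t: "t \<ge> 0"
  shows "sol Q B \<phi> x t = evol Q B (initial_amplitude \<phi>) x t"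
proof (cases "t = 0")
  case True
  obtain K where K: "\<And>x. norm (\<phi> x) \<le> K" using schwartz_bounded[OF \<phi>] by blast
  have "evol Q B (initial_amplitude \<phi>) x 0 = of_real (1 / (2 * pi) ^ CARD('n)) * (\<integral>\<xi>. exp (\<i> * of_real (x \<bullet> \<xi>)) * fourier \<phi> \<xi> \<partial>lborel)"
    unfolding evol_def initial_amplitude_def[abs_def] osc_cmult
    by (simp add: osc_def phase_def mexp_0 Qt_0)
  also have "(\<integral>\<xi>. exp (\<i> * of_real (x \<bullet> \<xi>)) * fourier \<phi> \<xi> \<partial>lborel) = of_real ((2 * pi) ^ CARD('n)) * \<phi> x"
    using K by (intro fourier_inversion schwartz_integrable schwartz_continuous schwartz_fourier \<phi>)
  finally show ?thesis using True by (simp add: sol_def)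
next
  case False
  then have t: "t > 0" using t by simp
  let ?E = "mexp (t *\<^sub>R B)" and ?P = "Qt Q B t"
  have "evol Q B (initial_amplitude \<phi>) x t = of_real (1 / (2 * pi) ^ CARD('n)) * (\<integral>\<xi>. exp (\<i> * of_real ((?E *v x) \<bullet> \<xi> - (?P *v \<xi>) \<bullet> \<xi>)) * fourier \<phi> \<xi> \<partial>lborel)"
    unfolding evol_def initial_amplitude_def[abs_def] osc_cmult unfolding osc_def phase_def ..
  also note fourier_chirp_kernel[OF \<phi> Qt_symmetric[OF Q] pos[OF t]]
  also have "of_real (1 / (2 * pi) ^ CARD('n)) * (of_real (sqrt pi ^ CARD('n)) * (exp (- (\<i> * of_real (real CARD('n) * pi / 4))) / of_real (sqrt (det ?P)))
      * (\<integral>y. exp (\<i> * of_real (((matrix_inv ?P *v (y - ?E *v x)) \<bullet> (y - ?E *v x)) / 4)) * \<phi> y \<partial>lborel))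
     = (\<integral>y. kernel Q B (?E *v x) y t * \<phi> y \<partial>lborel)"
  proof -
    have "(4 * pi) powr (- (real CARD('n) / 2)) = (1 / (2 * sqrt pi)) ^ CARD('n)"
    proof -
      have "(4 * pi) powr (- (real CARD('n) / 2)) = ((4 * pi) powr (1/2)) powr (- real CARD('n))"
        by (simp add: powr_powr)
      also have "(4 * pi) powr (1/2) = 2 * sqrt pi"
        by (simp add: powr_half_sqrt real_sqrt_mult)
      also have "(2 * sqrt pi) powr (- real CARD('n)) = inverse ((2 * sqrt pi) ^ CARD('n))"
        unfolding powr_minus by (subst powr_realpow) auto
      also have "\<dots> = (1 / (2 * sqrt pi)) ^ CARD('n)"
        by (simp only: power_one_over inverse_eq_divide)
      finally show ?thesis .
    qed
    also have "1 / (2 * sqrt pi) = sqrt pi / (2 * pi)"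
    proof -
      have "1 / (2 * r) = r / (2 * (r * r))" if "r > 0" for r :: real using that by simp
      from this[of "sqrt pi"] show ?thesis by simp
    qed
    finally have c: "(4 * pi) powr (- (real CARD('n) / 2)) = 1 / (2 * pi) ^ CARD('n) * sqrt pi ^ CARD('n)"
      by (simp add: power_divide)
    show ?thesis unfolding kernel_def c
      by (simp only: mult.assoc integral_mult_right_zero of_real_mult)
  qed
  finally show ?thesis using t by (simp add: sol_def)
qed

lemma integrable_matvec:
  fixes A :: "real^'n^'n" and f :: "real^'n \<Rightarrow> complex"
  assumes A: "det A \<noteq> 0" and f: "integrable lborel f"
  shows "integrable lborel (\<lambda>x. f (A *v x))"
proof (rule integrableI_bounded)
  have [measurable]: "f \<in> borel_measurable borel" using borel_measurable_integrable[OF f] by simp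
  show "(\<lambda>x. f (A *v x)) \<in> borel_measurable lborel" by measurable
  have m: "(\<lambda>x. ennreal (norm (f x))) \<in> borel_measurable borel" by measurable
  show "(\<integral>\<^sup>+x. ennreal (norm (f (A *v x))) \<partial>lborel) < \<infinity>"
    using nn_integral_matrix_change[OF A m] f
    by (simp add: integrable_iff_bounded ennreal_mult_less_top)
qed

text \<open>Reversibility. To reach \<open>w\<close> at time \<open>t\<close>, undo the three ingredients of the evolution: compose with
\<open>e\<^bsup>-tB\<^esup>\<close>, take the Fourier transform, and multiply by the conjugate chirp \<open>e\<^bsup>i\<langle>Q(t)\<eta>,\<eta>\<rangle>\<^esup>\<close>.\<close>
theorem evol_surjective:
  fixes Q B :: "real^'n^'n"
  assumes Q: "transpose Q = Q" and w: "schwartz w"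
  shows "\<exists>h. schwartz h \<and> (\<forall>x. evol Q B h x t = w x)"
proof -
  let ?E = "mexp (t *\<^sub>R B)" and ?E' = "mexp (t *\<^sub>R (- B))" and ?P = "Qt Q B t"
  have E'E: "?E' *v (?E *v x) = x" for x
    by (simp only: matrix_vector_mul_assoc mexp_inverse matrix_vector_mul_lid)
  have dE: "det ?E \<noteq> 0" "det ?E' \<noteq> 0"
    using invertible_mexp[of t B] invertible_mexp[of t "- B"] unfolding invertible_det_nz by blast+
  \<comment> \<open>the target in the coordinates \<open>y = e\<^bsup>tB\<^esup>x\<close>, in which the evolution is a plain Fourier integral\<close>
  let ?v = "\<lambda>y. w (?E' *v y)"
  have cw: "continuous_on UNIV w" by (rule schwartz_continuous[OF w])
  have cv: "continuous_on UNIV ?v"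
    by (intro continuous_on_compose2[OF cw] continuous_intros) auto
  have Fv: "fourier ?v = (\<lambda>\<eta>. of_real \<bar>det ?E\<bar> * fourier w (transpose ?E *v \<eta>))"
  proof
    fix \<eta>
    let ?g = "\<lambda>y. exp (- (\<i> * of_real (y \<bullet> \<eta>))) * ?v y"
    have "?g \<in> borel_measurable borel"
      by (intro borel_measurable_continuous_onI continuous_intros cv)
    from integral_matrix_change[OF dE(1) this]
    have "(\<integral>x. ?g (?E *v x) \<partial>lborel) = (1 / \<bar>det ?E\<bar>) *\<^sub>R fourier ?v \<eta>"
      unfolding fourier_def .
    also have "(\<integral>x. ?g (?E *v x) \<partial>lborel) = fourier w (transpose ?E *v \<eta>)"
      unfolding fourier_def E'E inner_transpose[of ?E] ..
    finally show "fourier ?v \<eta> = of_real \<bar>det ?E\<bar> * fourier w (transpose ?E *v \<eta>)"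
      using dE(1) by (simp add: scaleR_conv_of_real field_simps)
  qed
  have sFv: "schwartz (fourier ?v)"
    unfolding Fv by (intro schwartz_cmult schwartz_fourier_matvec w) (rule transpose_invertible[OF invertible_mexp])
  obtain K where K: "\<And>x. norm (w x) \<le> K" using schwartz_bounded[OF w] by blast
  have inv: "(\<integral>\<xi>. exp (\<i> * of_real (x \<bullet> \<xi>)) * fourier ?v \<xi> \<partial>lborel) = of_real ((2 * pi) ^ CARD('n)) * ?v x" for x
    by (rule fourier_inversion[OF integrable_matvec[OF dE(2) schwartz_integrable[OF w]] cv K schwartz_integrable[OF sFv]])
  define h where "h \<eta> = exp (\<i> * of_real ((?P *v \<eta>) \<bullet> \<eta>)) * (of_real (1 / (2 * pi) ^ CARD('n)) * fourier ?v \<eta>)" for \<eta>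
  have "schwartz h"
    unfolding h_def[abs_def] by (intro schwartz_chirp Qt_symmetric Q schwartz_cmult sFv) simp
  moreover have "evol Q B h x t = w x" for x
  proof -
    have "phase ?E ?P x \<eta> * h \<eta> = of_real (1 / (2 * pi) ^ CARD('n)) * (exp (\<i> * of_real ((?E *v x) \<bullet> \<eta>)) * fourier ?v \<eta>)" for \<eta>
    proof -
      have e: "phase ?E ?P x \<eta> * exp (\<i> * of_real ((?P *v \<eta>) \<bullet> \<eta>)) = exp (\<i> * of_real ((?E *v x) \<bullet> \<eta>))"
        unfolding phase_def exp_add[symmetric] by (simp add: right_diff_distrib)
      have "phase ?E ?P x \<eta> * h \<eta> = (phase ?E ?P x \<eta> * exp (\<i> * of_real ((?P *v \<eta>) \<bullet> \<eta>))) * (of_real (1 / (2 * pi) ^ CARD('n)) * fourier ?v \<eta>)"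
        unfolding h_def by (simp only: mult.assoc)
      then show ?thesis unfolding e by (simp only: mult.left_commute)
    qed
    then have "evol Q B h x t = of_real (1 / (2 * pi) ^ CARD('n)) * (\<integral>\<eta>. exp (\<i> * of_real ((?E *v x) \<bullet> \<eta>)) * fourier ?v \<eta> \<partial>lborel)"
      unfolding evol_def osc_def by simp
    then show ?thesis unfolding inv E'E by simp
  qed
  ultimately show ?thesis by blast
qed

lemma norm_matvec_le: "norm (A *v y) \<le> (\<Sum>i\<in>UNIV. \<Sum>j\<in>UNIV. \<bar>A $ i $ j\<bar>) * norm y"
  for A :: "real^'n^'n"
proof -
  have "norm (A *v y) \<le> (\<Sum>i\<in>UNIV. \<bar>(A *v y) $ i\<bar>)" by (rule norm_le_l1_cart)
  also have "\<dots> \<le> (\<Sum>i\<in>UNIV. \<Sum>j\<in>UNIV. \<bar>A $ i $ j\<bar> * norm y)"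
    unfolding matrix_vector_mult_def
    by (auto intro!: sum_mono order_trans[OF sum_abs] mult_left_mono component_le_norm_cart simp: abs_mult)
  finally show ?thesis by (simp add: sum_distrib_right)
qed

lemma evol_decay:
  fixes Q B :: "real^'n^'n"
  assumes Q: "transpose Q = Q" and h: "schwartz h"
  shows "\<exists>C. \<forall>t\<in>{0..T}. \<forall>x. norm x ^ k * norm (evol Q B h x t) \<le> C"
proof -
  have cQ: "continuous_on {0..T} (\<lambda>t. \<Sum>i\<in>UNIV. \<Sum>j\<in>UNIV. \<bar>Qt Q B t $ i $ j\<bar>)"
    by (intro continuous_intros continuous_on_subset[OF Qt_continuous]) auto
  have cE: "continuous_on {0..T} (\<lambda>t. \<Sum>i\<in>UNIV. \<Sum>j\<in>UNIV. \<bar>mexp (t *\<^sub>R (- B)) $ i $ j\<bar>)"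
    by (intro continuous_intros)
  obtain p where p: "\<And>t. t \<in> {0..T} \<Longrightarrow> \<bar>\<Sum>i\<in>UNIV. \<Sum>j\<in>UNIV. \<bar>Qt Q B t $ i $ j\<bar>\<bar> \<le> p"
    using compact_bound[OF cQ] by blast
  obtain K where K: "\<And>t. t \<in> {0..T} \<Longrightarrow> \<bar>\<Sum>i\<in>UNIV. \<Sum>j\<in>UNIV. \<bar>mexp (t *\<^sub>R (- B)) $ i $ j\<bar>\<bar> \<le> K"
    using compact_bound[OF cE] by blast
  have Qp: "\<bar>Qt Q B t $ i $ j\<bar> \<le> p" if "t \<in> {0..T}" for t i j
  proof -
    have "\<bar>Qt Q B t $ i $ j\<bar> \<le> (\<Sum>j\<in>UNIV. \<bar>Qt Q B t $ i $ j\<bar>)" by (rule member_le_sum) auto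
    also have "\<dots> \<le> (\<Sum>i\<in>UNIV. \<Sum>j\<in>UNIV. \<bar>Qt Q B t $ i $ j\<bar>)" by (rule member_le_sum) (auto intro: sum_nonneg)
    finally show ?thesis using p[OF that] by linarith
  qed
  obtain C where C: "\<And>(A::real^'n^'n) (P::real^'n^'n) x. transpose P = P \<Longrightarrow> (\<forall>i j. \<bar>P $ i $ j\<bar> \<le> p) \<Longrightarrow> norm (A *v x) ^ k * norm (osc A P h x) \<le> C"
    using osc_decay[OF h, of p k] by blast
  have "norm x ^ k * norm (evol Q B h x t) \<le> K ^ k * C" if t: "t \<in> {0..T}" for t x
  proof -
    have K0: "K \<ge> 0" using K[OF t] abs_ge_zero order_trans by blast
    have "norm x = norm (mexp (t *\<^sub>R (- B)) *v (mexp (t *\<^sub>R B) *v x))"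
      by (simp only: matrix_vector_mul_assoc mexp_inverse matrix_vector_mul_lid)
    also have "\<dots> \<le> K * norm (mexp (t *\<^sub>R B) *v x)"
      using K[OF t] by (intro order_trans[OF norm_matvec_le] mult_right_mono) auto
    finally have "norm x ^ k * norm (evol Q B h x t) \<le> (K * norm (mexp (t *\<^sub>R B) *v x)) ^ k * norm (evol Q B h x t)"
      by (intro mult_right_mono power_mono) auto
    also have "\<dots> = K ^ k * (norm (mexp (t *\<^sub>R B) *v x) ^ k * norm (evol Q B h x t))"
      by (simp add: power_mult_distrib mult.assoc)
    also have "\<dots> \<le> K ^ k * C"
      unfolding evol_def using K0 Qp[OF t] by (intro mult_left_mono C Qt_symmetric Q) auto
    finally show ?thesis .
  qed
  then show ?thesis by blast
qed

section \<open>Linearity of the Cauchy problem\<close>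

lemma classical_solution_cong:
  fixes Q B :: "real^'n^'n"
  assumes f: "classical_solution Q B \<phi> f" and eq: "\<And>x t. t \<ge> 0 \<Longrightarrow> g x t = f x t"
  shows "classical_solution Q B \<phi> g"
proof -
  have hv: "(g x has_vector_derivative D) (at t) \<longleftrightarrow> (f x has_vector_derivative D) (at t)" if "t > 0" for x t D
    using that eq
    by (auto elim!: has_vector_derivative_transform_within_open[where S="{0<..}"])
  have vd: "vector_derivative (g x) (at t) = vector_derivative (f x) (at t)" if "t > 0" for x t
    by (simp add: vector_derivative_def hv[OF that])
  have df: "g x differentiable at t \<longleftrightarrow> f x differentiable at t" if "t > 0" for x t
    using hv[OF that] by (metis differentiableI_vector vector_derivative_works)
  have sl: "(\<lambda>y. g y t) = (\<lambda>y. f y t)" if "t > 0" for t using eq that by auto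
  show ?thesis
    unfolding classical_solution_def
  proof (intro conjI allI impI)
    show "continuous_on (UNIV \<times> {0..}) (\<lambda>(x, t). g x t)"
      by (rule continuous_on_eq[of _ "\<lambda>(x, t). f x t"]) (use f eq in \<open>auto simp: classical_solution_def\<close>)
    show "continuous_on (UNIV \<times> {0<..}) (\<lambda>(x, t). vector_derivative (g x) (at t))"
      by (rule continuous_on_eq[of _ "\<lambda>(x, t). vector_derivative (f x) (at t)"]) (use f vd in \<open>auto simp: classical_solution_def\<close>)
    show "continuous_on (UNIV \<times> {0<..}) (\<lambda>(x, t). grad (\<lambda>y. g y t) x)"
      by (rule continuous_on_eq[of _ "\<lambda>(x, t). grad (\<lambda>y. f y t) x"]) (use f sl in \<open>auto simp: classical_solution_def\<close>)
    show "continuous_on (UNIV \<times> {0<..}) (\<lambda>(x, t). hess (\<lambda>y. g y t) x)"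
      by (rule continuous_on_eq[of _ "\<lambda>(x, t). hess (\<lambda>y. f y t) x"]) (use f sl in \<open>auto simp: classical_solution_def\<close>)
  qed (use f vd df sl eq in \<open>auto simp: classical_solution_def\<close>)
qed

lemma classical_solution_diff:
  fixes Q B :: "real^'n^'n"
  assumes f: "classical_solution Q B \<phi> f" and g: "classical_solution Q B \<phi> g"
  shows "classical_solution Q B (\<lambda>x. 0) (\<lambda>x t. f x t - g x t)"
proof -
  let ?w = "\<lambda>x t. f x t - g x t"
  have vd: "(?w x has_vector_derivative vector_derivative (f x) (at t) - vector_derivative (g x) (at t)) (at t)" if "t > 0" for x t
    using f g that unfolding classical_solution_def
    by (intro has_vector_derivative_diff) (auto simp: vector_derivative_works)
  have pd: "has_pd i (\<lambda>y. ?w y t) (pdiff i (\<lambda>y. f y t) x - pdiff i (\<lambda>y. g y t) x) x" if "t > 0" for i x t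
    using f g that unfolding classical_solution_def by (intro has_pd_diff) (auto simp: has_pd_iff)
  have pdeq: "pdiff i (\<lambda>y. ?w y t) = (\<lambda>x. pdiff i (\<lambda>y. f y t) x - pdiff i (\<lambda>y. g y t) x)" if "t > 0" for i t
    using pd[OF that] by (auto simp: has_pd_iff)
  have pd2: "has_pd i (pdiff j (\<lambda>y. ?w y t)) (pdiff i (pdiff j (\<lambda>y. f y t)) x - pdiff i (pdiff j (\<lambda>y. g y t)) x) x" if "t > 0" for i j x t
    unfolding pdeq[OF that] using f g that unfolding classical_solution_def by (intro has_pd_diff) (auto simp: has_pd_iff)
  have gr: "grad (\<lambda>y. ?w y t) x = grad (\<lambda>y. f y t) x - grad (\<lambda>y. g y t) x" if "t > 0" for x t
    by (simp add: grad_def vec_eq_iff pdeq[OF that])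
  have he: "hess (\<lambda>y. ?w y t) x = hess (\<lambda>y. f y t) x - hess (\<lambda>y. g y t) x" if "t > 0" for x t
    using pd2[OF that] by (simp add: hess_def vec_eq_iff has_pd_iff)
  show ?thesis
    unfolding classical_solution_def
  proof (intro conjI allI impI)
    have "continuous_on (UNIV \<times> {0..}) (\<lambda>p. (case p of (x, t) \<Rightarrow> f x t) - (case p of (x, t) \<Rightarrow> g x t))"
      using f g unfolding classical_solution_def by (intro continuous_on_diff) blast+
    then show "continuous_on (UNIV \<times> {0..}) (\<lambda>(x, t). ?w x t)" by (simp add: case_prod_unfold)
    have "continuous_on (UNIV \<times> {0<..}) (\<lambda>p. (case p of (x, t) \<Rightarrow> vector_derivative (f x) (at t)) - (case p of (x, t) \<Rightarrow> vector_derivative (g x) (at t)))"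
      using f g unfolding classical_solution_def by (intro continuous_on_diff) blast+
    then show "continuous_on (UNIV \<times> {0<..}) (\<lambda>(x, t). vector_derivative (?w x) (at t))"
      by (rule continuous_on_eq) (auto simp: vector_derivative_at[OF vd])
    have "continuous_on (UNIV \<times> {0<..}) (\<lambda>p. (case p of (x, t) \<Rightarrow> grad (\<lambda>y. f y t) x) - (case p of (x, t) \<Rightarrow> grad (\<lambda>y. g y t) x))"
      using f g unfolding classical_solution_def by (intro continuous_on_diff) blast+
    then show "continuous_on (UNIV \<times> {0<..}) (\<lambda>(x, t). grad (\<lambda>y. ?w y t) x)"
      by (rule continuous_on_eq) (auto simp: gr)
    have "continuous_on (UNIV \<times> {0<..}) (\<lambda>p. (case p of (x, t) \<Rightarrow> hess (\<lambda>y. f y t) x) - (case p of (x, t) \<Rightarrow> hess (\<lambda>y. g y t) x))"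
      using f g unfolding classical_solution_def by (intro continuous_on_diff) blast+
    then show "continuous_on (UNIV \<times> {0<..}) (\<lambda>(x, t). hess (\<lambda>y. ?w y t) x)"
      by (rule continuous_on_eq) (auto simp: he)
    show "?w x differentiable at t" if "t > 0" for x t using vd[OF that] by (rule differentiableI_vector)
    show "has_pdiff i (\<lambda>y. ?w y t) x" if "t > 0" for i x t using pd[OF that] by (simp add: has_pd_iff)
    show "has_pdiff i (pdiff j (\<lambda>y. ?w y t)) x" if "t > 0" for i j x t using pd2[OF that] by (simp add: has_pd_iff)
    show "vector_derivative (?w x) (at t) - \<i> * trace (map_matrix of_real Q ** hess (\<lambda>y. ?w y t) x)
        - bilin (B *v x) (grad (\<lambda>y. ?w y t) x) = 0" if t: "t > 0" for x t
    proof -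
      have tr: "trace (M ** (X - Y)) = trace (M ** X) - trace (M ** Y)" for M X Y :: "complex^'n^'n"
        by (simp add: trace_def matrix_matrix_mult_def right_diff_distrib sum_subtractf)
      have bl: "bilin v (X - Y) = bilin v X - bilin v Y" for v :: "real^'n" and X Y
        by (simp add: bilin_def right_diff_distrib sum_subtractf)
      have "vector_derivative (f x) (at t) - \<i> * trace (map_matrix of_real Q ** hess (\<lambda>y. f y t) x) - bilin (B *v x) (grad (\<lambda>y. f y t) x) = 0"
        "vector_derivative (g x) (at t) - \<i> * trace (map_matrix of_real Q ** hess (\<lambda>y. g y t) x) - bilin (B *v x) (grad (\<lambda>y. g y t) x) = 0"
        using f g t unfolding classical_solution_def by blast+
      then show ?thesis
        unfolding vector_derivative_at[OF vd[OF t]] gr[OF t] he[OF t] tr bl by (simp add: algebra_simps)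
    qed
    show "?w x 0 = 0" for x using f g unfolding classical_solution_def by simp
  qed
qed

section \<open>Green's identity with a cutoff\<close>

lemma positive_part_power_deriv:
  "((\<lambda>s::real. max 0 s ^ Suc (Suc n)) has_real_derivative real (Suc (Suc n)) * max 0 s ^ Suc n) (at s)"
proof -
  consider "s > 0" | "s < 0" | "s = 0" by linarith
  then show ?thesis
  proof cases
    case 1
    have "((\<lambda>s::real. s ^ Suc (Suc n)) has_real_derivative real (Suc (Suc n)) * s ^ Suc n) (at s)"
      using DERIV_pow[of "Suc (Suc n)" s] by simp
    then have "((\<lambda>s::real. max 0 s ^ Suc (Suc n)) has_real_derivative real (Suc (Suc n)) * s ^ Suc n) (at s)"
      by (rule has_field_derivative_transform_within_open[where S="{0<..}"]) (use 1 in \<open>auto simp: max_def\<close>)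
    then show ?thesis using 1 by (simp add: max_def)
  next
    case 2
    have "((\<lambda>s::real. 0) has_real_derivative 0) (at s)" by simp
    then have "((\<lambda>s::real. max 0 s ^ Suc (Suc n)) has_real_derivative 0) (at s)"
      by (rule has_field_derivative_transform_within_open[where S="{..<0}"]) (use 2 in \<open>auto simp: max_def\<close>)
    then show ?thesis using 2 by (simp add: max_def)
  next
    case 3
    have "((\<lambda>y::real. \<bar>y\<bar> ^ Suc n) \<longlongrightarrow> \<bar>0\<bar> ^ Suc n) (at 0)" by (intro tendsto_intros)
    then have l: "((\<lambda>y::real. \<bar>y\<bar> ^ Suc n) \<longlongrightarrow> 0) (at 0)" by simp
    have "((\<lambda>y::real. (max 0 y ^ Suc (Suc n) - max 0 0 ^ Suc (Suc n)) / (y - 0)) \<longlongrightarrow> 0) (at 0)"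
    proof (rule Lim_null_comparison[OF _ l])
      have "norm ((max 0 y ^ Suc (Suc n) - max 0 0 ^ Suc (Suc n)) / (y - 0)) \<le> \<bar>y\<bar> ^ Suc n" for y :: real
      proof (cases "y > 0")
        case False
        then have "norm ((max 0 y ^ Suc (Suc n) - max 0 0 ^ Suc (Suc n)) / (y - 0)) = 0" by (simp add: max_def)
        then show ?thesis by (simp only: zero_le_power abs_ge_zero)
      qed (simp add: max_def)
      then show "\<forall>\<^sub>F y in at 0. norm ((max 0 y ^ Suc (Suc n) - max 0 0 ^ Suc (Suc n)) / (y - 0)) \<le> \<bar>y\<bar> ^ Suc n" for y :: real
        by (intro always_eventually) blast
    qed
    then show ?thesis unfolding 3 has_field_derivative_iff by simp
  qed
qed

definition bump :: "real \<Rightarrow> real^'n \<Rightarrow> real" where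
  "bump R x = max 0 (1 - (norm x)\<^sup>2 / R\<^sup>2)"

lemma bump_bounds: "0 \<le> bump R x" "bump R x \<le> 1"
  by (auto simp: bump_def)

lemma bump_outside: "norm x > R \<Longrightarrow> R > 0 \<Longrightarrow> bump R x = 0"
proof -
  assume "norm x > R" "R > 0"
  then have "R\<^sup>2 \<le> (norm x)\<^sup>2" by (intro power_mono) auto
  then show ?thesis using \<open>R > 0\<close> by (simp add: bump_def field_simps)
qed

lemma continuous_on_bump [continuous_intros]: "continuous_on S (bump R)"
  unfolding bump_def divide_inverse by (intro continuous_intros continuous_on_max)

lemma has_pd_bump:
  "has_pd k (\<lambda>x. of_real (bump R x ^ Suc (Suc n))) (of_real (real (Suc (Suc n)) * bump R x ^ Suc n * (- 2 * x $ k / R\<^sup>2))) x"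
proof -
  let ?e = "axis k (1::real)"
  let ?q = "\<lambda>s. 1 - (norm (x + s *\<^sub>R ?e))\<^sup>2 / R\<^sup>2"
  have "(norm (x + s *\<^sub>R ?e))\<^sup>2 = (norm x)\<^sup>2 + 2 * s * x $ k + s\<^sup>2" for s
    unfolding power2_norm_eq_inner
    by (simp add: inner_add inner_axis inner_axis' inner_axis_axis power2_eq_square algebra_simps)
  then have "?q = (\<lambda>s. 1 - ((norm x)\<^sup>2 + 2 * s * x $ k + s\<^sup>2) / R\<^sup>2)" by (simp only:)
  moreover have "((\<lambda>s. 1 - ((norm x)\<^sup>2 + 2 * s * x $ k + s\<^sup>2) / R\<^sup>2) has_real_derivative - 2 * x $ k / R\<^sup>2) (at 0)"
    by (auto intro!: derivative_eq_intros simp: divide_inverse)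
  ultimately have q: "(?q has_real_derivative - 2 * x $ k / R\<^sup>2) (at 0)" by simp
  have "((\<lambda>s. max 0 (?q s) ^ Suc (Suc n)) has_real_derivative (real (Suc (Suc n)) * max 0 (?q 0) ^ Suc n) * (- 2 * x $ k / R\<^sup>2)) (at 0)"
    by (rule DERIV_chain2[OF positive_part_power_deriv q])
  then show ?thesis unfolding has_pd_def bump_def
    by (intro has_vector_derivative_of_real) simp
qed

text \<open>The third power of the truncated paraboloid is twice continuously differentiable, as two integrations by parts
require, and its derivatives are elementary.\<close>
definition cutoff :: "real \<Rightarrow> real^'n \<Rightarrow> complex" where
  "cutoff R x = of_real (bump R x ^ 3)"

definition cutoff_grad :: "real \<Rightarrow> 'n \<Rightarrow> real^'n \<Rightarrow> complex" where
  "cutoff_grad R k x = of_real (- (6 / R\<^sup>2)) * (of_real (x $ k) * of_real (bump R x ^ 2))"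

definition cutoff_hess :: "real \<Rightarrow> 'n \<Rightarrow> 'n \<Rightarrow> real^'n \<Rightarrow> complex" where
  "cutoff_hess R j k x = of_real (- (6 / R\<^sup>2)) * (of_real (x $ k) * of_real (2 * bump R x * (- 2 * x $ j / R\<^sup>2)) + (if j = k then 1 else 0) * of_real (bump R x ^ 2))"

lemma has_pd_cutoff: "has_pd k (cutoff R) (cutoff_grad R k x) x"
  using has_pd_bump[of k R 1 x] by (simp add: cutoff_def[abs_def] cutoff_grad_def numeral_3_eq_3 numeral_2_eq_2 mult_ac)

lemma has_pd_cutoff_grad: "has_pd j (cutoff_grad R k) (cutoff_hess R j k x) x"
  unfolding cutoff_grad_def[abs_def] cutoff_hess_def
  using has_pd_cmult[OF has_pd_mult[OF has_pd_coord[of j k x] has_pd_bump[of j R 0 x]], of "of_real (- (6 / R\<^sup>2))"]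
  by (simp add: numeral_2_eq_2)

lemma continuous_on_cutoffs [continuous_intros]:
  "continuous_on S (cutoff R)" "continuous_on S (cutoff_grad R k)" "continuous_on S (cutoff_hess R j k)"
  unfolding cutoff_def cutoff_grad_def cutoff_hess_def divide_inverse by (intro continuous_intros)+

lemma cutoffs_outside:
  assumes "norm x > R" "R > 0"
  shows "cutoff R x = 0" "cutoff_grad R k x = 0" "cutoff_hess R j k x = 0"
  using bump_outside[OF assms] by (simp_all add: cutoff_def cutoff_grad_def cutoff_hess_def)

lemma norm_cutoff_le: "norm (cutoff R x) \<le> 1"
  using bump_bounds[of R x] by (simp add: cutoff_def norm_power power_le_one)

lemma norm_cutoff_grad_le: "norm (cutoff_grad R k x) \<le> 6 / R\<^sup>2 * norm x"
proof -
  have "\<bar>x $ k\<bar> * bump R x ^ 2 \<le> norm x * 1"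
    using bump_bounds[of R x] by (intro mult_mono component_le_norm_cart power_le_one) auto
  then have "6 / R\<^sup>2 * (\<bar>x $ k\<bar> * bump R x ^ 2) \<le> 6 / R\<^sup>2 * norm x"
    by (intro mult_left_mono) auto
  then show ?thesis unfolding cutoff_grad_def norm_mult norm_of_real by (simp add: abs_mult)
qed

lemma norm_cutoff_hess_le:
  assumes "R \<ge> 1"
  shows "norm (cutoff_hess R j k x) \<le> 30 / R\<^sup>2 * (1 + (norm x)\<^sup>2)"
proof -
  have b: "bump R x \<le> 1" "0 \<le> bump R x" by (rule bump_bounds)+
  have R2: "1 / R\<^sup>2 \<le> 1" using assms by (simp add: divide_le_eq_1 one_le_power)
  have "\<bar>x $ k\<bar> * (2 * bump R x * (2 * \<bar>x $ j\<bar> * (1 / R\<^sup>2))) \<le> norm x * (2 * 1 * (2 * norm x * 1))"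
    using b R2 by (intro mult_mono component_le_norm_cart) auto
  also have "\<dots> = 4 * (norm x)\<^sup>2" by (simp add: power2_eq_square)
  finally have 1: "norm (complex_of_real (x $ k) * of_real (2 * bump R x * (- 2 * x $ j / R\<^sup>2))) \<le> 4 * (norm x)\<^sup>2"
    using b by (simp only: norm_mult norm_of_real) (simp add: abs_mult)
  have 2: "norm ((if j = k then 1 else 0) * complex_of_real (bump R x ^ 2)) \<le> 1"
    using b by (simp add: norm_mult norm_power power_le_one)
  have "norm (complex_of_real (x $ k) * of_real (2 * bump R x * (- 2 * x $ j / R\<^sup>2)) + (if j = k then 1 else 0) * of_real (bump R x ^ 2)) \<le> 4 * (norm x)\<^sup>2 + 1"
    by (rule order_trans[OF norm_triangle_ineq add_mono[OF 1 2]])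
  also have "\<dots> \<le> 5 * (1 + (norm x)\<^sup>2)" by simp
  finally have "6 / R\<^sup>2 * norm (complex_of_real (x $ k) * of_real (2 * bump R x * (- 2 * x $ j / R\<^sup>2)) + (if j = k then 1 else 0) * of_real (bump R x ^ 2)) \<le> 6 / R\<^sup>2 * (5 * (1 + (norm x)\<^sup>2))"
    by (intro mult_left_mono) auto
  then show ?thesis unfolding cutoff_hess_def norm_mult[of "of_real (- (6 / R\<^sup>2))"] norm_of_real by simp
qed

text \<open>The pointwise algebra behind \<open>cutoff_green\<close>, with \<open>w\<close>, \<open>f\<close>, \<open>c\<close> and their indexed versions standing for the values and
derivatives of two functions and of the cutoff at a point. Symmetry of \<open>Q\<close> cancels the products of first derivatives of \<open>w\<close> and \<open>f\<close>; in
the remaining term \<open>w\<close> appears undifferentiated.\<close>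
lemma flux_identity:
  fixes Q :: "real^'n^'n" and w f c :: complex and w1 f1 c1 b b' :: "'n \<Rightarrow> complex" and w2 f2 c2 :: "'n \<Rightarrow> 'n \<Rightarrow> complex"
  assumes "transpose Q = Q"
  shows "(\<Sum>j\<in>UNIV. c1 j * ((\<Sum>k\<in>UNIV. \<i> * of_real (Q $ j $ k) * (w1 k * f - w * f1 k)) + b j * (w * f))
       + c * ((\<Sum>k\<in>UNIV. \<i> * of_real (Q $ j $ k) * ((w1 k * f1 j + w2 j k * f) - (w * f2 j k + w1 j * f1 k))) + (b j * (w * f1 j + w1 j * f) + b' j * (w * f)))
       - (\<Sum>k\<in>UNIV. \<i> * of_real (Q $ j $ k) * (c1 k * (w * f1 j + w1 j * f) + c2 j k * (w * f))))
     + w * (- (\<Sum>j\<in>UNIV. b j * c1 j) * f + 2 * \<i> * (\<Sum>j\<in>UNIV. \<Sum>k\<in>UNIV. of_real (Q $ j $ k) * c1 j * f1 k) + \<i> * (\<Sum>j\<in>UNIV. \<Sum>k\<in>UNIV. of_real (Q $ j $ k) * c2 j k) * f)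
     = c * ((\<Sum>j\<in>UNIV. b' j) * w * f + (\<i> * (\<Sum>j\<in>UNIV. \<Sum>k\<in>UNIV. of_real (Q $ j $ k) * w2 j k) + (\<Sum>j\<in>UNIV. b j * w1 j)) * f
          + w * (- \<i> * (\<Sum>j\<in>UNIV. \<Sum>k\<in>UNIV. of_real (Q $ j $ k) * f2 j k) + (\<Sum>j\<in>UNIV. b j * f1 j)))"
proof -
  define S where "S u v = (\<Sum>j\<in>UNIV. \<Sum>k\<in>UNIV. of_real (Q $ j $ k) * u j * v k)" for u v :: "'n \<Rightarrow> complex"
  define T where "T u = (\<Sum>j\<in>UNIV. \<Sum>k\<in>UNIV. of_real (Q $ j $ k) * u j k)" for u :: "'n \<Rightarrow> 'n \<Rightarrow> complex"
  define L where "L u = (\<Sum>j\<in>UNIV. b j * u j)" for u :: "'n \<Rightarrow> complex"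
  have Qs: "Q $ j $ k = Q $ k $ j" for j k using assms by (metis transpose_def vec_lambda_beta)
  have S_sym: "S u v = S v u" for u v
    unfolding S_def by (subst sum.swap) (simp add: Qs mult_ac)
  have "(\<Sum>j\<in>UNIV. c1 j * ((\<Sum>k\<in>UNIV. \<i> * of_real (Q $ j $ k) * (w1 k * f - w * f1 k)) + b j * (w * f))
       + c * ((\<Sum>k\<in>UNIV. \<i> * of_real (Q $ j $ k) * ((w1 k * f1 j + w2 j k * f) - (w * f2 j k + w1 j * f1 k))) + (b j * (w * f1 j + w1 j * f) + b' j * (w * f)))
       - (\<Sum>k\<in>UNIV. \<i> * of_real (Q $ j $ k) * (c1 k * (w * f1 j + w1 j * f) + c2 j k * (w * f))))
     = \<i> * f * S c1 w1 - \<i> * w * S c1 f1 + w * f * L c1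
       + c * (\<i> * S f1 w1 + \<i> * f * T w2 - \<i> * w * T f2 - \<i> * S w1 f1 + w * L f1 + f * L w1 + w * f * (\<Sum>j\<in>UNIV. b' j))
       - \<i> * w * S f1 c1 - \<i> * f * S w1 c1 - \<i> * w * f * T c2"
    unfolding S_def T_def L_def
    by (simp add: sum.distrib sum_subtractf sum_distrib_left distrib_left distrib_right right_diff_distrib left_diff_distrib mult_ac)
  then show ?thesis
    unfolding S_def[symmetric] T_def[symmetric] L_def[symmetric] S_sym[of c1 w1] S_sym[of c1 f1] S_sym[of f1 w1]
    by (simp add: algebra_simps)
qed

lemma pdiff_cnj: assumes "schwartz f" shows "pdiff i (\<lambda>x. cnj (f x)) = (\<lambda>x. cnj (pdiff i f x))"
  using has_pd_cnj[OF schwartz_has_pd[OF assms]] by (auto simp: has_pd_iff)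

lemma schwartz_cnj: assumes "schwartz f" shows "schwartz (\<lambda>x. cnj (f x))"
proof (rule schwartz_coinduct[where X="\<lambda>u. \<exists>f. schwartz f \<and> u = (\<lambda>x. cnj (f x))"])
  fix u :: "real^'a \<Rightarrow> complex" assume "\<exists>f. schwartz f \<and> u = (\<lambda>x. cnj (f x))"
  then obtain f where f: "schwartz f" and u: "u = (\<lambda>x. cnj (f x))" by blast
  show "continuous_on UNIV u" unfolding u by (intro continuous_intros schwartz_continuous f)
  show "\<exists>g'. (\<exists>f. schwartz f \<and> g' = (\<lambda>x. cnj (f x))) \<and> (\<forall>x. has_pd i u (g' x) x)" for i
    unfolding u using has_pd_cnj[OF schwartz_has_pd[OF f]] schwartz_pdiff[OF f] by blast
  show "\<exists>C. \<forall>x. norm x ^ k * norm (u x) \<le> C" for k using schwartz_decay[OF f, of k] by (simp add: u)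
qed (use assms in blast)

lemma integrable_compact_support:
  fixes g :: "real^'n \<Rightarrow> complex"
  assumes "continuous_on UNIV g" and "\<And>x. norm x > R \<Longrightarrow> g x = 0"
  shows "integrable lborel g"
proof -
  have "integrable lborel (\<lambda>x. indicator (cball 0 R) x *\<^sub>R g x)"
    by (rule borel_integrable_compact) (use continuous_on_subset[OF assms(1)] in auto)
  moreover have "(\<lambda>x. indicator (cball 0 R) x *\<^sub>R g x) = g"
    using assms(2) by (force simp: indicator_def)
  ultimately show ?thesis by simp
qed

definition diffusion :: "real^'n^'n \<Rightarrow> (real^'n \<Rightarrow> complex) \<Rightarrow> real^'n \<Rightarrow> complex" where
  "diffusion Q u x = (\<Sum>j\<in>UNIV. \<Sum>k\<in>UNIV. of_real (Q $ j $ k) * pdiff j (pdiff k u) x)"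

definition drift :: "real^'n^'n \<Rightarrow> (real^'n \<Rightarrow> complex) \<Rightarrow> real^'n \<Rightarrow> complex" where
  "drift B u x = (\<Sum>j\<in>UNIV. of_real ((B *v x) $ j) * pdiff j u x)"

text \<open>The commutator of \<open>i tr(Q\<nabla>\<^sup>2) - \<langle>Bx,\<nabla>\<rangle>\<close> with multiplication by the cutoff, applied to \<open>v\<close>.\<close>
definition remainder :: "real^'n^'n \<Rightarrow> real^'n^'n \<Rightarrow> real \<Rightarrow> (real^'n \<Rightarrow> complex) \<Rightarrow> real^'n \<Rightarrow> complex" where
  "remainder Q B R v x = - (\<Sum>j\<in>UNIV. of_real ((B *v x) $ j) * cutoff_grad R j x) * v x
     + 2 * \<i> * (\<Sum>j\<in>UNIV. \<Sum>k\<in>UNIV. of_real (Q $ j $ k) * cutoff_grad R j x * pdiff k v x)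
     + \<i> * (\<Sum>j\<in>UNIV. \<Sum>k\<in>UNIV. of_real (Q $ j $ k) * cutoff_hess R j k x) * v x"

lemma trace_complex: "complex_of_real (trace B) = (\<Sum>j\<in>UNIV. of_real (B $ j $ j))"
  by (simp add: trace_def)

text \<open>If \<open>u\<close> solves the equation and \<open>v\<close> the conjugate one, the left integrand is the cutoff times
\<open>e\<^bsup>-t tr B\<^esup> \<partial>\<^sub>t(e\<^bsup>t tr B\<^esup> u v)\<close>. By \<open>flux_identity\<close> it is a divergence up to the remainder. The vector field \<open>U\<close> is chosen so
that the remainder involves no derivative of \<open>u\<close>; this is what allows an estimate by the
\<open>L\<^sup>2\<close> norm of \<open>u\<close> alone.\<close>
theorem cutoff_green:
  fixes Q B :: "real^'n^'n"
  assumes Q: "transpose Q = Q" and R: "R > 0" and u: "schwartz u" and v: "schwartz v"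
  shows "(\<integral>x. cutoff R x * (of_real (trace B) * u x * v x
        + (\<i> * diffusion Q u x + drift B u x) * v x + u x * (- \<i> * diffusion Q v x + drift B v x)) \<partial>lborel)
    = (\<integral>x. u x * remainder Q B R v x \<partial>lborel)"
proof -
  define U where "U j x = cutoff R x * ((\<Sum>k\<in>UNIV. \<i> * of_real (Q $ j $ k) * (pdiff k u x * v x - u x * pdiff k v x)) + of_real ((B *v x) $ j) * (u x * v x))
      - (\<Sum>k\<in>UNIV. \<i> * of_real (Q $ j $ k) * (cutoff_grad R k x * (u x * v x)))" for j x
  define D where "D j x = cutoff_grad R j x * ((\<Sum>k\<in>UNIV. \<i> * of_real (Q $ j $ k) * (pdiff k u x * v x - u x * pdiff k v x)) + of_real ((B *v x) $ j) * (u x * v x))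
       + cutoff R x * ((\<Sum>k\<in>UNIV. \<i> * of_real (Q $ j $ k) * ((pdiff k u x * pdiff j v x + pdiff j (pdiff k u) x * v x) - (u x * pdiff j (pdiff k v) x + pdiff j u x * pdiff k v x)))
            + (of_real ((B *v x) $ j) * (u x * pdiff j v x + pdiff j u x * v x) + of_real (B $ j $ j) * (u x * v x)))
       - (\<Sum>k\<in>UNIV. \<i> * of_real (Q $ j $ k) * (cutoff_grad R k x * (u x * pdiff j v x + pdiff j u x * v x) + cutoff_hess R j k x * (u x * v x)))" for j x
  note su = schwartz_continuous[OF u] schwartz_continuous[OF schwartz_pdiff[OF u]] schwartz_continuous[OF schwartz_pdiff[OF schwartz_pdiff[OF u]]]
  note sv = schwartz_continuous[OF v] schwartz_continuous[OF schwartz_pdiff[OF v]] schwartz_continuous[OF schwartz_pdiff[OF schwartz_pdiff[OF v]]]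
  have Bc: "has_pd j (\<lambda>x. of_real ((B *v x) $ j)) (of_real (B $ j $ j)) x" for j x
  proof -
    have "(\<lambda>x. complex_of_real ((B *v x) $ j)) = (\<lambda>x. of_real ((B $ j) \<bullet> x))"
      by (simp add: matrix_vector_mult_def inner_vec_def)
    then show ?thesis using has_pd_linear[of j "B $ j" x] by simp
  qed
  have pd: "has_pd j (U j) (D j x) x" for j x
  proof -
    note pu = schwartz_has_pd[OF u] and pv = schwartz_has_pd[OF v]
    note ppu = schwartz_has_pd[OF schwartz_pdiff[OF u]] and ppv = schwartz_has_pd[OF schwartz_pdiff[OF v]]
    have "has_pd j (U j) (cutoff R x * ((\<Sum>k\<in>UNIV. \<i> * of_real (Q $ j $ k) * ((pdiff k u x * pdiff j v x + pdiff j (pdiff k u) x * v x) - (u x * pdiff j (pdiff k v) x + pdiff j u x * pdiff k v x)))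
            + (of_real ((B *v x) $ j) * (u x * pdiff j v x + pdiff j u x * v x) + of_real (B $ j $ j) * (u x * v x)))
       + cutoff_grad R j x * ((\<Sum>k\<in>UNIV. \<i> * of_real (Q $ j $ k) * (pdiff k u x * v x - u x * pdiff k v x)) + of_real ((B *v x) $ j) * (u x * v x))
       - (\<Sum>k\<in>UNIV. \<i> * of_real (Q $ j $ k) * (cutoff_grad R k x * (u x * pdiff j v x + pdiff j u x * v x) + cutoff_hess R j k x * (u x * v x)))) x"
      unfolding U_def[abs_def]
      by (intro has_pd_diff has_pd_mult has_pd_add has_pd_sum has_pd_cmult pu pv ppu ppv Bc has_pd_cutoff has_pd_cutoff_grad)
    then show ?thesis unfolding D_def by (simp only: add.commute)
  qed
  have cU: "continuous_on UNIV (U j)" for j unfolding U_def[abs_def] by (intro continuous_intros su sv)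
  have cD: "continuous_on UNIV (D j)" for j unfolding D_def[abs_def] by (intro continuous_intros su sv)
  have iU: "integrable lborel (U j)" for j
    by (rule integrable_compact_support[OF cU, of R]) (simp add: U_def cutoffs_outside R)
  have iD: "integrable lborel (D j)" for j
    by (rule integrable_compact_support[OF cD, of R]) (simp add: D_def cutoffs_outside R)
  have zero: "(\<integral>x. D j x \<partial>lborel) = 0" for j
    by (rule integral_partial_derivative_zero[OF pd cD iU iD])
  have ir: "integrable lborel (\<lambda>x. u x * remainder Q B R v x)"
  proof (rule integrable_compact_support[of _ R])
    show "continuous_on UNIV (\<lambda>x. u x * remainder Q B R v x)"
      unfolding remainder_def by (intro continuous_intros su sv)
  qed (simp add: remainder_def cutoffs_outside R)
  have "(\<integral>x. cutoff R x * (of_real (trace B) * u x * v x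
        + (\<i> * diffusion Q u x + drift B u x) * v x + u x * (- \<i> * diffusion Q v x + drift B v x)) \<partial>lborel)
      = (\<integral>x. (\<Sum>j\<in>UNIV. D j x) + u x * remainder Q B R v x \<partial>lborel)"
    unfolding D_def remainder_def trace_complex diffusion_def drift_def
    by (rule Bochner_Integration.integral_cong[OF refl], rule flux_identity[OF Q, symmetric])
  also have "\<dots> = (\<Sum>j\<in>UNIV. \<integral>x. D j x \<partial>lborel) + (\<integral>x. u x * remainder Q B R v x \<partial>lborel)"
    using iD ir by (simp add: Bochner_Integration.integral_add Bochner_Integration.integral_sum)
  finally show ?thesis by (simp add: zero)
qed

text \<open>Every term carries a derivative of the cutoff. The gradient is \<open>O(|x|/R\<^sup>2)\<close>, which leaves room for the linear growth of
the drift, and the second derivatives are \<open>O((1 + |x|\<^sup>2)/R\<^sup>2)\<close>.\<close>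
lemma remainder_bound:
  fixes Q B :: "real^'n^'n"
  shows "\<exists>K\<ge>0. \<forall>R\<ge>1. \<forall>v x. norm (remainder Q B R v x) \<le> K / R * ((1 + (norm x)\<^sup>2) * (norm (v x) + (\<Sum>k\<in>UNIV. norm (pdiff k v x))))"
proof -
  define q where "q = (\<Sum>j\<in>UNIV. \<Sum>k\<in>UNIV. \<bar>Q $ j $ k\<bar>)"
  define \<beta> where "\<beta> = (\<Sum>i\<in>UNIV. \<Sum>j\<in>UNIV. \<bar>B $ i $ j\<bar>)"
  have q0: "q \<ge> 0" and \<beta>0: "\<beta> \<ge> 0" unfolding q_def \<beta>_def by (intro sum_nonneg; simp)+
  define K where "K = 6 * (real CARD('n) * \<beta>) + 12 * q + 30 * q"
  have "norm (remainder Q B R v x) \<le> K / R * ((1 + (norm x)\<^sup>2) * (norm (v x) + (\<Sum>k\<in>UNIV. norm (pdiff k v x))))" if R: "R \<ge> 1" for R v x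
  proof -
    let ?X = "1 + (norm x)\<^sup>2" and ?V = "norm (v x) + (\<Sum>k\<in>UNIV. norm (pdiff k v x))"
    have nx: "norm x \<le> ?X" using power_le_one_plus_sq[of 1 1 "norm x"] by simp
    have R2: "1 / R\<^sup>2 \<le> 1 / R" using R by (simp add: field_simps power2_eq_square)
    have X0: "?X \<ge> 0" by simp
    have vV: "norm (v x) \<le> ?V" by (simp add: sum_nonneg)
    have pV: "norm (pdiff k v x) \<le> ?V" for k
      using member_le_sum[of k UNIV "\<lambda>k. norm (pdiff k v x)"] by (simp add: add_increasing)
    have V0: "?V \<ge> 0" by (simp add: sum_nonneg)
    have c1: "norm (cutoff_grad R j x) \<le> 6 * (1 / R * ?X)" for j
    proof -
      have "norm (cutoff_grad R j x) \<le> 6 * (1 / R\<^sup>2 * norm x)" using norm_cutoff_grad_le[of R j x] by simp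
      also have "\<dots> \<le> 6 * (1 / R * ?X)" using R2 nx R by (intro mult_left_mono mult_mono) auto
      finally show ?thesis .
    qed
    have c2: "norm (cutoff_hess R j k x) \<le> 30 * (1 / R * ?X)" for j k
    proof -
      have "norm (cutoff_hess R j k x) \<le> 30 * (1 / R\<^sup>2 * ?X)" using norm_cutoff_hess_le[OF R, of j k x] by simp
      also have "\<dots> \<le> 30 * (1 / R * ?X)" using R2 by (intro mult_left_mono mult_right_mono) auto
      finally show ?thesis .
    qed
    have bc: "norm (of_real ((B *v x) $ j) * cutoff_grad R j x) \<le> 6 * \<beta> * (1 / R * ?X)" for j
    proof -
      have "\<bar>(B *v x) $ j\<bar> \<le> \<beta> * norm x"
        using component_le_norm_cart[of "B *v x" j] norm_matvec_le[of B x] unfolding \<beta>_def by linarith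
      then have "norm (of_real ((B *v x) $ j) * cutoff_grad R j x) \<le> (\<beta> * norm x) * (6 / R\<^sup>2 * norm x)"
        unfolding norm_mult norm_of_real using norm_cutoff_grad_le[of R j x] \<beta>0 by (intro mult_mono) auto
      also have "\<dots> = 6 * \<beta> * (1 / R\<^sup>2 * (norm x)\<^sup>2)" by (simp add: power2_eq_square)
      also have "\<dots> \<le> 6 * \<beta> * (1 / R * ?X)" using \<beta>0 R2 R by (intro mult_left_mono mult_mono) auto
      finally show ?thesis .
    qed
    have t1: "norm (- (\<Sum>j\<in>UNIV. of_real ((B *v x) $ j) * cutoff_grad R j x) * v x) \<le> (real CARD('n) * (6 * \<beta> * (1 / R * ?X))) * ?V"
    proof -
      have "norm (\<Sum>j\<in>UNIV. of_real ((B *v x) $ j) * cutoff_grad R j x) \<le> (\<Sum>j\<in>(UNIV::'n set). 6 * \<beta> * (1 / R * ?X))"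
        by (intro sum_norm_le bc)
      then show ?thesis
        unfolding norm_mult norm_minus_cancel using vV by (intro mult_mono) (auto simp: sum_nonneg intro!: mult_nonneg_nonneg \<beta>0 divide_nonneg_nonneg, use R in auto)
    qed
    have t2: "norm (2 * \<i> * (\<Sum>j\<in>UNIV. \<Sum>k\<in>UNIV. of_real (Q $ j $ k) * cutoff_grad R j x * pdiff k v x)) \<le> 2 * (q * (6 * (1 / R * ?X) * ?V))"
    proof -
      have "norm (\<Sum>j\<in>UNIV. \<Sum>k\<in>UNIV. of_real (Q $ j $ k) * cutoff_grad R j x * pdiff k v x) \<le> (\<Sum>j\<in>UNIV. \<Sum>k\<in>UNIV. \<bar>Q $ j $ k\<bar> * (6 * (1 / R * ?X) * ?V))"
      proof (intro sum_norm_le)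
        fix j k
        have "norm (cutoff_grad R j x) * norm (pdiff k v x) \<le> 6 * (1 / R * ?X) * ?V"
          using R by (intro mult_mono c1 pV) auto
        then show "norm (of_real (Q $ j $ k) * cutoff_grad R j x * pdiff k v x) \<le> \<bar>Q $ j $ k\<bar> * (6 * (1 / R * ?X) * ?V)"
          unfolding mult.assoc[of "of_real _"] norm_mult norm_of_real by (intro mult_left_mono) auto
      qed
      also have "\<dots> = q * (6 * (1 / R * ?X) * ?V)" unfolding q_def by (simp only: sum_distrib_right)
      finally have le: "norm (\<Sum>j\<in>UNIV. \<Sum>k\<in>UNIV. of_real (Q $ j $ k) * cutoff_grad R j x * pdiff k v x) \<le> q * (6 * (1 / R * ?X) * ?V)" .
      have "norm (2 * \<i> * z) = 2 * norm z" for z by (simp add: norm_mult)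
      then show ?thesis using mult_left_mono[OF le, of 2] by (simp only:)
    qed
    have t3: "norm (\<i> * (\<Sum>j\<in>UNIV. \<Sum>k\<in>UNIV. of_real (Q $ j $ k) * cutoff_hess R j k x) * v x) \<le> (q * (30 * (1 / R * ?X))) * ?V"
    proof -
      have "norm (\<Sum>j\<in>UNIV. \<Sum>k\<in>UNIV. of_real (Q $ j $ k) * cutoff_hess R j k x) \<le> (\<Sum>j\<in>UNIV. \<Sum>k\<in>UNIV. \<bar>Q $ j $ k\<bar> * (30 * (1 / R * ?X)))"
        by (intro sum_norm_le, unfold norm_mult norm_of_real, intro mult_left_mono c2) auto
      also have "\<dots> = q * (30 * (1 / R * ?X))" unfolding q_def by (simp only: sum_distrib_right)
      finally show ?thesis
        unfolding norm_mult norm_ii mult_1 using vV q0 R by (intro mult_mono) auto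
    qed
    have "norm (remainder Q B R v x) \<le> (real CARD('n) * (6 * \<beta> * (1 / R * ?X))) * ?V + 2 * (q * (6 * (1 / R * ?X) * ?V)) + (q * (30 * (1 / R * ?X))) * ?V"
      unfolding remainder_def by (intro order_trans[OF norm_triangle_ineq] add_mono t1 t2 t3)
    also have "\<dots> = K / R * (?X * ?V)"
    proof -
      have "(n * (6 * \<beta> * (r * X))) * V + 2 * (q * (6 * (r * X) * V)) + (q * (30 * (r * X))) * V
          = (6 * (n * \<beta>) + 12 * q + 30 * q) * r * (X * V)" for n r X V :: real
        by (simp add: algebra_simps)
      from this[of "real CARD('n)" "1 / R" ?X ?V] show ?thesis unfolding K_def by simp
    qed
    finally show ?thesis .
  qed
  moreover have "K \<ge> 0" unfolding K_def using q0 \<beta>0 by simp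
  ultimately show ?thesis by blast
qed

section \<open>Conservation of pairings\<close>

lemma weighted_decay:
  fixes g :: "'p \<Rightarrow> 'a::real_normed_vector \<Rightarrow> real"
  assumes "\<And>k. \<exists>C. \<forall>p\<in>S. \<forall>x. norm x ^ k * g p x \<le> C"
  shows "\<exists>C. \<forall>p\<in>S. \<forall>x. (1 + (norm x)\<^sup>2) ^ N * (norm x ^ k * g p x) \<le> C"
proof (induction N arbitrary: k)
  case 0 then show ?case using assms by simp
next
  case (Suc N)
  obtain C D where C: "\<And>p x. p \<in> S \<Longrightarrow> (1 + (norm x)\<^sup>2) ^ N * (norm x ^ k * g p x) \<le> C"
    and D: "\<And>p x. p \<in> S \<Longrightarrow> (1 + (norm x)\<^sup>2) ^ N * (norm x ^ (k + 2) * g p x) \<le> D"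
    using Suc[of k] Suc[of "k + 2"] by blast
  have "(1 + (norm x)\<^sup>2) ^ Suc N * (norm x ^ k * g p x) \<le> C + D" if "p \<in> S" for p x
  proof -
    have "(1 + (norm x)\<^sup>2) ^ Suc N * (norm x ^ k * g p x)
        = (1 + (norm x)\<^sup>2) ^ N * (norm x ^ k * g p x) + (1 + (norm x)\<^sup>2) ^ N * (norm x ^ (k + 2) * g p x)"
      by (simp add: algebra_simps power_add power2_eq_square)
    then show ?thesis using C[OF that, of x] D[OF that, of x] by simp
  qed
  then show ?case by blast
qed

lemma evol_weighted_decay:
  fixes Q B :: "real^'n^'n"
  assumes Q: "transpose Q = Q" and h: "schwartz h"
  shows "\<exists>C. \<forall>t\<in>{0..T}. \<forall>x. (1 + (norm x)\<^sup>2) ^ N *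
      (norm (evol Q B h x t) + (\<Sum>k\<in>UNIV. norm (pdiff k (\<lambda>y. evol Q B h y t) x))) \<le> C"
proof -
  have cE: "continuous_on {0..T} (\<lambda>t. mexp (t *\<^sub>R B) $ l $ k)" for l k by (intro continuous_intros)
  obtain K where K: "\<And>l k t. t \<in> {0..T} \<Longrightarrow> \<bar>mexp (t *\<^sub>R B) $ l $ k\<bar> \<le> K l k"
    using compact_bound[OF cE] by metis
  have "\<exists>C. \<forall>t\<in>{0..T}. \<forall>x. norm x ^ m * (norm (evol Q B h x t) + (\<Sum>k\<in>UNIV. norm (pdiff k (\<lambda>y. evol Q B h y t) x))) \<le> C" for m
  proof -
    obtain C where C: "\<And>t x. t \<in> {0..T} \<Longrightarrow> norm x ^ m * norm (evol Q B h x t) \<le> C"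
      using evol_decay[OF Q h, of T m B] by blast
    have "\<forall>l. \<exists>D. \<forall>t\<in>{0..T}. \<forall>x. norm x ^ m * norm (evol Q B (imul l h) x t) \<le> D"
      using evol_decay[OF Q schwartz_imul[OF h]] by blast
    then obtain D where D: "\<And>l t x. t \<in> {0..T} \<Longrightarrow> norm x ^ m * norm (evol Q B (imul l h) x t) \<le> D l" by metis
    have "norm x ^ m * (norm (evol Q B h x t) + (\<Sum>k\<in>UNIV. norm (pdiff k (\<lambda>y. evol Q B h y t) x))) \<le> C + (\<Sum>k\<in>UNIV. \<Sum>l\<in>UNIV. K l k * D l)"
      if t: "t \<in> {0..T}" for t x
    proof -
      have "norm x ^ m * norm (pdiff k (\<lambda>y. evol Q B h y t) x) \<le> (\<Sum>l\<in>UNIV. K l k * D l)" for k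
      proof -
        have K0: "0 \<le> K l k" for l using K[OF t, of l k] by linarith
        have "norm (pdiff k (\<lambda>y. evol Q B h y t) x) \<le> (\<Sum>l\<in>UNIV. K l k * norm (evol Q B (imul l h) x t))"
          unfolding evol_pdiff[OF h] using K[OF t]
          by (intro sum_norm_le) (auto simp: norm_mult intro!: mult_right_mono)
        then have "norm x ^ m * norm (pdiff k (\<lambda>y. evol Q B h y t) x) \<le> norm x ^ m * (\<Sum>l\<in>UNIV. K l k * norm (evol Q B (imul l h) x t))"
          by (intro mult_left_mono) auto
        also have "\<dots> = (\<Sum>l\<in>UNIV. K l k * (norm x ^ m * norm (evol Q B (imul l h) x t)))"
          by (simp add: sum_distrib_left mult.left_commute)
        also have "\<dots> \<le> (\<Sum>l\<in>UNIV. K l k * D l)" by (intro sum_mono mult_left_mono D t K0)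
        finally show ?thesis .
      qed
      then have "(\<Sum>k\<in>UNIV. norm x ^ m * norm (pdiff k (\<lambda>y. evol Q B h y t) x)) \<le> (\<Sum>k\<in>UNIV. \<Sum>l\<in>UNIV. K l k * D l)"
        by (intro sum_mono)
      then show ?thesis using C[OF t, of x] by (simp only: distrib_left sum_distrib_left add_mono)
    qed
    then show ?thesis by blast
  qed
  from weighted_decay[where k=0, OF this, of N] show ?thesis by simp
qed

lemma pde_expanded:
  fixes Q B :: "real^'n^'n"
  assumes cs: "classical_solution Q B \<psi> w" and Q: "transpose Q = Q" and t: "t > 0"
  shows "vector_derivative (w x) (at t) = \<i> * diffusion Q (\<lambda>y. w y t) x + drift B (\<lambda>y. w y t) x"
proof -
  have Qs: "Q $ j $ k = Q $ k $ j" for j k using Q by (metis transpose_def vec_lambda_beta)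
  have "trace (map_matrix of_real Q ** hess (\<lambda>y. w y t) x) = (\<Sum>k\<in>UNIV. \<Sum>j\<in>UNIV. of_real (Q $ k $ j) * pdiff j (pdiff k (\<lambda>y. w y t)) x)"
    by (simp add: trace_def matrix_matrix_mult_def map_matrix_def hess_def)
  also have "\<dots> = diffusion Q (\<lambda>y. w y t) x"
    unfolding diffusion_def by (subst sum.swap) (simp only: Qs)
  finally have tr: "trace (map_matrix of_real Q ** hess (\<lambda>y. w y t) x) = \<dots>" .
  have "bilin (B *v x) (grad (\<lambda>y. w y t) x) = drift B (\<lambda>y. w y t) x"
    by (simp add: bilin_def grad_def drift_def)
  moreover have "vector_derivative (w x) (at t) - \<i> * trace (map_matrix of_real Q ** hess (\<lambda>y. w y t) x) - bilin (B *v x) (grad (\<lambda>y. w y t) x) = 0"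
    using cs t unfolding classical_solution_def by blast
  ultimately show ?thesis unfolding tr by (simp add: algebra_simps)
qed

lemma schwartz_mult_integrable:
  assumes "schwartz u" "schwartz v" shows "integrable lborel (\<lambda>x. u x * v x)"
proof -
  obtain K where K: "\<And>x. norm (u x) \<le> K" using schwartz_bounded[OF assms(1)] by blast
  show ?thesis
  proof (rule Bochner_Integration.integrable_bound[of _ "\<lambda>x. K * norm (v x)"])
    show "integrable lborel (\<lambda>x. K * norm (v x))" by (intro integrable_mult_right integrable_norm schwartz_integrable assms)
    show "(\<lambda>x. u x * v x) \<in> borel_measurable lborel"
      using schwartz_integrable[OF assms(1)] schwartz_integrable[OF assms(2)] by measurable
    have "norm (u x * v x) \<le> K * norm (v x)" for x
      using K[of x] by (simp add: norm_mult mult_right_mono)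
    then show "AE x in lborel. norm (u x * v x) \<le> norm (K * norm (v x))"
      by (intro AE_I2) (metis abs_ge_self order_trans real_norm_def)
  qed
qed

lemma schwartz_square_integrable:
  assumes "schwartz u" shows "integrable lborel (\<lambda>x. (norm (u x))\<^sup>2)"
proof -
  have "integrable lborel (\<lambda>x. norm (u x * u x))" by (intro integrable_norm schwartz_mult_integrable assms)
  then show ?thesis by (simp add: norm_mult power2_eq_square)
qed

lemma cylinder_bound:
  fixes g :: "real^'n \<Rightarrow> real \<Rightarrow> complex"
  assumes "continuous_on T (\<lambda>p. g (fst p) (snd p))" and "cball 0 R \<times> {c..d} \<subseteq> T"
  obtains C where "\<And>x t. x \<in> cball 0 R \<Longrightarrow> t \<in> {c..d} \<Longrightarrow> norm (g x t) \<le> C"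
proof -
  have "compact ((cball 0 R :: (real^'n) set) \<times> {c..d})" by (intro compact_Times) auto
  then have "bounded ((\<lambda>p. g (fst p) (snd p)) ` (cball 0 R \<times> {c..d}))"
    by (intro compact_imp_bounded compact_continuous_image continuous_on_subset[OF assms])
  then obtain C where C: "\<And>p. p \<in> cball 0 R \<times> {c..d} \<Longrightarrow> norm (g (fst p) (snd p)) \<le> C"
    unfolding bounded_iff by blast
  show ?thesis
  proof (rule that)
    show "norm (g x t) \<le> C" if "x \<in> cball 0 R" "t \<in> {c..d}" for x t
      using C[of "(x, t)"] that by simp
  qed
qed

lemma integrable_cball_const: "integrable lborel (\<lambda>x::real^'n. C * indicator (cball 0 R) x :: real)"
  using emeasure_lborel_cball_finite[of "0::real^'n" R] by (intro integrable_mult_right integrable_real_indicator) auto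

lemma continuous_on_slice:
  assumes "continuous_on (UNIV \<times> T) (\<lambda>p. g (fst p) (snd p))" "S \<subseteq> T"
  shows "continuous_on S (\<lambda>t. g x t)"
proof -
  have c: "continuous_on S (\<lambda>t. (x, t))" by (intro continuous_intros)
  have "(\<lambda>t. (x, t)) ` S \<subseteq> UNIV \<times> T" using assms(2) by auto
  from continuous_on_compose2[OF assms(1) c this] show ?thesis by simp
qed

text \<open>The localised pairing \<open>F R\<close> is differentiable in time, with derivative \<open>O(1/R)\<close> uniformly on the interval: the
remainder is small and rapidly decreasing, and \<open>w\<close> is bounded in \<open>L\<^sup>2\<close>. Then let \<open>R \<rightarrow> \<infinity>\<close>.\<close>
theorem pairing_constant:
  fixes Q B :: "real^'n^'n"
  assumes Q: "transpose Q = Q" and cs: "classical_solution Q B \<psi> w"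
    and sw: "\<And>t. t \<ge> 0 \<Longrightarrow> schwartz (\<lambda>x. w x t)" and h: "schwartz h"
    and ab: "0 \<le> a" "a \<le> b"
    and M: "\<And>t. t \<in> {a..b} \<Longrightarrow> (\<integral>x. (norm (w x t))\<^sup>2 \<partial>lborel) \<le> M"
  shows "of_real (exp (a * trace B)) * (\<integral>x. w x a * cnj (evol Q B h x a) \<partial>lborel)
       = of_real (exp (b * trace B)) * (\<integral>x. w x b * cnj (evol Q B h x b) \<partial>lborel)"
proof (cases "a = b")
  case False
  then have a_less: "a < b" using ab by simp
  let ?f = "evol Q B h" and ?\<tau> = "trace B"
  let ?v = "\<lambda>t x. cnj (evol Q B h x t)"
  note cf = classical_solution_evol[OF h, of Q B]
  have sf: "schwartz (\<lambda>x. ?f x t)" for t by (rule schwartz_evol[OF Q h])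
  have sv: "schwartz (?v t)" for t by (rule schwartz_cnj[OF sf])
  define Wt where "Wt x t = vector_derivative (w x) (at t)" for x t
  define Ft where "Ft x t = vector_derivative (?f x) (at t)" for x t
  have cw: "continuous_on (UNIV \<times> {0..}) (\<lambda>p. w (fst p) (snd p))"
    and cWt: "continuous_on (UNIV \<times> {0<..}) (\<lambda>p. Wt (fst p) (snd p))"
    using cs unfolding classical_solution_def Wt_def case_prod_unfold by blast+
  have cff: "continuous_on (UNIV \<times> {0..}) (\<lambda>p. ?f (fst p) (snd p))"
    and cFt: "continuous_on (UNIV \<times> {0<..}) (\<lambda>p. Ft (fst p) (snd p))"
    using cf unfolding classical_solution_def Ft_def case_prod_unfold by blast+
  have dw: "(w x has_vector_derivative Wt x t) (at t)" if "t > 0" for x t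
    using cs that unfolding classical_solution_def Wt_def by (simp add: vector_derivative_works)
  have df: "(?f x has_vector_derivative Ft x t) (at t)" if "t > 0" for x t
    using cf that unfolding classical_solution_def Ft_def by (simp add: vector_derivative_works)
  define g where "g R x t = complex_of_real (exp (t * ?\<tau>)) * (cutoff R x * (w x t * ?v t x))" for R x t
  define g' where "g' R x t = complex_of_real (exp (t * ?\<tau>)) * (cutoff R x * (of_real ?\<tau> * w x t * ?v t x + Wt x t * ?v t x + w x t * cnj (Ft x t)))" for R x t
  define F where "F R t = (\<integral>x. g R x t \<partial>lborel)" for R t
  have dg: "((\<lambda>t. g R x t) has_vector_derivative g' R x t) (at t)" if "t > 0" for R x t
  proof -
    have "((\<lambda>t. exp (t * ?\<tau>)) has_real_derivative exp (t * ?\<tau>) * ?\<tau>) (at t)"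
      by (auto intro!: derivative_eq_intros)
    note e = has_vector_derivative_of_real[OF this]
    have "((\<lambda>t. complex_of_real (exp (t * ?\<tau>)) * (cutoff R x * (w x t * ?v t x))) has_vector_derivative
       complex_of_real (exp (t * ?\<tau>)) * (cutoff R x * (w x t * cnj (Ft x t) + Wt x t * ?v t x)) + of_real (exp (t * ?\<tau>) * ?\<tau>) * (cutoff R x * (w x t * ?v t x))) (at t)"
      by (intro has_vector_derivative_mult has_vector_derivative_mult_right has_vector_derivative_cnj e dw df that)
    then show ?thesis unfolding g_def g'_def
      by (rule has_vector_derivative_eq_rhs) (simp add: algebra_simps)
  qed
  have g0: "g R x t = 0" "g' R x t = 0" if "norm x > R" "R > 0" for R x t
    using cutoffs_outside[OF that] by (simp_all add: g_def g'_def)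
  have cg: "continuous_on (UNIV \<times> {0..}) (\<lambda>p. g R (fst p) (snd p))" for R
    unfolding g_def by (intro continuous_intros cw cff continuous_on_compose2[OF continuous_on_cutoffs(1)]) auto
  have cg': "continuous_on (UNIV \<times> {0<..}) (\<lambda>p. g' R (fst p) (snd p))" for R
    unfolding g'_def by (intro continuous_intros continuous_on_subset[OF cw] continuous_on_subset[OF cff] cWt cFt continuous_on_compose2[OF continuous_on_cutoffs(1)]) auto
  have int_g: "integrable lborel (\<lambda>x. g R x t)" if "t \<ge> 0" "R > 0" for R t
  proof (rule integrable_compact_support[of _ R])
    show "continuous_on UNIV (\<lambda>x. g R x t)"
      unfolding g_def by (intro continuous_intros schwartz_continuous sw sf that)
  qed (use g0 that in auto)
  have F_cont: "continuous_on {a..b} (F R)" if R: "R > 0" for R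
  proof -
    obtain C where C: "\<And>x t. x \<in> cball 0 R \<Longrightarrow> t \<in> {a..b} \<Longrightarrow> norm (g R x t) \<le> C"
      by (rule cylinder_bound[OF cg[of R], of R a b]) (use ab in auto)
    show ?thesis unfolding F_def
    proof (rule continuous_on_integral_param[where b="\<lambda>x. C * indicator (cball 0 R) x"])
      show "continuous_on {a..b} (\<lambda>t. g R x t)" for x
        by (rule continuous_on_slice[OF cg]) (use ab in auto)
      show "(\<lambda>x. g R x t) \<in> borel_measurable lborel" if "t \<in> {a..b}" for t
        using int_g[of t R] that ab R by (intro borel_measurable_integrable) auto
      show "norm (g R x t) \<le> C * indicator (cball 0 R) x" if "t \<in> {a..b}" for t x
        using C[OF _ that, of x] g0[of R x t] R by (cases "norm x \<le> R") (auto simp: indicator_def)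
    qed (rule integrable_cball_const)
  qed
  \<comment> \<open>the cutoff confines the integrand to a compact cylinder, where continuity
    provides the dominating constant; away from it no bound uniform in time is available\<close>
  have F_deriv: "(F R has_vector_derivative (\<integral>x. g' R x t \<partial>lborel)) (at t)" if t: "t > 0" and R: "R > 0" for R t
  proof -
    obtain C where C: "\<And>x s. x \<in> cball 0 R \<Longrightarrow> s \<in> {t/2..3*t/2} \<Longrightarrow> norm (g' R x s) \<le> C"
      by (rule cylinder_bound[OF cg'[of R], of R "t/2" "3*t/2"]) (use t in auto)
    show ?thesis unfolding F_def[abs_def]
    proof (rule integral_has_vector_derivative_param[where d="t/2" and b="\<lambda>x. C * indicator (cball 0 R) x"])
      fix s assume "\<bar>s - t\<bar> < t / 2"
      then have s: "s > 0" "s \<in> {t/2..3*t/2}" by (auto simp: abs_if split: if_splits)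
      show "integrable lborel (\<lambda>x. g R x s)" using s R by (intro int_g) auto
      show "((\<lambda>s. g R x s) has_vector_derivative g' R x s) (at s)" for x by (rule dg[OF s(1)])
      show "norm (g' R x s) \<le> C * indicator (cball 0 R) x" for x
        using C[OF _ s(2), of x] g0[of R x s] R by (cases "norm x \<le> R") (auto simp: indicator_def)
    next
      have c: "continuous_on UNIV (\<lambda>x::real^'n. (x, t))" by (intro continuous_intros)
      have "(\<lambda>x. (x, t)) ` UNIV \<subseteq> UNIV \<times> {0<..}" using t by auto
      from continuous_on_compose2[OF cg'[of R] c this] have "continuous_on UNIV (\<lambda>x. g' R x t)" by simp
      then show "(\<lambda>x. g' R x t) \<in> borel_measurable lborel" by (simp add: borel_measurable_continuous_onI)
    qed (use t integrable_cball_const in auto)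
  qed
  have green: "(\<integral>x. g' R x t \<partial>lborel) = of_real (exp (t * ?\<tau>)) * (\<integral>x. w x t * remainder Q B R (?v t) x \<partial>lborel)" if t: "t > 0" and R: "R > 0" for R t
  proof -
    have f: "cnj (Ft x t) = - \<i> * diffusion Q (?v t) x + drift B (?v t) x" for x
      unfolding Ft_def pde_expanded[OF cf Q t] diffusion_def drift_def pdiff_cnj[OF sf] pdiff_cnj[OF schwartz_pdiff[OF sf]]
      by simp
    have st: "schwartz (\<lambda>x. w x t)" using sw t by simp
    have "(\<integral>x. g' R x t \<partial>lborel) = of_real (exp (t * ?\<tau>)) * (\<integral>x. cutoff R x * (of_real ?\<tau> * w x t * ?v t x + Wt x t * ?v t x + w x t * cnj (Ft x t)) \<partial>lborel)"
      unfolding g'_def by (rule integral_mult_right_zero)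
    then show ?thesis
      unfolding f Wt_def pde_expanded[OF cs Q t] using cutoff_green[OF Q R st sv[of t], of B] by simp
  qed
  obtain K where K: "K \<ge> 0" "\<And>R v x. R \<ge> 1 \<Longrightarrow> norm (remainder Q B R v x) \<le> K / R * ((1 + (norm x)\<^sup>2) * (norm (v x) + (\<Sum>k\<in>UNIV. norm (pdiff k v x))))"
    using remainder_bound[of Q B] by blast
  obtain C where C: "\<And>t x. t \<in> {0..b} \<Longrightarrow> (1 + (norm x)\<^sup>2) ^ Suc (CARD('n)) * (norm (?f x t) + (\<Sum>k\<in>UNIV. norm (pdiff k (\<lambda>y. ?f y t) x))) \<le> C"
    using evol_weighted_decay[OF Q h, of b "Suc (CARD('n))" B] by blast
  \<comment> \<open>an integrable weight bounded by 1; the extra power in \<open>C\<close> pays for the factor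
    \<open>1 + |x|\<^sup>2\<close> of the remainder\<close>
  define \<omega> where "\<omega> x = 1 / (1 + (norm x)\<^sup>2) ^ CARD('n)" for x :: "real^'n"
  have X1: "1 \<le> (1 + (norm x)\<^sup>2) ^ CARD('n)" for x :: "real^'n" by (rule one_le_power) simp
  have \<omega>: "integrable lborel \<omega>" "0 \<le> \<omega> x" "\<omega> x \<le> 1" for x
  proof -
    show "integrable lborel \<omega>" unfolding \<omega>_def[abs_def] by (rule integrable_polynomial_weight)
    show "0 \<le> \<omega> x" "\<omega> x \<le> 1"
      using X1[of x] unfolding \<omega>_def by (auto intro!: divide_nonneg_nonneg simp: divide_le_eq)
  qed
  have C0: "C \<ge> 0"
  proof -
    have "0 \<le> (1 + (norm (0::real^'n))\<^sup>2) ^ Suc (CARD('n)) * (norm (?f 0 a) + (\<Sum>k\<in>UNIV. norm (pdiff k (\<lambda>y. ?f y a) 0)))"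
      by (intro mult_nonneg_nonneg add_nonneg_nonneg sum_nonneg) auto
    also have "\<dots> \<le> C" by (rule C) (use ab in auto)
    finally show ?thesis .
  qed
  define L where "L = exp (b * \<bar>?\<tau>\<bar>) * (K * C * (M + (\<integral>x. \<omega> x \<partial>lborel)))"
  have F'_bound: "norm (\<integral>x. g' R x t \<partial>lborel) \<le> L / R" if t: "t \<in> {a<..<b}" and R: "R \<ge> 1" for R t
  proof -
    have t0: "t > 0" and tT: "t \<in> {0..b}" and tab: "t \<in> {a..b}" using t ab by auto
    have st: "schwartz (\<lambda>x. w x t)" using sw t0 by simp
    have pt: "norm (w x t * remainder Q B R (?v t) x) \<le> K / R * C * ((norm (w x t))\<^sup>2 + \<omega> x)" for x
    proof -
      have pos: "(1 + (norm x)\<^sup>2) ^ CARD('n) > 0" by (intro zero_less_power add_pos_nonneg) auto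
      have "norm (remainder Q B R (?v t) x) \<le> K / R * ((1 + (norm x)\<^sup>2) * (norm (?f x t) + (\<Sum>k\<in>UNIV. norm (pdiff k (\<lambda>y. ?f y t) x))))"
        using K(2)[OF R, of "?v t" x] unfolding pdiff_cnj[OF sf] by simp
      also have "\<dots> \<le> K / R * (C * \<omega> x)"
      proof (intro mult_left_mono)
        show "(1 + (norm x)\<^sup>2) * (norm (?f x t) + (\<Sum>k\<in>UNIV. norm (pdiff k (\<lambda>y. ?f y t) x))) \<le> C * \<omega> x"
          using C[OF tT, of x] pos unfolding \<omega>_def by (simp add: field_simps)
      qed (use K R in auto)
      finally have "norm (w x t * remainder Q B R (?v t) x) \<le> norm (w x t) * (K / R * (C * \<omega> x))"
        unfolding norm_mult by (intro mult_left_mono) auto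
      also have "\<dots> = K / R * C * (norm (w x t) * \<omega> x)" by simp
      also have "\<dots> \<le> K / R * C * ((norm (w x t))\<^sup>2 + \<omega> x)"
      proof (intro mult_left_mono)
        \<comment> \<open>compare \<open>|w|\<close> with \<open>1\<close>, using that \<open>\<omega> \<le> 1\<close>\<close>
        show "norm (w x t) * \<omega> x \<le> (norm (w x t))\<^sup>2 + \<omega> x"
        proof (cases "norm (w x t) \<le> 1")
          case True
          then have "norm (w x t) * \<omega> x \<le> 1 * \<omega> x" using \<omega> by (intro mult_right_mono) auto
          then show ?thesis by (simp add: add_increasing)
        next
          case False
          then have "norm (w x t) * \<omega> x \<le> norm (w x t) * norm (w x t)" using \<omega>(3)[of x] by (intro mult_left_mono) auto
          then show ?thesis using \<omega>(2)[of x] by (simp add: power2_eq_square add_increasing2)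
        qed
      qed (use K R C0 in auto)
      finally show ?thesis .
    qed
    have i2: "integrable lborel (\<lambda>x. K / R * C * ((norm (w x t))\<^sup>2 + \<omega> x))"
      by (intro integrable_mult_right Bochner_Integration.integrable_add schwartz_square_integrable st \<omega>)
    have "norm (\<integral>x. w x t * remainder Q B R (?v t) x \<partial>lborel) \<le> (\<integral>x. norm (w x t * remainder Q B R (?v t) x) \<partial>lborel)"
      by (rule integral_norm_bound)
    also have "\<dots> \<le> (\<integral>x. K / R * C * ((norm (w x t))\<^sup>2 + \<omega> x) \<partial>lborel)"
      by (rule integral_mono_AE'[OF i2]) (intro AE_I2 pt order_trans[OF norm_ge_zero pt])+
    also have "\<dots> = K / R * C * ((\<integral>x. (norm (w x t))\<^sup>2 \<partial>lborel) + (\<integral>x. \<omega> x \<partial>lborel))"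
      using schwartz_square_integrable[OF st] \<omega>(1) by simp
    also have "\<dots> \<le> K / R * C * (M + (\<integral>x. \<omega> x \<partial>lborel))"
      using M[OF tab] K R C0 by (intro mult_left_mono) auto
    finally have 1: "norm (\<integral>x. w x t * remainder Q B R (?v t) x \<partial>lborel) \<le> K / R * C * (M + (\<integral>x. \<omega> x \<partial>lborel))" .
    have "t * ?\<tau> \<le> t * \<bar>?\<tau>\<bar>" using tT by (intro mult_left_mono) auto
    also have "\<dots> \<le> b * \<bar>?\<tau>\<bar>" using tT by (intro mult_right_mono) auto
    finally have "t * ?\<tau> \<le> b * \<bar>?\<tau>\<bar>" .
    then have "exp (t * ?\<tau>) \<le> exp (b * \<bar>?\<tau>\<bar>)" by simp
    from mult_mono[OF this 1]
    show ?thesis unfolding green[OF t0 less_le_trans[OF zero_less_one R]] norm_mult L_def by (simp add: norm_mult)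
  qed
  have F_diff: "norm (F R b - F R a) \<le> L / R * b - L / R * a" if R: "R \<ge> 1" for R
  proof (rule differentiable_bound_general[OF a_less, where f'="\<lambda>t. \<integral>x. g' R x t \<partial>lborel" and \<phi>="\<lambda>t. L / R * t" and \<phi>'="\<lambda>t. L / R"])
    show "continuous_on {a..b} (F R)" using F_cont R by simp
    show "continuous_on {a..b} (\<lambda>t. L / R * t)" by (intro continuous_intros)
    show "(F R has_vector_derivative (\<integral>x. g' R x t \<partial>lborel)) (at t)" if "a < t" "t < b" for t
      using F_deriv[of t R] that ab R by simp
    show "((\<lambda>t. L / R * t) has_vector_derivative L / R) (at t)" for t
      using has_vector_derivative_mult_right[OF has_vector_derivative_id, of "L / R" "at t"] by simp
    show "norm (\<integral>x. g' R x t \<partial>lborel) \<le> L / R" if "a < t" "t < b" for t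
      using F'_bound[of t R] that R by simp
  qed
  have F_lim: "(\<lambda>n. F (real (Suc n)) t) \<longlonglongrightarrow> of_real (exp (t * ?\<tau>)) * (\<integral>x. w x t * ?v t x \<partial>lborel)" if t: "t \<ge> 0" for t
  proof -
    have st: "schwartz (\<lambda>x. w x t)" using sw t by simp
    have i: "integrable lborel (\<lambda>x. w x t * ?v t x)" by (rule schwartz_mult_integrable[OF st sv])
    have "(\<lambda>n. \<integral>x. cutoff (real (Suc n)) x * (w x t * ?v t x) \<partial>lborel) \<longlonglongrightarrow> (\<integral>x. w x t * ?v t x \<partial>lborel)"
    proof (rule integral_dominated_convergence[where w="\<lambda>x. norm (w x t * ?v t x)"])
      show "(\<lambda>x. w x t * ?v t x) \<in> borel_measurable lborel" using i by (rule borel_measurable_integrable)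
      show "(\<lambda>x. cutoff (real (Suc n)) x * (w x t * ?v t x)) \<in> borel_measurable lborel" for n
        unfolding measurable_lborel2 by (intro borel_measurable_continuous_onI continuous_intros schwartz_continuous st sv)
      show "integrable lborel (\<lambda>x. norm (w x t * ?v t x))" using i by (rule integrable_norm)
      show "AE x in lborel. norm (cutoff (real (Suc n)) x * (w x t * ?v t x)) \<le> norm (w x t * ?v t x)" for n
        unfolding norm_mult[of "cutoff _ _"] by (intro AE_I2 mult_left_le_one_le norm_ge_zero norm_cutoff_le)
      show "AE x in lborel. (\<lambda>n. cutoff (real (Suc n)) x * (w x t * ?v t x)) \<longlonglongrightarrow> w x t * ?v t x"
      proof (rule AE_I2)
        fix x :: "real^'n"
        have "(\<lambda>n. max 0 (1 - (norm x * inverse (real (Suc n)))\<^sup>2)) \<longlonglongrightarrow> max 0 (1 - (norm x * 0)\<^sup>2)"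
          by (intro tendsto_intros LIMSEQ_inverse_real_of_nat)
        then have "(\<lambda>n. bump (real (Suc n)) x) \<longlonglongrightarrow> 1"
          unfolding bump_def by (simp add: power_mult_distrib power_inverse divide_inverse)
        then have "(\<lambda>n. complex_of_real (bump (real (Suc n)) x ^ 3) * (w x t * ?v t x)) \<longlonglongrightarrow> of_real (1 ^ 3) * (w x t * ?v t x)"
          by (intro tendsto_intros)
        then show "(\<lambda>n. cutoff (real (Suc n)) x * (w x t * ?v t x)) \<longlonglongrightarrow> w x t * ?v t x"
          by (simp add: cutoff_def)
      qed
    qed
    then have "(\<lambda>n. of_real (exp (t * ?\<tau>)) * (\<integral>x. cutoff (real (Suc n)) x * (w x t * ?v t x) \<partial>lborel)) \<longlonglongrightarrow> of_real (exp (t * ?\<tau>)) * (\<integral>x. w x t * ?v t x \<partial>lborel)"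
      by (intro tendsto_intros)
    then show ?thesis unfolding F_def g_def integral_mult_right_zero .
  qed
  have "(\<lambda>n. F (real (Suc n)) b - F (real (Suc n)) a) \<longlonglongrightarrow> 0"
  proof (rule Lim_null_comparison)
    show "\<forall>\<^sub>F n in sequentially. norm (F (real (Suc n)) b - F (real (Suc n)) a) \<le> L * (b - a) * inverse (real (Suc n))"
    proof (rule always_eventually, rule allI)
      fix n
      show "norm (F (real (Suc n)) b - F (real (Suc n)) a) \<le> L * (b - a) * inverse (real (Suc n))"
        using F_diff[of "real (Suc n)"] by (simp add: divide_inverse algebra_simps)
    qed
    have "(\<lambda>n. L * (b - a) * inverse (real (Suc n))) \<longlonglongrightarrow> L * (b - a) * 0"
      by (intro tendsto_intros LIMSEQ_inverse_real_of_nat)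
    then show "(\<lambda>n. L * (b - a) * inverse (real (Suc n))) \<longlonglongrightarrow> 0" by simp
  qed
  moreover have "(\<lambda>n. F (real (Suc n)) b - F (real (Suc n)) a) \<longlonglongrightarrow>
      of_real (exp (b * ?\<tau>)) * (\<integral>x. w x b * ?v b x \<partial>lborel) - of_real (exp (a * ?\<tau>)) * (\<integral>x. w x a * ?v a x \<partial>lborel)"
    using ab by (intro tendsto_diff F_lim) auto
  ultimately show ?thesis using LIMSEQ_unique by fastforce
qed simp

section \<open>A category argument\<close>

lemma locally_bounded_imp_bounded:
  fixes H :: "real \<Rightarrow> real"
  assumes ab: "a \<le> b" and loc: "\<And>t. t \<in> {a..b} \<Longrightarrow> \<exists>e>0. \<exists>M. \<forall>s\<in>{a..b}. \<bar>s - t\<bar> < e \<longrightarrow> H s \<le> M"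
  shows "\<exists>M. \<forall>t\<in>{a..b}. H t \<le> M"
proof -
  have "\<exists>M. \<forall>t\<in>{a..b}. a \<le> t \<and> t \<le> b \<longrightarrow> H t \<le> M"
  proof (induction rule: Bolzano[OF ab, where P="\<lambda>c d. \<exists>M. \<forall>t\<in>{c..d}. a \<le> t \<and> t \<le> b \<longrightarrow> H t \<le> M", case_names trans local])
    case (trans c d e)
    then obtain M N where "\<forall>t\<in>{c..d}. a \<le> t \<and> t \<le> b \<longrightarrow> H t \<le> M" "\<forall>t\<in>{d..e}. a \<le> t \<and> t \<le> b \<longrightarrow> H t \<le> N" by blast
    then show ?case by (intro exI[of _ "max M N"]) (auto simp: le_max_iff_disj)
  next
    case (local t)
    then obtain e M where e: "e > 0" and M: "\<forall>s\<in>{a..b}. \<bar>s - t\<bar> < e \<longrightarrow> H s \<le> M" using loc[of t] by auto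
    show ?case
    proof (rule exI[of _ e], intro conjI allI impI)
      fix c d assume "c \<le> t \<and> t \<le> d \<and> d - c < e"
      then show "\<exists>M. \<forall>t\<in>{c..d}. a \<le> t \<and> t \<le> b \<longrightarrow> H t \<le> M"
        using M by (intro exI[of _ M]) auto
    qed (rule e)
  qed
  then show ?thesis by auto
qed

text \<open>\<open>K\<close> is the closed set of times near which \<open>H\<close> is unbounded. If it is nonempty, the Baire category theorem
applied to the closed sublevel sets gives a point \<open>c\<close> of \<open>K\<close> and a neighbourhood such that \<open>H \<le> n\<close> on the part of \<open>K\<close> in it.
A time \<open>t\<close> in this neighbourhood but outside \<open>K\<close> is separated from \<open>c\<close> by a nearest point \<open>a\<close> of \<open>K\<close>. Between \<open>a\<close>
and \<open>t\<close> the function is constant, hence bounded on the closed interval, hence constant there including \<open>a\<close>; thus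
\<open>H t = H a \<le> n\<close>. So \<open>c\<close> is not in \<open>K\<close> after all.\<close>
theorem bounded_interval_constancy_extends:
  fixes H :: "real \<Rightarrow> real"
  assumes T: "T \<ge> 0"
    and clo: "\<And>M. closed {t\<in>{0..T}. H t \<le> M}"
    and const: "\<And>a b M. 0 \<le> a \<Longrightarrow> b \<le> T \<Longrightarrow> \<forall>t\<in>{a..b}. H t \<le> M \<Longrightarrow> \<forall>s\<in>{a..b}. \<forall>t\<in>{a..b}. H s = H t"
  shows "H T = H 0"
proof -
  define good where "good t \<longleftrightarrow> (\<exists>e>0. \<exists>M. \<forall>s\<in>{0..T}. \<bar>s - t\<bar> < e \<longrightarrow> H s \<le> M)" for t
  define K where "K = {t\<in>{0..T}. \<not> good t}"
  have good_const: "H s = H t" if "0 \<le> s" "s \<le> t" "t \<le> T" "{s..t} \<inter> K = {}" for s t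
  proof -
    have "\<exists>M. \<forall>r\<in>{s..t}. H r \<le> M"
    proof (rule locally_bounded_imp_bounded)
      fix r assume r: "r \<in> {s..t}"
      then have "good r" using that by (auto simp: K_def)
      then obtain e M where "e > 0" "\<forall>s\<in>{0..T}. \<bar>s - r\<bar> < e \<longrightarrow> H s \<le> M" unfolding good_def by blast
      then show "\<exists>e>0. \<exists>M. \<forall>r'\<in>{s..t}. \<bar>r' - r\<bar> < e \<longrightarrow> H r' \<le> M"
        using that by (intro exI[of _ e] conjI exI[of _ M]) auto
    qed (use that in auto)
    then obtain M where "\<forall>r\<in>{s..t}. H r \<le> M" by blast
    from const[OF _ _ this] show ?thesis using that by auto
  qed
  have K_closed: "closed K"
  proof -
    have "open {t. good t}"
      unfolding open_dist
    proof (intro ballI)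
      fix t assume "t \<in> {t. good t}"
      then obtain e M where e: "e > 0" and M: "\<forall>s\<in>{0..T}. \<bar>s - t\<bar> < e \<longrightarrow> H s \<le> M" unfolding good_def by blast
      show "\<exists>e>0. \<forall>y. dist y t < e \<longrightarrow> y \<in> {t. good t}"
      proof (intro exI[of _ "e/2"] conjI allI impI)
        fix y assume "dist y t < e / 2"
        then have "\<bar>s - t\<bar> < e" if "\<bar>s - y\<bar> < e / 2" for s
          using that abs_triangle_ineq[of "s - y" "y - t"] by (simp add: dist_real_def)
        then have "\<forall>s\<in>{0..T}. \<bar>s - y\<bar> < e / 2 \<longrightarrow> H s \<le> M" using M by blast
        then have "good y" unfolding good_def
          using e by - (rule exI[of _ "e/2"], rule conjI, simp, rule exI[of _ M])
        then show "y \<in> {t. good t}" by simp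
      qed (use e in simp)
    qed
    moreover have "K = {0..T} \<inter> - {t. good t}" by (auto simp: K_def)
    ultimately show ?thesis by (simp add: closed_Int closed_Compl)
  qed
  have "K = {}"
  proof (rule ccontr)
    assume "K \<noteq> {}"
    define S where "S n = {t\<in>{0..T}. H t \<le> real n}" for n :: nat
    have "\<exists>n. \<not> K \<subseteq> closure (K - S n)"
    proof (rule ccontr)
      assume "\<not> ?thesis"
      then have dense: "K \<subseteq> closure (K - S n)" for n by blast
      have in_closure: "K \<subseteq> closure (\<Inter> (range (\<lambda>n. K - S n)))"
      proof (rule Baire[OF K_closed])
        fix U assume "U \<in> range (\<lambda>n. K - S n)"
        then obtain n where U: "U = K - S n" by blast
        have "closed (S n)" unfolding S_def by (rule clo)
        then have "openin (top_of_set K) U" unfolding U by (simp add: Diff_eq openin_open_Int open_Compl)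
        then show "openin (top_of_set K) U \<and> K \<subseteq> closure U" using dense U by simp
      qed simp
      have "\<Inter> (range (\<lambda>n. K - S n)) = {}"
      proof -
        have "t \<in> S (nat \<lceil>H t\<rceil>)" if "t \<in> K" for t
          using that by (auto simp: S_def K_def of_nat_ceiling)
        then show ?thesis by blast
      qed
      then show False using in_closure \<open>K \<noteq> {}\<close> by (simp only: closure_empty subset_empty)
    qed
    then obtain n c where c: "c \<in> K" "c \<notin> closure (K - S n)" by blast
    then obtain r where r: "r > 0" and out: "\<And>t. t \<in> K - S n \<Longrightarrow> \<not> dist t c < r"
      unfolding closure_approachable by blast
    have KH: "H t \<le> real n" if "t \<in> K" "\<bar>t - c\<bar> < r" for t
      using out[of t] that by (auto simp: S_def dist_real_def)
    have c0: "c \<in> {0..T}" using c by (simp add: K_def)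
    have "H t \<le> real n" if t: "t \<in> {0..T}" "\<bar>t - c\<bar> < r" for t
    proof (cases "t \<in> K")
      case False
      show ?thesis
      proof (cases "c \<le> t")
        case True
        let ?A = "K \<inter> {c..t}"
        define a where "a = Sup ?A"
        have A: "?A \<noteq> {}" "closed ?A" "bdd_above ?A" using c True K_closed by (auto intro: closed_Int)
        have "a \<in> ?A" unfolding a_def by (rule closed_contains_Sup[OF A(1,3,2)])
        then have a: "a \<in> K" "c \<le> a" "a \<le> t" by auto
        have a0: "0 \<le> a" using a c0 by simp
        have free: "s \<notin> K" if "a < s" "s \<le> t" for s
        proof
          assume "s \<in> K"
          then have "s \<le> a" unfolding a_def using A(3) that a by (intro cSup_upper) auto
          then show False using that by simp
        qed
        have const_right: "H s = H t" if "a < s" "s \<le> t" for s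
        proof (rule good_const)
          show "{s..t} \<inter> K = {}" using free that by auto
        qed (use that a0 t in auto)
        have "H s \<le> max (H a) (H t)" if "s \<in> {a..t}" for s
          using const_right[of s] that by (cases "s = a") auto
        then have "\<forall>s\<in>{a..t}. H s \<le> max (H a) (H t)" by blast
        from const[OF a0 _ this] have "H t = H a" using t a by auto
        moreover have "H a \<le> real n" using a t by (intro KH) auto
        ultimately show ?thesis by simp
      next
        case False
        let ?A = "K \<inter> {t..c}"
        define a where "a = Inf ?A"
        have A: "?A \<noteq> {}" "closed ?A" "bdd_below ?A" using c False K_closed by (auto intro: closed_Int)
        have "a \<in> ?A" unfolding a_def by (rule closed_contains_Inf[OF A(1,3,2)])
        then have a: "a \<in> K" "t \<le> a" "a \<le> c" by auto
        have aT: "a \<le> T" using a c0 by simp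
        have t0: "0 \<le> t" using t by simp
        have free: "s \<notin> K" if "t \<le> s" "s < a" for s
        proof
          assume "s \<in> K"
          then have "a \<le> s" unfolding a_def using A(3) that a by (intro cInf_lower) auto
          then show False using that by simp
        qed
        have const_left: "H t = H s" if "t \<le> s" "s < a" for s
        proof (rule good_const)
          show "{t..s} \<inter> K = {}" using free that by auto
        qed (use that aT t in auto)
        have "H s \<le> max (H a) (H t)" if "s \<in> {t..a}" for s
          using const_left[of s] that by (cases "s = a") auto
        then have "\<forall>s\<in>{t..a}. H s \<le> max (H a) (H t)" by blast
        from const[OF t0 aT this] have "H t = H a" using a by auto
        moreover have "H a \<le> real n" using a t False by (intro KH) auto
        ultimately show ?thesis by simp
      qed
    qed (use KH that in auto)
    then have "good c" unfolding good_def using r by blast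
    then show False using c by (simp add: K_def)
  qed
  then show ?thesis using good_const[of 0 T] T by simp
qed

section \<open>Uniqueness\<close>

text \<open>Write \<open>H(t) = e\<^bsup>t tr B\<^esup> \<integral>|w(x,t)|\<^sup>2 dx\<close> and let \<open>f\<close> be the explicit solution that agrees with \<open>w\<close> at time \<open>s\<close>. Conservation of the pairings of \<open>w\<close> with \<open>f\<close> and
of \<open>f\<close> with itself, combined with \<open>2|w f| \<le> |w|\<^sup>2 + |f|\<^sup>2\<close> at time \<open>t\<close>, gives
\<open>H(s) \<le> H(t)/2 + H(s)/2\<close>.\<close>
lemma energy_constant_if_bounded:
  fixes Q B :: "real^'n^'n"
  assumes Q: "transpose Q = Q" and cs: "classical_solution Q B \<psi> w"
    and sw: "\<And>t. t \<ge> 0 \<Longrightarrow> schwartz (\<lambda>x. w x t)"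
    and a: "0 \<le> a" and M: "\<And>t. t \<in> {a..b} \<Longrightarrow> (\<integral>x. (norm (w x t))\<^sup>2 \<partial>lborel) \<le> M"
    and s: "s \<in> {a..b}" and t: "t \<in> {a..b}"
  shows "exp (s * trace B) * (\<integral>x. (norm (w x s))\<^sup>2 \<partial>lborel) \<le> exp (t * trace B) * (\<integral>x. (norm (w x t))\<^sup>2 \<partial>lborel)"
proof -
  let ?e = "\<lambda>r. exp (r * trace B)"
  have s0: "s \<ge> 0" and t0: "t \<ge> 0" using a s t by auto
  obtain h where h: "schwartz h" and hs: "\<And>x. evol Q B h x s = w x s"
    using evol_surjective[OF Q sw[OF s0], of B s] by blast
  let ?f = "evol Q B h"
  have sf: "schwartz (\<lambda>x. ?f x r)" for r by (rule schwartz_evol[OF Q h])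
  have cf: "classical_solution Q B (\<lambda>x. ?f x 0) ?f" by (rule classical_solution_evol[OF h])
  have pair: "of_real (?e s) * (\<integral>x. u x s * cnj (?f x s) \<partial>lborel) = of_real (?e t) * (\<integral>x. u x t * cnj (?f x t) \<partial>lborel)"
    if "classical_solution Q B \<phi> u" "\<And>t. t \<ge> 0 \<Longrightarrow> schwartz (\<lambda>x. u x t)" "\<And>t. t \<in> {a..b} \<Longrightarrow> (\<integral>x. (norm (u x t))\<^sup>2 \<partial>lborel) \<le> N" for u \<phi> N
  proof (cases "s \<le> t")
    case True
    show ?thesis by (rule pairing_constant[OF Q that(1,2) h s0 True that(3)]) (use s t in auto)
  next
    case False
    then have "t \<le> s" by simp
    show ?thesis by (rule pairing_constant[OF Q that(1,2) h t0 \<open>t \<le> s\<close> that(3), symmetric]) (use s t in auto)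
  qed
  have sq: "(\<integral>x. u x * cnj (u x) \<partial>lborel) = of_real (\<integral>x. (norm (u x))\<^sup>2 \<partial>lborel)" for u :: "real^'n \<Rightarrow> complex"
    by (simp only: complex_norm_square[symmetric] integral_complex_of_real)
  have f_bdd: "\<exists>N. \<forall>r\<in>{a..b}. (\<integral>x. (norm (?f x r))\<^sup>2 \<partial>lborel) \<le> N"
  proof -
    obtain C where C: "\<And>r x. r \<in> {0..b} \<Longrightarrow> (1 + (norm x)\<^sup>2) ^ CARD('n) * (norm (?f x r) + (\<Sum>k\<in>UNIV. norm (pdiff k (\<lambda>y. ?f y r) x))) \<le> C"
      using evol_weighted_decay[OF Q h, of b "CARD('n)" B] by blast
    let ?\<omega> = "\<lambda>x::real^'n. 1 / (1 + (norm x)\<^sup>2) ^ CARD('n)"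
    have "(\<integral>x. (norm (?f x r))\<^sup>2 \<partial>lborel) \<le> (\<integral>x. C * (C * ?\<omega> x) \<partial>lborel)" if r: "r \<in> {a..b}" for r
    proof (rule integral_mono_AE')
      show "integrable lborel (\<lambda>x. C * (C * ?\<omega> x))"
        by (intro integrable_mult_right integrable_polynomial_weight)
      have r': "r \<in> {0..b}" using r a by auto
      have "(norm (?f x r))\<^sup>2 \<le> C * (C * ?\<omega> x)" for x
      proof -
        have X: "1 \<le> (1 + (norm x)\<^sup>2) ^ CARD('n)" by (rule one_le_power) simp
        have "(1 + (norm x)\<^sup>2) ^ CARD('n) * norm (?f x r) \<le> (1 + (norm x)\<^sup>2) ^ CARD('n) * (norm (?f x r) + (\<Sum>k\<in>UNIV. norm (pdiff k (\<lambda>y. ?f y r) x)))"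
          using X by (intro mult_left_mono) (auto simp: sum_nonneg)
        also have "\<dots> \<le> C" by (rule C[OF r'])
        finally have le: "(1 + (norm x)\<^sup>2) ^ CARD('n) * norm (?f x r) \<le> C" .
        have "1 * norm (?f x r) \<le> (1 + (norm x)\<^sup>2) ^ CARD('n) * norm (?f x r)" using X by (intro mult_right_mono) auto
        then have 1: "norm (?f x r) \<le> C" using le by linarith
        have 2: "norm (?f x r) \<le> C * ?\<omega> x" using le less_le_trans[OF zero_less_one X] by (simp add: pos_le_divide_eq mult.commute)
        have "norm (?f x r) * norm (?f x r) \<le> C * (C * ?\<omega> x)"
          by (rule mult_mono[OF 1 2]) (use order_trans[OF norm_ge_zero 1] in auto)
        then show ?thesis by (simp add: power2_eq_square)
      qed
      then show "AE x in lborel. (norm (?f x r))\<^sup>2 \<le> C * (C * ?\<omega> x)" "AE x in lborel. 0 \<le> C * (C * ?\<omega> x)"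
        by (auto intro: order_trans[OF zero_le_power2])
    qed
    then show ?thesis by blast
  qed
  then obtain N where N: "\<And>r. r \<in> {a..b} \<Longrightarrow> (\<integral>x. (norm (?f x r))\<^sup>2 \<partial>lborel) \<le> N" by blast
  let ?Iw = "\<lambda>r. \<integral>x. (norm (w x r))\<^sup>2 \<partial>lborel" and ?If = "\<lambda>r. \<integral>x. (norm (?f x r))\<^sup>2 \<partial>lborel"
  have "complex_of_real (?e s * ?Iw s) = of_real (?e t * ?If t)"
    using pair[OF cf sf N] by (simp only: sq hs of_real_mult)
  then have ff: "?e s * ?Iw s = ?e t * ?If t" by (simp only: of_real_eq_iff)
  have cross: "complex_of_real (?e s * ?Iw s) = of_real (?e t) * (\<integral>x. w x t * cnj (?f x t) \<partial>lborel)"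
    using pair[OF cs sw M] by (simp only: sq hs of_real_mult)
  have "0 \<le> ?e s * ?Iw s" by (intro mult_nonneg_nonneg integral_nonneg_AE) auto
  then have "?e s * ?Iw s = norm (of_real (?e t) * (\<integral>x. w x t * cnj (?f x t) \<partial>lborel))"
    unfolding cross[symmetric] norm_of_real by (simp only: abs_of_nonneg)
  also have "\<dots> \<le> ?e t * ((?Iw t + ?If t) / 2)"
  proof -
    have "norm (\<integral>x. w x t * cnj (?f x t) \<partial>lborel) \<le> (\<integral>x. norm (w x t * cnj (?f x t)) \<partial>lborel)"
      by (rule integral_norm_bound)
    also have "\<dots> \<le> (\<integral>x. ((norm (w x t))\<^sup>2 + (norm (?f x t))\<^sup>2) / 2 \<partial>lborel)"
    proof (rule integral_mono_AE')
      show "integrable lborel (\<lambda>x. ((norm (w x t))\<^sup>2 + (norm (?f x t))\<^sup>2) / 2)"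
        using schwartz_square_integrable[OF sw[OF t0]] schwartz_square_integrable[OF sf[of t]] by simp
      have "norm (w x t * cnj (?f x t)) \<le> ((norm (w x t))\<^sup>2 + (norm (?f x t))\<^sup>2) / 2" for x
        using sum_squares_bound[of "norm (w x t)" "norm (?f x t)"] by (simp add: norm_mult)
      then show "AE x in lborel. norm (w x t * cnj (?f x t)) \<le> ((norm (w x t))\<^sup>2 + (norm (?f x t))\<^sup>2) / 2" by simp
    qed auto
    also have "\<dots> = (?Iw t + ?If t) / 2"
      using schwartz_square_integrable[OF sw[OF t0]] schwartz_square_integrable[OF sf[of t]] by simp
    finally show ?thesis by (simp add: norm_mult)
  qed
  also have "\<dots> = (?e t * ?Iw t + ?e s * ?Iw s) / 2" unfolding ff by (simp add: algebra_simps add_divide_distrib)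
  finally show ?thesis by simp
qed

text \<open>The energies in balls of radius \<open>k\<close> depend continuously on time, and the energy is their supremum.\<close>
lemma energy_sublevel_closed:
  fixes B :: "real^'n^'n" and w :: "real^'n \<Rightarrow> real \<Rightarrow> complex"
  assumes cw: "continuous_on (UNIV \<times> {0..}) (\<lambda>p. w (fst p) (snd p))"
    and sw: "\<And>t. t \<ge> 0 \<Longrightarrow> schwartz (\<lambda>x. w x t)"
  shows "closed {t\<in>{0..T}. exp (t * c) * (\<integral>x. (norm (w x t))\<^sup>2 \<partial>lborel) \<le> M}"
proof -
  define J where "J k t = (\<integral>x. indicator (cball 0 (real k)) x * (norm (w x t))\<^sup>2 \<partial>lborel)" for k :: nat and t
  have sq: "integrable lborel (\<lambda>x. (norm (w x t))\<^sup>2)" if "t \<ge> 0" for t by (rule schwartz_square_integrable[OF sw[OF that]])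
  have iJ: "integrable lborel (\<lambda>x. indicator (cball 0 (real k)) x * (norm (w x t))\<^sup>2)" if "t \<ge> 0" for k t
    using integrable_mult_indicator[OF _ sq[OF that], of "cball 0 (real k)"] by simp
  have J_le: "J k t \<le> (\<integral>x. (norm (w x t))\<^sup>2 \<partial>lborel)" if "t \<ge> 0" for k t
    unfolding J_def by (intro integral_mono iJ sq that) (auto simp: indicator_def)
  have J_lim: "(\<lambda>k. J k t) \<longlonglongrightarrow> (\<integral>x. (norm (w x t))\<^sup>2 \<partial>lborel)" if "t \<ge> 0" for t
    unfolding J_def
  proof (rule integral_dominated_convergence[where w="\<lambda>x. (norm (w x t))\<^sup>2"])
    show "AE x in lborel. (\<lambda>k. indicator (cball 0 (real k)) x * (norm (w x t))\<^sup>2) \<longlonglongrightarrow> (norm (w x t))\<^sup>2"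
    proof (rule AE_I2)
      fix x :: "real^'n"
      obtain N where N: "norm x \<le> real N" using real_arch_simple by blast
      have "\<forall>\<^sub>F k in sequentially. indicator (cball 0 (real k)) x * (norm (w x t))\<^sup>2 = (norm (w x t))\<^sup>2"
        using eventually_ge_at_top[of N] by eventually_elim (use N in \<open>auto simp: indicator_def\<close>)
      then show "(\<lambda>k. indicator (cball 0 (real k)) x * (norm (w x t))\<^sup>2) \<longlonglongrightarrow> (norm (w x t))\<^sup>2"
        by (rule tendsto_eventually)
    qed
    show "AE x in lborel. norm (indicator (cball 0 (real k)) x * (norm (w x t))\<^sup>2) \<le> (norm (w x t))\<^sup>2" for k
      by (intro AE_I2) (auto simp: indicator_def)
  qed (use sq[OF that] iJ[OF that] in \<open>auto intro: borel_measurable_integrable\<close>)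
  have J_cont: "continuous_on {0..T} (J k)" for k
  proof -
    obtain C where C: "\<And>x t. x \<in> cball 0 (real k) \<Longrightarrow> t \<in> {0..T} \<Longrightarrow> norm (w x t) \<le> C"
      by (rule cylinder_bound[OF cw, of "real k" 0 T]) auto
    have c: "continuous_on {0..T} (\<lambda>t. \<integral>x. complex_of_real (indicator (cball 0 (real k)) x * (norm (w x t))\<^sup>2) \<partial>lborel)"
    proof (rule continuous_on_integral_param[where b="\<lambda>x. C\<^sup>2 * indicator (cball 0 (real k)) x"])
      show "continuous_on {0..T} (\<lambda>t. complex_of_real (indicator (cball 0 (real k)) x * (norm (w x t))\<^sup>2))" for x
        by (intro continuous_intros continuous_on_slice[OF cw]) auto
      show "(\<lambda>x. complex_of_real (indicator (cball 0 (real k)) x * (norm (w x t))\<^sup>2)) \<in> borel_measurable lborel" if "t \<in> {0..T}" for t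
        using that by (intro borel_measurable_integrable integrable_of_real iJ) auto
      show "norm (complex_of_real (indicator (cball 0 (real k)) x * (norm (w x t))\<^sup>2)) \<le> C\<^sup>2 * indicator (cball 0 (real k)) x" if "t \<in> {0..T}" for t x
      proof (cases "x \<in> cball 0 (real k)")
        case True
        then have "(norm (w x t))\<^sup>2 \<le> C\<^sup>2" using C[OF True that] by (intro power_mono) auto
        then show ?thesis using True by (simp add: norm_power)
      qed simp
    qed (rule integrable_cball_const)
    have "continuous_on {0..T} (\<lambda>t. complex_of_real (J k t))"
      using c unfolding integral_complex_of_real J_def[symmetric] .
    from continuous_on_Re[OF this] show ?thesis by simp
  qed
  have "{t\<in>{0..T}. exp (t * c) * (\<integral>x. (norm (w x t))\<^sup>2 \<partial>lborel) \<le> M} = (\<Inter>k. {t\<in>{0..T}. exp (t * c) * J k t \<le> M})" (is "?L = ?R")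
  proof (intro equalityI subsetI)
    fix t assume t: "t \<in> ?L"
    have "exp (t * c) * J k t \<le> M" for k
    proof -
      have "exp (t * c) * J k t \<le> exp (t * c) * (\<integral>x. (norm (w x t))\<^sup>2 \<partial>lborel)"
        using t by (intro mult_left_mono J_le) auto
      also have "\<dots> \<le> M" using t by simp
      finally show ?thesis .
    qed
    then show "t \<in> ?R" using t by simp
  next
    fix t assume t: "t \<in> ?R"
    then have t0: "t \<in> {0..T}" and le: "\<And>k. exp (t * c) * J k t \<le> M" by auto
    have "(\<lambda>k. exp (t * c) * J k t) \<longlonglongrightarrow> exp (t * c) * (\<integral>x. (norm (w x t))\<^sup>2 \<partial>lborel)"
      using t0 by (intro tendsto_intros J_lim) auto
    then have "exp (t * c) * (\<integral>x. (norm (w x t))\<^sup>2 \<partial>lborel) \<le> M"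
      by (rule LIMSEQ_le_const2) (use le in blast)
    then show "t \<in> ?L" using t0 by simp
  qed
  moreover have "closed {t\<in>{0..T}. exp (t * c) * J k t \<le> M}" for k
    by (rule continuous_on_closed_Collect_le) (intro continuous_intros J_cont, simp_all)
  ultimately show ?thesis by auto
qed

theorem zero_initial_data_unique:
  fixes Q B :: "real^'n^'n"
  assumes Q: "transpose Q = Q" and cs: "classical_solution Q B (\<lambda>x. 0) w"
    and sw: "\<And>t. t \<ge> 0 \<Longrightarrow> schwartz (\<lambda>x. w x t)" and T: "T \<ge> 0"
  shows "w x T = 0"
proof -
  define H where "H t = exp (t * trace B) * (\<integral>x. (norm (w x t))\<^sup>2 \<partial>lborel)" for t
  have cw: "continuous_on (UNIV \<times> {0..}) (\<lambda>p. w (fst p) (snd p))"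
    using cs unfolding classical_solution_def case_prod_unfold by blast
  have "H T = H 0"
  proof (rule bounded_interval_constancy_extends[OF T])
    show "closed {t\<in>{0..T}. H t \<le> M}" for M
      unfolding H_def by (rule energy_sublevel_closed[OF cw sw])
    fix a b M assume a: "0 \<le> a" and b: "b \<le> T" and HM: "\<forall>t\<in>{a..b}. H t \<le> M"
    have M: "(\<integral>x. (norm (w x t))\<^sup>2 \<partial>lborel) \<le> exp (b * \<bar>trace B\<bar>) * M" if t: "t \<in> {a..b}" for t
    proof -
      have "- (t * trace B) = t * (- trace B)" by simp
      also have "\<dots> \<le> t * \<bar>trace B\<bar>" using t a by (intro mult_left_mono) auto
      also have "\<dots> \<le> b * \<bar>trace B\<bar>" using t by (intro mult_right_mono) auto
      finally have e: "exp (- (t * trace B)) \<le> exp (b * \<bar>trace B\<bar>)" by simp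
      have "0 \<le> H t" unfolding H_def by (intro mult_nonneg_nonneg integral_nonneg_AE) auto
      have "(\<integral>x. (norm (w x t))\<^sup>2 \<partial>lborel) = exp (- (t * trace B)) * H t"
        unfolding H_def by (simp add: mult.assoc[symmetric] exp_add[symmetric])
      also have "\<dots> \<le> exp (b * \<bar>trace B\<bar>) * M"
        using e HM t \<open>0 \<le> H t\<close> by (intro mult_mono) auto
      finally show ?thesis .
    qed
    show "\<forall>s\<in>{a..b}. \<forall>t\<in>{a..b}. H s = H t"
      unfolding H_def by (intro ballI antisym energy_constant_if_bounded[OF Q cs sw a M])
  qed
  also have "H 0 = 0" using cs unfolding H_def classical_solution_def by simp
  finally have "(\<integral>x. (norm (w x T))\<^sup>2 \<partial>lborel) = 0" unfolding H_def by simp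
  then have "AE x in lborel. (norm (w x T))\<^sup>2 = 0"
    by (subst (asm) integral_nonneg_eq_0_iff_AE) (use schwartz_square_integrable[OF sw[OF T]] in auto)
  then have ae: "AE x in lborel. w x T = 0" by simp
  let ?U = "{x. w x T \<noteq> 0}"
  have "open ?U"
    by (intro open_Collect_neq schwartz_continuous[OF sw[OF T]] continuous_on_const)
  moreover have "?U \<in> null_sets lborel"
  proof -
    have "?U \<in> sets lborel" using \<open>open ?U\<close> by simp
    from AE_iff_null_sets[OF this] show ?thesis using ae by simp
  qed
  then have "negligible ?U"
    unfolding negligible_iff_null_sets by (rule null_sets_completionI)
  ultimately have "?U = {}" using open_not_negligible by blast
  then show ?thesis by auto
qed

theorem proposition2p4:
  fixes Q B :: "real^'n^'n" and \<phi> :: "real^'n \<Rightarrow> complex"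
  assumes Q_sym: "transpose Q = Q"
    and Q_nonneg: "pos_semidefinite Q"
    and Qt_pos: "\<And>t. t > 0 \<Longrightarrow> pos_definite (Qt Q B t)"
    and phi: "schwartz \<phi>"
  shows "classical_solution Q B \<phi> (sol Q B \<phi>)
    \<and> (\<forall>t\<ge>0. schwartz (\<lambda>x. sol Q B \<phi> x t))
    \<and> (\<forall>g. classical_solution Q B \<phi> g \<and> (\<forall>t\<ge>0. schwartz (\<lambda>x. g x t))
          \<longrightarrow> (\<forall>x. \<forall>t\<ge>0. g x t = sol Q B \<phi> x t))"
proof -
  let ?h = "initial_amplitude \<phi>"
  have h: "schwartz ?h" by (rule schwartz_initial_amplitude[OF phi])
  have eq: "sol Q B \<phi> x t = evol Q B ?h x t" if "t \<ge> 0" for x t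
    by (rule sol_eq_evol[OF Q_sym Qt_pos phi that])
  have "evol Q B ?h x 0 = \<phi> x" for x
    using eq[of 0 x] by (simp add: sol_def)
  then have "(\<lambda>x. evol Q B ?h x 0) = \<phi>" by (rule ext)
  then have cs: "classical_solution Q B \<phi> (sol Q B \<phi>)"
    using classical_solution_cong[OF classical_solution_evol[OF h, of Q B] eq] by simp
  have ss: "schwartz (\<lambda>x. sol Q B \<phi> x t)" if "t \<ge> 0" for t
    using schwartz_evol[OF Q_sym h] eq[OF that] by simp
  have "g x t = sol Q B \<phi> x t" if g: "classical_solution Q B \<phi> g" "\<forall>t\<ge>0. schwartz (\<lambda>x. g x t)" and t: "t \<ge> 0" for g x t
  proof -
    have "schwartz (\<lambda>x. g x r - sol Q B \<phi> x r)" if "r \<ge> 0" for r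
      using schwartz_add[of "\<lambda>x. g x r" "\<lambda>x. (-1) * sol Q B \<phi> x r"] schwartz_cmult[OF ss[OF that], of "-1"] g(2) that by simp
    then have "g x t - sol Q B \<phi> x t = 0"
      by (rule zero_initial_data_unique[OF Q_sym classical_solution_diff[OF g(1) cs] _ t])
    then show ?thesis by simp
  qed
  with cs ss show ?thesis by blast
qed

end
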